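(* Let $F=\alpha\phi(\beta/\alpha)$ be an $(\alpha,\beta)$-metric on a manifold $M$ of dimension $n\ge3$, where $\alpha=\sqrt{a_{ij}(x)y^iy^j}$ is Riemannian, $\beta=b_i(x)y^i$ is a 1-form, and $\phi(0)=1$. Assume that $F$ is not of Randers type and that $\beta$ is not parallel with respect to $\alpha$. Suppose that $F$ is of scalar flag curvature and that, for some constants $k_1,k_2,k_3$ with $k_2\neq k_1k_3$ and some scalar functions $\lambda=\lambda(x)$, $\tau=\tau(x)$ on $M$, $$b_{i|j}=\tau\big\{(1+k_1b^2)a_{ij}+(k_2b^2+k_3)b_ib_j\big\},\qquad b^2:=\|\beta\|_\alpha^2,$$ $$\bar R^i_{\ k}=\lambda(\alpha^2\delta^i_k-y^iy_k)+\eta\big(\beta^2\delta^i_k+\alpha^2b^ib_k-\beta b^iy_k-\beta b_ky^i\big),$$ $$\tau_{x^i}=q\,b_i,$$ where $$\eta:=\big\{k_1^2+k_2-2k_1k_3-k_1(k_2-k_1^2)b^2\big\}\tau^2+k_1\lambda,\qquad q:=(k_3-2k_1-k_1^2b^2)\tau^2-\lambda.$$ Then $\phi(s)$ must satisfy $$\big\{1+(k_1+k_3)s^2+k_2s^4\big\}\phi''(s)=(k_1+k_2s^2)\big\{\phi(s)-s\phi'(s)\big\}.$$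
   Context: An $(\alpha,\beta)$-metric is a Finsler metric $F=\alpha\phi(s)$, $s=\beta/\alpha$, where $\alpha$ is a Riemannian metric, $\beta$ is a 1-form, and $\phi>0$ is a $C^\infty$ function on $(-b_o,b_o)$ with $b:=\|\beta\|_\alpha<b_o$. All $(\alpha,\beta)$-metrics are assumed regular: $\phi(s)-s\phi'(s)+(b^2-s^2)\phi''(s)>0$ for $|s|\le b<b_o$. $F=\alpha\phi(s)$ is of Randers type if $\phi(s)=a_1s+\sqrt{1+ks^2}$ for some constants $a_1,k$. Indices are raised and lowered with $a_{ij}$: $b^i=a^{ij}b_j$, $y_k=a_{kj}y^j$. $b_{i|j}$ are the covariant derivatives of $\beta$ with respect to $\alpha$. For a Finsler metric $F$, set $G^i=\frac14 g^{il}\{[F^2]_{x^ky^l}y^k-[F^2]_{x^l}\}$, where $g_{ij}=\frac12[F^2]_{y^iy^j}$ and $(g^{ij})=(g_{ij})^{-1}$, and $R^i_{\ k}=2\frac{\partial G^i}{\partial x^k}-y^j\frac{\partial^2G^i}{\partial x^j\partial y^k}+2G^j\frac{\partial^2G^i}{\partial y^j\partial y^k}-\frac{\partial G^i}{\partial y^j}\frac{\partial G^j}{\partial y^k}$; $\bar R^i_{\ k}$ is this quantity for $F=\alpha$. $F$ is of scalar flag curvature if $R^i_{\ k}=\mathbf{K}F^2(\delta^i_k-F^{-1}y^iF_{y^k})$ for a scalar function $\mathbf{K}=\mathbf{K}(x,y)$.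
   Formalization: M is assumed connected (otherwise φ could be altered freely on a component where β is parallel with larger norm), and "not of Randers type" and the equation for φ(s) are read at the values s=β/α actually attained, since φ is undetermined by F elsewhere. *)

theory Defs
  imports "HOL-Analysis.Analysis"
begin

definition dir_deriv ::
    "'a::real_normed_vector \<Rightarrow> ('a \<Rightarrow> 'b::real_normed_vector) \<Rightarrow> 'a \<Rightarrow> 'b" where
  "dir_deriv v f x = frechet_derivative f (at x) v"

primrec iter_deriv ::
    "'a::real_normed_vector list \<Rightarrow> ('a \<Rightarrow> 'b::real_normed_vector) \<Rightarrow> 'a \<Rightarrow> 'b" where
  "iter_deriv [] f = f"
| "iter_deriv (v # vs) f = dir_deriv v (iter_deriv vs f)"

text \<open>Used only for open \<open>S\<close> in finite-dimensional spaces, where it is the usual \<open>C\<^sup>\<infinity>\<close>.\<close>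

definition smooth_on ::
    "'a::real_normed_vector set \<Rightarrow> ('a \<Rightarrow> 'b::real_normed_vector) \<Rightarrow> bool" where
  "smooth_on S f \<longleftrightarrow> (\<forall>vs. \<forall>x\<in>S. iter_deriv vs f differentiable (at x))"

definition pd :: "'n::finite \<Rightarrow> (real^'n \<Rightarrow> real) \<Rightarrow> real^'n \<Rightarrow> real" where
  "pd i f = dir_deriv (axis i 1) f"

definition kron :: "'n \<Rightarrow> 'n \<Rightarrow> real" where
  "kron i k = (if i = k then 1 else 0)"

text \<open>A chart is a pair of its domain and its coordinate map. The dimension of the manifold is
  \<open>CARD('n)\<close>.\<close>

type_synonym ('m, 'n) chart = "'m set \<times> ('m \<Rightarrow> real^'n)"

definition chart_image :: "('m, 'n::finite) chart \<Rightarrow> (real^'n) set" where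
  "chart_image c = snd c ` fst c"

definition chart_inv :: "('m, 'n::finite) chart \<Rightarrow> real^'n \<Rightarrow> 'm" where
  "chart_inv c = inv_into (fst c) (snd c)"

definition overlap :: "('m, 'n::finite) chart \<Rightarrow> ('m, 'n) chart \<Rightarrow> (real^'n) set" where
  "overlap c d = snd c ` (fst c \<inter> fst d)"

definition transition ::
    "('m, 'n::finite) chart \<Rightarrow> ('m, 'n) chart \<Rightarrow> real^'n \<Rightarrow> real^'n" where
  "transition c d = snd d \<circ> chart_inv c"

definition transition_deriv ::
    "('m, 'n::finite) chart \<Rightarrow> ('m, 'n) chart \<Rightarrow> real^'n \<Rightarrow> real^'n \<Rightarrow> real^'n" where
  "transition_deriv c d x = frechet_derivative (transition c d) (at x)"

definition smooth_manifold :: "'m topology \<Rightarrow> ('m, 'n::finite) chart set \<Rightarrow> bool" where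
  "smooth_manifold M A \<longleftrightarrow>
     Hausdorff_space M \<and> second_countable M \<and> topspace M = \<Union> (fst ` A) \<and>
     (\<forall>c\<in>A. openin M (fst c) \<and> open (chart_image c) \<and>
        homeomorphic_map (subtopology M (fst c)) (top_of_set (chart_image c)) (snd c)) \<and>
     (\<forall>c\<in>A. \<forall>d\<in>A. smooth_on (overlap c d) (transition c d))"

definition smooth_function :: "('m, 'n::finite) chart set \<Rightarrow> ('m \<Rightarrow> real) \<Rightarrow> bool" where
  "smooth_function A h \<longleftrightarrow> (\<forall>c\<in>A. smooth_on (chart_image c) (h \<circ> chart_inv c))"

text \<open>Tensor fields, and functions on the tangent bundle, are families of coordinate expressions
  indexed by the charts of the atlas, subject to the usual transformation rules.\<close>

type_synonym ('m, 'n) tangent_fun = "('m, 'n) chart \<Rightarrow> real^'n \<Rightarrow> real^'n \<Rightarrow> real"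
type_synonym ('m, 'n) form1 = "('m, 'n) chart \<Rightarrow> real^'n \<Rightarrow> real^'n"
type_synonym ('m, 'n) form2 = "('m, 'n) chart \<Rightarrow> real^'n \<Rightarrow> real^'n^'n"

definition tangent_function ::
    "('m, 'n::finite) chart set \<Rightarrow> ('m, 'n) tangent_fun \<Rightarrow> bool" where
  "tangent_function A f \<longleftrightarrow>
     (\<forall>c\<in>A. \<forall>d\<in>A. \<forall>x\<in>overlap c d. \<forall>y. y \<noteq> 0 \<longrightarrow>
        f c x y = f d (transition c d x) (transition_deriv c d x y))"

definition one_form :: "('m, 'n::finite) chart set \<Rightarrow> ('m, 'n) form1 \<Rightarrow> bool" where
  "one_form A b \<longleftrightarrow>
     (\<forall>c\<in>A. smooth_on (chart_image c) (b c)) \<and>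
     (\<forall>c\<in>A. \<forall>d\<in>A. \<forall>x\<in>overlap c d. \<forall>u.
        b c x \<bullet> u = b d (transition c d x) \<bullet> transition_deriv c d x u)"

definition riemannian_metric :: "('m, 'n::finite) chart set \<Rightarrow> ('m, 'n) form2 \<Rightarrow> bool" where
  "riemannian_metric A a \<longleftrightarrow>
     (\<forall>c\<in>A. smooth_on (chart_image c) (a c)) \<and>
     (\<forall>c\<in>A. \<forall>x\<in>chart_image c. transpose (a c x) = a c x \<and> (\<forall>y. y \<noteq> 0 \<longrightarrow> y \<bullet> (a c x *v y) > 0)) \<and>
     (\<forall>c\<in>A. \<forall>d\<in>A. \<forall>x\<in>overlap c d. \<forall>u v.
        u \<bullet> (a c x *v v) =
        transition_deriv c d x u \<bullet> (a d (transition c d x) *v transition_deriv c d x v))"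

definition dx :: "'n::finite \<Rightarrow> (real^'n \<Rightarrow> real^'n \<Rightarrow> real) \<Rightarrow> real^'n \<Rightarrow> real^'n \<Rightarrow> real" where
  "dx k f x y = pd k (\<lambda>z. f z y) x"

definition dy :: "'n::finite \<Rightarrow> (real^'n \<Rightarrow> real^'n \<Rightarrow> real) \<Rightarrow> real^'n \<Rightarrow> real^'n \<Rightarrow> real" where
  "dy k f x y = pd k (\<lambda>z. f x z) y"

definition sq :: "(real^'n \<Rightarrow> real^'n \<Rightarrow> real) \<Rightarrow> real^'n \<Rightarrow> real^'n \<Rightarrow> real" where
  "sq F x y = (F x y)\<^sup>2"

definition fund_tensor ::
    "(real^'n \<Rightarrow> real^'n \<Rightarrow> real) \<Rightarrow> real^'n \<Rightarrow> real^'n \<Rightarrow> real^'n::finite^'n" where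
  "fund_tensor F x y = (\<chi> i j. 1/2 * dy j (dy i (sq F)) x y)"

definition spray ::
    "(real^'n \<Rightarrow> real^'n \<Rightarrow> real) \<Rightarrow> 'n::finite \<Rightarrow> real^'n \<Rightarrow> real^'n \<Rightarrow> real" where
  "spray F i x y =
     1/4 * (\<Sum>l\<in>UNIV. matrix_inv (fund_tensor F x y) $ i $ l *
        ((\<Sum>k\<in>UNIV. dy l (dx k (sq F)) x y * y $ k) - dx l (sq F) x y))"

definition riemann_curv ::
    "(real^'n \<Rightarrow> real^'n \<Rightarrow> real) \<Rightarrow> 'n::finite \<Rightarrow> 'n \<Rightarrow> real^'n \<Rightarrow> real^'n \<Rightarrow> real" where
  "riemann_curv F i k x y =
     2 * dx k (spray F i) x y
     - (\<Sum>j\<in>UNIV. y $ j * dx j (dy k (spray F i)) x y)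
     + 2 * (\<Sum>j\<in>UNIV. spray F j x y * dy j (dy k (spray F i)) x y)
     - (\<Sum>j\<in>UNIV. dy j (spray F i) x y * dy k (spray F j) x y)"

definition finsler_metric ::
    "('m, 'n::finite) chart set \<Rightarrow> ('m, 'n) tangent_fun \<Rightarrow> bool" where
  "finsler_metric A F \<longleftrightarrow>
     tangent_function A F \<and>
     (\<forall>c\<in>A. smooth_on (chart_image c \<times> (- {0})) (\<lambda>(x, y). F c x y)) \<and>
     (\<forall>c\<in>A. \<forall>x\<in>chart_image c.
        (\<forall>y t. t > 0 \<longrightarrow> F c x (t *\<^sub>R y) = t * F c x y) \<and>
        (\<forall>y. y \<noteq> 0 \<longrightarrow> F c x y > 0 \<and>
           (\<forall>v. v \<noteq> 0 \<longrightarrow> v \<bullet> (fund_tensor (F c) x y *v v) > 0)))"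

definition scalar_flag_curvature ::
    "('m, 'n::finite) chart set \<Rightarrow> ('m, 'n) tangent_fun \<Rightarrow> bool" where
  "scalar_flag_curvature A F \<longleftrightarrow>
     (\<exists>K. tangent_function A K \<and>
        (\<forall>c\<in>A. \<forall>x\<in>chart_image c. \<forall>y. y \<noteq> 0 \<longrightarrow> (\<forall>i k.
           riemann_curv (F c) i k x y =
           K c x y * (F c x y)\<^sup>2 * (kron i k - y $ i / F c x y * dy k (F c) x y))))"

definition alpha :: "('m, 'n::finite) form2 \<Rightarrow> ('m, 'n) tangent_fun" where
  "alpha a c x y = sqrt (\<Sum>i\<in>UNIV. \<Sum>j\<in>UNIV. a c x $ i $ j * y $ i * y $ j)"

definition beta :: "('m, 'n::finite) form1 \<Rightarrow> ('m, 'n) tangent_fun" where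
  "beta b c x y = (\<Sum>i\<in>UNIV. b c x $ i * y $ i)"

definition b_up ::
    "('m, 'n::finite) form2 \<Rightarrow> ('m, 'n) form1 \<Rightarrow> ('m, 'n) chart \<Rightarrow> real^'n \<Rightarrow> 'n \<Rightarrow> real" where
  "b_up a b c x i = (\<Sum>j\<in>UNIV. matrix_inv (a c x) $ i $ j * b c x $ j)"

definition y_low ::
    "('m, 'n::finite) form2 \<Rightarrow> ('m, 'n) chart \<Rightarrow> real^'n \<Rightarrow> real^'n \<Rightarrow> 'n \<Rightarrow> real" where
  "y_low a c x y k = (\<Sum>j\<in>UNIV. a c x $ k $ j * y $ j)"

definition normsq ::
    "('m, 'n::finite) form2 \<Rightarrow> ('m, 'n) form1 \<Rightarrow> ('m, 'n) chart \<Rightarrow> real^'n \<Rightarrow> real" where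
  "normsq a b c x = (\<Sum>i\<in>UNIV. b_up a b c x i * b c x $ i)"

definition christoffel ::
    "('m, 'n::finite) form2 \<Rightarrow> ('m, 'n) chart \<Rightarrow> 'n \<Rightarrow> 'n \<Rightarrow> 'n \<Rightarrow> real^'n \<Rightarrow> real" where
  "christoffel a c k i j x =
     1/2 * (\<Sum>l\<in>UNIV. matrix_inv (a c x) $ k $ l *
        (pd i (\<lambda>z. a c z $ l $ j) x + pd j (\<lambda>z. a c z $ l $ i) x - pd l (\<lambda>z. a c z $ i $ j) x))"

text \<open>\<open>cov_deriv a b c i j\<close> is \<open>b\<close> with indices \<open>i|j\<close>: the second index is the direction of
  differentiation.\<close>

definition cov_deriv ::
    "('m, 'n::finite) form2 \<Rightarrow> ('m, 'n) form1 \<Rightarrow> ('m, 'n) chart \<Rightarrow> 'n \<Rightarrow> 'n \<Rightarrow> real^'n \<Rightarrow> real" where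
  "cov_deriv a b c i j x =
     pd j (\<lambda>z. b c z $ i) x - (\<Sum>k\<in>UNIV. christoffel a c k i j x * b c x $ k)"

definition parallel ::
    "('m, 'n::finite) chart set \<Rightarrow> ('m, 'n) form2 \<Rightarrow> ('m, 'n) form1 \<Rightarrow> bool" where
  "parallel A a b \<longleftrightarrow> (\<forall>c\<in>A. \<forall>x\<in>chart_image c. \<forall>i j. cov_deriv a b c i j x = 0)"

definition ab_metric ::
    "('m, 'n::finite) form2 \<Rightarrow> ('m, 'n) form1 \<Rightarrow> (real \<Rightarrow> real) \<Rightarrow> ('m, 'n) tangent_fun" where
  "ab_metric a b \<phi> c x y = alpha a c x y * \<phi> (beta b c x y / alpha a c x y)"

text \<open>The bound \<open>b\<^sub>o\<close> may be infinite. Only the values of \<open>\<phi>\<close> on \<open>(-b\<^sub>o, b\<^sub>o)\<close> matter. In the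
  regularity condition \<open>b\<close> is the norm of \<open>\<beta>\<close> at the point under consideration.\<close>

definition alpha_beta_metric ::
    "('m, 'n::finite) chart set \<Rightarrow> ('m, 'n) form2 \<Rightarrow> ('m, 'n) form1 \<Rightarrow> (real \<Rightarrow> real) \<Rightarrow> ereal \<Rightarrow> bool" where
  "alpha_beta_metric A a b \<phi> bo \<longleftrightarrow>
     riemannian_metric A a \<and> one_form A b \<and>
     smooth_on {s. ereal \<bar>s\<bar> < bo} \<phi> \<and> (\<forall>s. ereal \<bar>s\<bar> < bo \<longrightarrow> \<phi> s > 0) \<and>
     (\<forall>c\<in>A. \<forall>x\<in>chart_image c.
        ereal (sqrt (normsq a b c x)) < bo \<and>
        (\<forall>s. \<bar>s\<bar> \<le> sqrt (normsq a b c x) \<longrightarrow>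
           \<phi> s - s * deriv \<phi> s + (normsq a b c x - s\<^sup>2) * deriv (deriv \<phi>) s > 0)) \<and>
     finsler_metric A (ab_metric a b \<phi>)"

text \<open>The metric determines \<open>\<phi>\<close> only on the set of values taken by \<open>s = \<beta>/\<alpha>\<close> on nonzero tangent
  vectors, i.e. on the union over all points of the intervals \<open>[-b, b]\<close>. Identities for \<open>\<phi>(s)\<close> are
  identities on this set; outside it \<open>\<phi>\<close> can be changed without changing \<open>F\<close>.\<close>

definition s_values ::
    "('m, 'n::finite) chart set \<Rightarrow> ('m, 'n) form2 \<Rightarrow> ('m, 'n) form1 \<Rightarrow> real set" where
  "s_values A a b =
     {beta b c x y / alpha a c x y | c x y. c \<in> A \<and> x \<in> chart_image c \<and> y \<noteq> 0}"

definition randers_type ::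
    "('m, 'n::finite) chart set \<Rightarrow> ('m, 'n) form2 \<Rightarrow> ('m, 'n) form1 \<Rightarrow> (real \<Rightarrow> real) \<Rightarrow> bool" where
  "randers_type A a b \<phi> \<longleftrightarrow>
     (\<exists>a1 k. \<forall>s\<in>s_values A a b. 1 + k * s\<^sup>2 > 0 \<and> \<phi> s = a1 * s + sqrt (1 + k * s\<^sup>2))"

text \<open>The functions \<open>\<eta>\<close> and \<open>q\<close>, as expressions in the values \<open>B = b\<^sup>2\<close>, \<open>t = \<tau>\<close>, \<open>l = \<lambda>\<close>.\<close>

definition eta_coeff :: "real \<Rightarrow> real \<Rightarrow> real \<Rightarrow> real \<Rightarrow> real \<Rightarrow> real \<Rightarrow> real" where
  "eta_coeff k1 k2 k3 B t l =
     (k1\<^sup>2 + k2 - 2 * k1 * k3 - k1 * (k2 - k1\<^sup>2) * B) * t\<^sup>2 + k1 * l"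

definition q_coeff :: "real \<Rightarrow> real \<Rightarrow> real \<Rightarrow> real \<Rightarrow> real \<Rightarrow> real" where
  "q_coeff k1 k3 B t l = (k3 - 2 * k1 - k1\<^sup>2 * B) * t\<^sup>2 - l"

end

theory Submission
  imports Defs
begin

text \<open>Write \<open>B = b\<^sup>2\<close>, \<open>u = 1 + k1 B\<close>, \<open>v = k2 B + k3\<close>, \<open>\<rho> = \<phi>''/(\<phi> - s \<phi>')\<close>, and
  \<open>N = 1 + (B - s\<^sup>2) \<rho>\<close>. With \<open>D(B) = 1 + (k1 + k3) B + k2 B\<^sup>2\<close> and \<open>\<kappa> = k1 + k2 s\<^sup>2\<close> the theorem
  asserts that \<open>\<sigma> = D(s\<^sup>2) \<rho> - \<kappa>\<close> vanishes.

  The right-hand side of the hypothesis on \<open>b\<^bsub>i|j\<^esub>\<close> is symmetric, so \<open>\<beta>\<close> is closed, and the spray of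
  \<open>F\<close> is that of \<open>\<alpha>\<close> plus \<open>P y + T b\<close> with \<open>T = \<tau> \<alpha>\<^sup>2 h\<close> and \<open>h = (u + v s\<^sup>2) \<rho>/(2 N)\<close>
  (\<open>spray_F\<close>). The term \<open>P y\<close> is a projective change and contributes to \<open>R\<^sup>i\<^sub>k\<close> only multiples of
  \<open>\<delta>\<^sup>i\<^sub>k\<close> and \<open>y\<^sup>i\<close>, as does the right-hand side of the condition of scalar flag curvature. Contracting
  with a covector and a vector that annihilate such terms leaves one scalar equation for \<open>h\<close> as a
  function of \<open>s\<close> and \<open>B\<close>, which involves \<open>x\<close> only through \<open>B\<close> and \<open>\<mu> = \<lambda>/\<tau>\<^sup>2\<close>
  (\<open>equation_at_unit\<close>). The function \<open>\<kappa>/2\<close> solves it for every \<open>\<mu>\<close>, and \<open>h = \<kappa>/2 + \<sigma>/(2 N)\<close>. So the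
  equation \<open>E = 0\<close> is homogeneous in \<open>f = \<sigma>/(2 N)\<close>.

  It remains to solve this equation. Suppose that \<open>B\<close> takes infinitely many values near some value.
  Multiplied by \<open>4 N\<^sup>4\<close>, the equation is polynomial in \<open>B\<close> except for the unknown function \<open>\<mu>\<close> of the
  point, which does not depend on \<open>s\<close> and can be eliminated between two values of \<open>s\<close>. Unless
  \<open>\<sigma> W = 0\<close>, where \<open>W = \<rho>' + 2 s \<rho>\<^sup>2\<close>, the function \<open>\<mu>\<close> would have a double pole at the zero
  \<open>s\<^sup>2 - 1/\<rho>\<close> of \<open>N\<close>. Hence this zero is locally constant, and differentiating it gives \<open>W = 0\<close>
  after all (\<open>sig_W_eq_0\<close>). The alternatives \<open>\<sigma> = 0\<close> and \<open>W = 0\<close> cannot be glued smoothly, since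
  \<open>k2 \<noteq> k1 k3\<close> makes the zeros of \<open>\<sigma>\<close> simple where \<open>W = 0\<close> (\<open>sig_or_W\<close>, \<open>no_mixing_at_0\<close>). The solutions
  of \<open>W = 0\<close> are those with \<open>\<rho> (1 + k s\<^sup>2) = k\<close>, which give the functions of Randers type.

  Because \<open>d B = 2 \<tau> D(B) \<beta>\<close>, the function \<open>B\<close> can fail to vary where \<open>\<tau> \<noteq> 0\<close> only if \<open>D(B) = 0\<close>.
  For such \<open>B\<close> the derivatives with respect to \<open>B\<close> drop out of the equation. What is left is an
  ordinary differential equation in \<open>s\<close> for \<open>\<rho>/N\<close>, singular at \<open>s = \<plusminus> b\<close>, whose only solutions that
  are smooth on \<open>[-b, b]\<close> are constant (\<open>degenerate_case\<close>); these again are of Randers type.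

  The equation is available only at points with \<open>\<tau> \<noteq> 0\<close>. A value of \<open>b\<close> larger than all those at such
  points would be attained on an open and closed set on which \<open>\<tau> = 0\<close>, contrary to the assumption that
  \<open>\<beta>\<close> is not parallel (\<open>BB_cofinal\<close>). So continuity in \<open>s\<close> gives the conclusion on all values of
  \<open>\<beta>/\<alpha>\<close>.\<close>

section \<open>Partial derivatives and smooth functions\<close>

lemma dir_deriv_eqI: "(f has_derivative f') (at x) \<Longrightarrow> dir_deriv v f x = f' v"
  unfolding dir_deriv_def by (metis frechet_derivative_at)

lemma pd_eqI: "(f has_derivative f') (at x) \<Longrightarrow> pd i f x = f' (axis i 1)"
  unfolding pd_def by (rule dir_deriv_eqI)

lemma linear_sum_axis:
  fixes f :: "real^'n::finite \<Rightarrow> real"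
  assumes "linear f"
  shows "(\<Sum>k\<in>UNIV. f (axis k 1) * w $ k) = f w"
proof -
  have "f w = f (\<Sum>k\<in>UNIV. (w $ k) *\<^sub>R axis k 1)"
    using basis_expansion[of w] by (simp add: scalar_mult_eq_scaleR)
  also have "\<dots> = (\<Sum>k\<in>UNIV. f (axis k 1) * w $ k)"
    using assms by (simp add: linear_sum linear_cmul mult.commute)
  finally show ?thesis by simp
qed

lemma has_derivative_sum_axis:
  fixes f :: "real^'n::finite \<Rightarrow> real"
  assumes "(f has_derivative f') (at x)"
  shows "(\<Sum>k\<in>UNIV. pd k f x * w $ k) = f' w"
  using linear_sum_axis[OF has_derivative_linear[OF assms], of w] pd_eqI[OF assms] by simp

text \<open>\<^const>\<open>iter_deriv\<close> applies the last vector of the list first, so derivatives of a smooth function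
  are smooth by appending to the list.\<close>

lemma iter_deriv_snoc: "iter_deriv (vs @ [v]) f = iter_deriv vs (dir_deriv v f)"
  by (induction vs) auto

lemma smooth_on_differentiable: "smooth_on S f \<Longrightarrow> x \<in> S \<Longrightarrow> f differentiable (at x)"
  unfolding smooth_on_def by (metis iter_deriv.simps(1))

lemma smooth_on_dir_deriv: "smooth_on S f \<Longrightarrow> smooth_on S (dir_deriv v f)"
  unfolding smooth_on_def by (metis iter_deriv_snoc)

lemma differentiable_transform_open:
  assumes "f differentiable (at x)" "open S" "x \<in> S" "\<And>z. z \<in> S \<Longrightarrow> f z = g z"
  shows "g differentiable (at x)"
  using assms unfolding differentiable_def by (metis has_derivative_transform_within_open)

lemma dir_deriv_cong_open:
  assumes "f differentiable (at x)" "open S" "x \<in> S" "\<And>z. z \<in> S \<Longrightarrow> f z = g z"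
  shows "dir_deriv v f x = dir_deriv v g x"
  unfolding dir_deriv_def
  using frechet_derivative_transform_within_open[OF assms(1,2,3)] assms(4) by auto

lemma smooth_on_cong_open:
  assumes S: "open S" and sm: "smooth_on S f" and eq: "\<And>z. z \<in> S \<Longrightarrow> f z = g z"
  shows "smooth_on S g"
proof -
  have "\<forall>z\<in>S. iter_deriv vs f z = iter_deriv vs g z" for vs
  proof (induction vs)
    case (Cons v vs)
    then show ?case
      using sm dir_deriv_cong_open[OF _ S, of "iter_deriv vs f" _ "iter_deriv vs g" v]
      unfolding smooth_on_def by auto
  qed (simp add: eq)
  then show ?thesis
    using sm S unfolding smooth_on_def by (metis differentiable_transform_open)
qed

lemma smooth_on_deriv:
  fixes f :: "real \<Rightarrow> real"
  assumes "open S" "smooth_on S f"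
  shows "smooth_on S (deriv f)"
proof (rule smooth_on_cong_open[OF assms(1) smooth_on_dir_deriv[OF assms(2), of 1]])
  fix z assume "z \<in> S"
  then have "f differentiable (at z)" using assms(2) smooth_on_differentiable by blast
  then have "(f has_real_derivative deriv f z) (at z)"
    using real_differentiable_def DERIV_imp_deriv by blast
  then show "dir_deriv 1 f z = deriv f z"
    by (metis dir_deriv_eqI has_field_derivative_def mult.right_neutral)
qed

lemma smooth_on_has_real_derivative:
  fixes f :: "real \<Rightarrow> real"
  assumes "smooth_on S f" "x \<in> S"
  shows "(f has_real_derivative deriv f x) (at x)"
  using smooth_on_differentiable[OF assms] real_differentiable_def DERIV_imp_deriv by blast

lemma matrix_inv_mul:
  fixes A :: "real^'n::finite^'n"
  assumes "invertible A"
  shows "A ** matrix_inv A = mat 1" "matrix_inv A ** A = mat 1"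
  using assms someI_ex[of "\<lambda>A'. A ** A' = mat 1 \<and> A' ** A = mat 1"]
  unfolding invertible_def matrix_inv_def by blast+

lemma matrix_inv_mul_vector:
  fixes A :: "real^'n::finite^'n"
  assumes "invertible A"
  shows "A *v (matrix_inv A *v y) = y" "matrix_inv A *v (A *v y) = y"
  by (simp_all add: matrix_inv_mul[OF assms] matrix_vector_mul_assoc)

lemma posdef_invertible:
  fixes A :: "real^'n::finite^'n"
  assumes "\<And>y. y \<noteq> 0 \<Longrightarrow> y \<bullet> (A *v y) > 0"
  shows "invertible A"
  unfolding invertible_left_inverse matrix_left_invertible_ker
  using assms by (metis inner_zero_right less_irrefl)

lemma differentiable_vecI:
  fixes f :: "'a::euclidean_space \<Rightarrow> real^'n::finite"
  assumes "\<And>i. (\<lambda>z. f z $ i) differentiable (at x)"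
  shows "f differentiable (at x)"
  unfolding differentiable_componentwise_within[of f]
  using assms by (auto simp: Basis_vec_def inner_axis)

lemma differentiable_nth:
  fixes f :: "'a::real_normed_vector \<Rightarrow> 'b::real_normed_vector^'n::finite"
  assumes "f differentiable (at x)"
  shows "(\<lambda>z. f z $ i) differentiable (at x)"
  using assms bounded_linear.has_derivative[OF bounded_linear_vec_nth] unfolding differentiable_def by blast

lemma differentiable_prod':
  fixes f :: "'i \<Rightarrow> 'a::real_normed_vector \<Rightarrow> real"
  assumes "\<And>i. i \<in> I \<Longrightarrow> f i differentiable (at x)"
  shows "(\<lambda>z. \<Prod>i\<in>I. f i z) differentiable (at x)"
  using assms by (induction I rule: infinite_finite_induct) auto

lemma differentiable_det:
  fixes A :: "'a::real_normed_vector \<Rightarrow> real^'n::finite^'n"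
  assumes "\<And>i j. (\<lambda>z. A z $ i $ j) differentiable (at x)"
  shows "(\<lambda>z. det (A z)) differentiable (at x)"
proof -
  have "(\<lambda>z. \<Prod>i\<in>UNIV. A z $ i $ p i) differentiable (at x)" for p
    by (rule differentiable_prod') (rule assms)
  then show ?thesis
    unfolding det_def by (intro differentiable_sum differentiable_mult differentiable_const) auto
qed

text \<open>By Cramer's rule the solution of a linear system is a quotient of determinants.\<close>

lemma differentiable_matrix_inv_vector:
  fixes A :: "'a::euclidean_space \<Rightarrow> real^'n::finite^'n"
  assumes S: "open S" "x \<in> S" and inv: "\<And>z. z \<in> S \<Longrightarrow> invertible (A z)"
    and A: "A differentiable (at x)" and q: "q differentiable (at x)"
  shows "(\<lambda>z. matrix_inv (A z) *v q z) differentiable (at x)"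
proof -
  define Ck where "Ck z k = (\<chi> i j. if j = k then q z $ i else A z $ i $ j)" for z k
  have Aij: "(\<lambda>z. A z $ i $ j) differentiable (at x)" for i j
    by (intro differentiable_nth A)
  have qi: "(\<lambda>z. q z $ i) differentiable (at x)" for i
    by (intro differentiable_nth q)
  have det: "det (A z) \<noteq> 0" if "z \<in> S" for z
    using inv[OF that] by (simp add: invertible_det_nz)
  have eq: "(\<chi> k. det (Ck z k) / det (A z)) = matrix_inv (A z) *v q z" if "z \<in> S" for z
    using cramer[OF det[OF that], of "matrix_inv (A z) *v q z" "q z"] matrix_inv_mul_vector(1)[OF inv[OF that]]
    unfolding Ck_def by simp
  have "(\<lambda>z. \<chi> k. det (Ck z k) / det (A z)) differentiable (at x)"
  proof (rule differentiable_vecI)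
    fix k
    have "(\<lambda>z. Ck z k $ i $ j) differentiable (at x)" for i j
      unfolding Ck_def using Aij qi by (cases "j = k") auto
    then have "(\<lambda>z. det (Ck z k)) differentiable (at x)" by (rule differentiable_det)
    then have "(\<lambda>z. det (Ck z k) / det (A z)) differentiable (at x)"
      using differentiable_det[OF Aij] det[OF S(2)] by (intro differentiable_divide) auto
    then show "(\<lambda>z. (\<chi> k. det (Ck z k) / det (A z)) $ k) differentiable (at x)" by simp
  qed
  then show ?thesis by (rule differentiable_transform_open[OF _ S eq])
qed

section \<open>The Levi-Civita connection in a chart\<close>

lemma bounded_linear_quadratic: "bounded_linear (\<lambda>M::real^'n::finite^'n. u \<bullet> (M *v v))"
  unfolding linear_conv_bounded_linear[symmetric]
  by (rule linearI) (simp_all add: matrix_vector_mult_add_rdistrib inner_add_right scaleR_matrix_vector_assoc[symmetric])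

lemma axis_inner_vector: "axis i 1 \<bullet> (v::real^'n::finite) = v $ i"
  by (simp add: inner_axis')

lemma sum_matrix_vector: "(\<Sum>i\<in>UNIV. \<Sum>j\<in>UNIV. M $ i $ j * u $ i * v $ j) = u \<bullet> (M *v v)"
  for M :: "real^'n::finite^'n"
  by (simp add: inner_vec_def matrix_vector_mult_def sum_distrib_left mult_ac)

text \<open>Tensor calculus is done in the coordinates of a single chart with image \<open>U\<close>. To avoid index sums,
  the metric and its derivative are used as bilinear forms \<open>ip\<close> and \<open>dip\<close>, and the Christoffel symbols
  as the bilinear map \<open>Gam\<close> with components \<open>\<Gamma>\<^sup>k\<^sub>i\<^sub>j u\<^sup>i v\<^sup>j\<close>.\<close>

locale riemannian_chart =
  fixes a :: "('m, 'n::finite) form2" and c :: "('m, 'n) chart" and U :: "(real^'n) set"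
  assumes open_U: "open U"
    and smooth_a: "smooth_on U (a c)"
    and sym_a: "\<And>x. x \<in> U \<Longrightarrow> transpose (a c x) = a c x"
    and pos_a: "\<And>x y. x \<in> U \<Longrightarrow> y \<noteq> 0 \<Longrightarrow> y \<bullet> (a c x *v y) > 0"
begin

definition ip :: "real^'n \<Rightarrow> real^'n \<Rightarrow> real^'n \<Rightarrow> real" where
  "ip x u v = u \<bullet> (a c x *v v)"

definition dip :: "real^'n \<Rightarrow> real^'n \<Rightarrow> real^'n \<Rightarrow> real^'n \<Rightarrow> real" where
  "dip x w u v = u \<bullet> (frechet_derivative (a c) (at x) w *v v)"

definition koszul :: "real^'n \<Rightarrow> real^'n \<Rightarrow> real^'n \<Rightarrow> real^'n" where
  "koszul x u v = (\<chi> l. (dip x u (axis l 1) v + dip x v (axis l 1) u - dip x (axis l 1) u v) / 2)"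

definition Gam :: "real^'n \<Rightarrow> real^'n \<Rightarrow> real^'n \<Rightarrow> real^'n" where
  "Gam x u v = matrix_inv (a c x) *v koszul x u v"

lemma invertible_a: "x \<in> U \<Longrightarrow> invertible (a c x)"
  by (rule posdef_invertible) (rule pos_a)

lemma ip_sym: "x \<in> U \<Longrightarrow> ip x u v = ip x v u"
  unfolding ip_def by (metis dot_lmul_matrix inner_commute sym_a vector_transpose_matrix)

lemma ip_linear [simp]:
  "ip x (u + u') v = ip x u v + ip x u' v" "ip x u (v + v') = ip x u v + ip x u v'"
  "ip x (u - u') v = ip x u v - ip x u' v" "ip x u (v - v') = ip x u v - ip x u v'"
  "ip x (r *\<^sub>R u) v = r * ip x u v" "ip x u (r *\<^sub>R v) = r * ip x u v"
  "ip x 0 v = 0" "ip x u 0 = 0"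
  by (simp_all add: ip_def inner_add_left inner_add_right inner_diff_left inner_diff_right
      matrix_vector_right_distrib matrix_vector_mult_diff_distrib matrix_vector_mult_scaleR)

lemma dip_linear [simp]:
  "dip x w (u + u') v = dip x w u v + dip x w u' v" "dip x w u (v + v') = dip x w u v + dip x w u v'"
  "dip x w (r *\<^sub>R u) v = r * dip x w u v" "dip x w u (r *\<^sub>R v) = r * dip x w u v"
  by (simp_all add: dip_def inner_add_left inner_add_right
      matrix_vector_right_distrib matrix_vector_mult_scaleR)

lemma has_derivative_a:
  "x \<in> U \<Longrightarrow> (a c has_derivative frechet_derivative (a c) (at x)) (at x)"
  using smooth_on_differentiable[OF smooth_a] frechet_derivative_works by blast

lemma has_derivative_ip [derivative_intros]:
  "x \<in> U \<Longrightarrow> ((\<lambda>z. ip z u v) has_derivative (\<lambda>w. dip x w u v)) (at x)"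
  unfolding ip_def dip_def
  by (rule bounded_linear.has_derivative[OF bounded_linear_quadratic has_derivative_a])

lemma linear_dip: "x \<in> U \<Longrightarrow> linear (\<lambda>w. dip x w u v)"
  by (rule has_derivative_linear[OF has_derivative_ip])

lemma dip_linear1 [simp]:
  assumes "x \<in> U"
  shows "dip x (w + w') u v = dip x w u v + dip x w' u v" "dip x (r *\<^sub>R w) u v = r * dip x w u v"
  using linear_add[OF linear_dip[OF assms]] linear_cmul[OF linear_dip[OF assms]] by auto

lemma dip_sym: 
  assumes "x \<in> U" shows "dip x w u v = dip x w v u"
proof -
  have "((\<lambda>z. ip z v u) has_derivative (\<lambda>w. dip x w u v)) (at x)"
    by (rule has_derivative_transform_within_open[OF has_derivative_ip[OF assms] open_U assms])
       (rule ip_sym)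
  from has_derivative_unique[OF this has_derivative_ip[OF assms]] show ?thesis by metis
qed

lemma ip_has_derivative_vector [derivative_intros]:
  "((\<lambda>z. ip x (f z) (g z)) has_derivative (\<lambda>w. ip x (f' w) (g z0) + ip x (f z0) (g' w))) (at z0)"
  if "(f has_derivative f') (at z0)" "(g has_derivative g') (at z0)"
proof -
  have bl: "bounded_linear (\<lambda>v. a c x *v v)" by (rule matrix_vector_mul_bounded_linear)
  show ?thesis unfolding ip_def
    using has_derivative_inner[OF that(1) bounded_linear.has_derivative[OF bl that(2)]]
    by (simp add: add.commute)
qed

lemma koszul_inner:
  assumes "x \<in> U"
  shows "e \<bullet> koszul x u v = (dip x u e v + dip x v e u - dip x e u v) / 2"
proof -
  have l1: "linear (\<lambda>e. dip x w e v')" for w v' by (rule linearI) simp_all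
  have l: "linear (\<lambda>e. (dip x u e v + dip x v e u - dip x e u v) / 2)"
    by (rule linearI) (simp_all add: assms field_simps)
  show ?thesis
    unfolding linear_sum_axis[OF l, of e, symmetric]
    by (simp add: inner_vec_def koszul_def mult.commute)
qed

lemma ip_Gam:
  assumes "x \<in> U"
  shows "ip x e (Gam x u v) = (dip x u e v + dip x v e u - dip x e u v) / 2"
  unfolding ip_def Gam_def matrix_inv_mul_vector(1)[OF invertible_a[OF assms]] koszul_inner[OF assms] ..

text \<open>This makes \<open>\<alpha>\<close> constant in horizontal directions; the Christoffel terms of all later computations
  cancel through it.\<close>

lemma metric_compatible:
  assumes "x \<in> U"
  shows "dip x w u v = ip x (Gam x w u) v + ip x u (Gam x w v)"
  using ip_Gam[OF assms, of v w u] ip_Gam[OF assms, of u w v] ip_sym[OF assms, of v] 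
    dip_sym[OF assms, of w u v] dip_sym[OF assms, of v u w] dip_sym[OF assms, of u v w]
  by simp

lemma ip_eqI:
  assumes "x \<in> U" "\<And>e. ip x e u = ip x e v" shows "u = v"
proof -
  have "(u - v) \<bullet> (a c x *v (u - v)) = 0"
    using assms(2)[of "u - v"] unfolding ip_def by (simp add: matrix_vector_mult_diff_distrib inner_diff_right)
  then show ?thesis using pos_a[OF assms(1), of "u - v"] by force
qed

lemma Gam_linear [simp]:
  assumes "x \<in> U"
  shows "Gam x (u + u') v = Gam x u v + Gam x u' v" "Gam x u (v + v') = Gam x u v + Gam x u v'"
   "Gam x (r *\<^sub>R u) v = r *\<^sub>R Gam x u v" "Gam x u (r *\<^sub>R v) = r *\<^sub>R Gam x u v"
  by (rule ip_eqI[OF assms]; simp add: ip_Gam assms; simp add: field_simps)+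

lemma Gam_sym: "x \<in> U \<Longrightarrow> Gam x u v = Gam x v u"
  by (rule ip_eqI) (auto simp: ip_Gam dip_sym[of x _ u v])

lemma pd_a: "x \<in> U \<Longrightarrow> pd k (\<lambda>z. a c z $ i $ j) x = dip x (axis k 1) (axis i 1) (axis j 1)"
proof -
  assume x: "x \<in> U"
  have "(\<lambda>z. a c z $ i $ j) = (\<lambda>z. ip z (axis i 1) (axis j 1))"
    by (simp add: ip_def axis_inner_vector matrix_vector_mult_basis column_def)
  then show ?thesis using pd_eqI[OF has_derivative_ip[OF x]] by simp
qed

lemma christoffel_eq:
  assumes "x \<in> U"
  shows "christoffel a c k i j x = Gam x (axis i 1) (axis j 1) $ k"
  by (simp add: christoffel_def Gam_def matrix_vector_mult_def pd_a assms koszul_def sum_distrib_left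
      dip_sym[OF assms, of "axis j 1"] dip_sym[OF assms, of "axis i 1"] mult_ac sum_divide_distrib)
   

lemma alpha_eq: "alpha a c x y = sqrt (ip x y y)"
  by (simp add: alpha_def ip_def sum_matrix_vector)

lemma ip_pos: "x \<in> U \<Longrightarrow> y \<noteq> 0 \<Longrightarrow> ip x y y > 0"
  by (simp add: ip_def pos_a)

lemma ip_nonneg: "x \<in> U \<Longrightarrow> ip x y y \<ge> 0"
  using ip_pos[of x y] by (cases "y = 0") auto

lemma sq_alpha: "x \<in> U \<Longrightarrow> sq (alpha a c) x y = ip x y y"
  by (simp add: sq_def alpha_eq ip_nonneg)

lemma y_low_eq: "y_low a c x y k = (a c x *v y) $ k"
  by (simp add: y_low_def matrix_vector_mult_def)

lemma dx_cong:
  assumes "x \<in> U" "((\<lambda>z. g z y) has_derivative g') (at x)" "\<And>z. z \<in> U \<Longrightarrow> f z y = g z y"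
  shows "dx k f x y = g' (axis k 1)"
  unfolding dx_def
  by (rule pd_eqI, rule has_derivative_transform_within_open[OF assms(2) open_U assms(1)])
     (simp add: assms(3))

lemma dx_sq_alpha: "x \<in> U \<Longrightarrow> dx k (sq (alpha a c)) x y = dip x (axis k 1) y y"
  by (rule dx_cong[OF _ has_derivative_ip]) (simp_all add: sq_alpha)

lemma has_derivative_dip_vector [derivative_intros]:
  "((\<lambda>z. dip x w (f z) (g z)) has_derivative (\<lambda>v. dip x w (f' v) (g z0) + dip x w (f z0) (g' v))) (at z0)"
  if "(f has_derivative f') (at z0)" "(g has_derivative g') (at z0)"
proof -
  have bl: "bounded_linear (\<lambda>v. frechet_derivative (a c) (at x) w *v v)" by (rule matrix_vector_mul_bounded_linear)
  show ?thesis unfolding dip_def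
    using has_derivative_inner[OF that(1) bounded_linear.has_derivative[OF bl that(2)]]
    by (simp add: add.commute)
qed

lemma dy_dx_sq_alpha:
  assumes x: "x \<in> U"
  shows "dy l (dx k (sq (alpha a c))) x y = 2 * dip x (axis k 1) (axis l 1) y"
proof -
  have "((\<lambda>z. dip x (axis k 1) z z) has_derivative (\<lambda>v. dip x (axis k 1) v y + dip x (axis k 1) y v)) (at y)"
    by (intro derivative_intros)
  then show ?thesis unfolding dy_def dx_sq_alpha[OF x]
    by (subst pd_eqI, assumption) (simp add: dip_sym[OF x, of _ y])
qed

lemma fund_tensor_alpha:
  assumes x: "x \<in> U"
  shows "fund_tensor (alpha a c) x y = a c x"
proof -
  have 1: "((\<lambda>z. ip x z z) has_derivative (\<lambda>v. ip x v y + ip x y v)) (at y)" for y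
    by (intro derivative_intros)
  have d: "dy i (sq (alpha a c)) x y = 2 * ip x (axis i 1) y" for i y
    unfolding dy_def sq_alpha[OF x] 
    by (subst pd_eqI[OF 1]) (simp add: ip_sym[OF x, of y])
  have 2: "((\<lambda>z. 2 * ip x (axis i 1) z) has_derivative (\<lambda>v. 2 * ip x (axis i 1) v)) (at y)" for y i
    by (auto intro!: derivative_eq_intros)
  have "dy j (dy i (sq (alpha a c))) x y = 2 * ip x (axis i 1) (axis j 1)" for i j
    unfolding dy_def[of j] d by (subst pd_eqI[OF 2]) simp
  then show ?thesis
    by (simp add: fund_tensor_def vec_eq_iff ip_def axis_inner_vector matrix_vector_mult_basis column_def)
qed

text \<open>The Euler--Lagrange expression of \<open>\<alpha>\<^sup>2\<close> is twice the Koszul expression.\<close>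

lemma spray_alpha:
  assumes x: "x \<in> U"
  shows "spray (alpha a c) i x y = 1/2 * Gam x y y $ i"
proof -
  have "(\<Sum>k\<in>UNIV. dy l (dx k (sq (alpha a c))) x y * y $ k) - dx l (sq (alpha a c)) x y
      = 2 * koszul x y y $ l" for l
  proof -
    have "(\<Sum>k\<in>UNIV. dy l (dx k (sq (alpha a c))) x y * y $ k) = 2 * dip x y (axis l 1) y"
      using linear_sum_axis[OF linear_dip[OF x], of "axis l 1" y y]
      by (simp add: dy_dx_sq_alpha[OF x] sum_distrib_left[symmetric] mult.assoc)
    then show ?thesis by (simp add: dx_sq_alpha[OF x] koszul_def)
  qed
  then show ?thesis
    by (simp add: spray_def fund_tensor_alpha[OF x] Gam_def matrix_vector_mult_def sum_distrib_left mult_ac)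
qed

lemma differentiable_dip:
  assumes x: "x \<in> U"
  shows "(\<lambda>z. dip z w u v) differentiable (at x)"
proof -
  have "dir_deriv w (a c) differentiable (at x)"
    using smooth_on_differentiable[OF smooth_on_dir_deriv[OF smooth_a] x] .
  then show ?thesis
    unfolding dip_def dir_deriv_def[symmetric, abs_def] differentiable_def
    using bounded_linear.has_derivative[OF bounded_linear_quadratic] by blast
qed

lemma differentiable_Gam:
  assumes x: "x \<in> U"
  shows "(\<lambda>z. Gam z u v) differentiable (at x)"
  unfolding Gam_def
proof (rule differentiable_matrix_inv_vector[OF open_U x invertible_a])
  show "a c differentiable (at x)" using smooth_on_differentiable[OF smooth_a x] .
  show "(\<lambda>z. koszul z u v) differentiable (at x)"
    by (rule differentiable_vecI) (auto simp: koszul_def intro!: differentiable_dip x differentiable_divide differentiable_add differentiable_diff)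
qed

lemma bounded_linear_Gam:
  assumes x: "x \<in> U"
  shows "bounded_linear (\<lambda>v. Gam x u v)" "bounded_linear (\<lambda>v. Gam x v u)"
  unfolding linear_conv_bounded_linear[symmetric]
  by (rule linearI; simp add: x)+

end

section \<open>A 1-form with prescribed covariant derivative\<close>

text \<open>The functions \<open>t\<close> and \<open>l\<close> are \<open>\<tau>\<close> and \<open>\<lambda>\<close> in the coordinates of the chart. The open set \<open>I\<close> contains
  all values of \<open>s = \<beta>/\<alpha>\<close>, and \<open>\<phi>\<close> is smooth there.\<close>

locale ab_chart = riemannian_chart a c U
  for a :: "('m, 'n::finite) form2" and c :: "('m, 'n) chart" and U :: "(real^'n) set" +
  fixes b :: "('m, 'n) form1" and \<phi> :: "real \<Rightarrow> real" and I :: "real set"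
    and k1 k2 k3 :: real and t l :: "real^'n \<Rightarrow> real"
  assumes smooth_b: "smooth_on U (b c)"
    and open_I: "open I" and smooth_phi: "smooth_on I \<phi>"
    and s_range: "\<And>x s. x \<in> U \<Longrightarrow> \<bar>s\<bar> \<le> sqrt (normsq a b c x) \<Longrightarrow> s \<in> I"
    and phi_pos: "\<And>s. s \<in> I \<Longrightarrow> \<phi> s > 0"
    and regular: "\<And>x s. x \<in> U \<Longrightarrow> \<bar>s\<bar> \<le> sqrt (normsq a b c x) \<Longrightarrow>
          \<phi> s - s * deriv \<phi> s + (normsq a b c x - s\<^sup>2) * deriv (deriv \<phi>) s > 0"
    and posdef_F: "\<And>x y v. x \<in> U \<Longrightarrow> y \<noteq> 0 \<Longrightarrow> v \<noteq> 0 \<Longrightarrow>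
          v \<bullet> (fund_tensor (ab_metric a b \<phi> c) x y *v v) > 0"
    and cov: "\<And>x i j. x \<in> U \<Longrightarrow> cov_deriv a b c i j x =
          t x * ((1 + k1 * normsq a b c x) * a c x $ i $ j
           + (k2 * normsq a b c x + k3) * b c x $ i * b c x $ j)"
    and diff_t: "\<And>x. x \<in> U \<Longrightarrow> t differentiable (at x)"
    and dt: "\<And>x i. x \<in> U \<Longrightarrow> pd i t x = q_coeff k1 k3 (normsq a b c x) (t x) (l x) * b c x $ i"
begin

abbreviation B where "B x \<equiv> normsq a b c x"
abbreviation F where "F \<equiv> ab_metric a b \<phi> c"
abbreviation u where "u x \<equiv> 1 + k1 * B x"
abbreviation v where "v x \<equiv> k2 * B x + k3"

definition db :: "real^'n \<Rightarrow> real^'n \<Rightarrow> real^'n" where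
  "db x w = frechet_derivative (b c) (at x) w"

text \<open>\<open>bs\<close> is the vector field \<open>b\<^sup>i\<close> dual to \<open>\<beta>\<close>; \<open>db\<close> and \<open>dbs\<close> are coordinate derivatives, the first
  argument being the point and the second the direction.\<close>

definition bs :: "real^'n \<Rightarrow> real^'n" where
  "bs x = matrix_inv (a c x) *v b c x"

definition dbs :: "real^'n \<Rightarrow> real^'n \<Rightarrow> real^'n" where
  "dbs x w = frechet_derivative bs (at x) w"

lemma beta_eq: "beta b c x y = b c x \<bullet> y"
  by (simp add: beta_def inner_vec_def)

lemma b_up_eq: "b_up a b c x i = bs x $ i"
  by (simp add: b_up_def bs_def matrix_vector_mult_def)

lemma normsq_eq: "B x = b c x \<bullet> bs x"
  by (simp add: normsq_def b_up_eq inner_vec_def mult.commute)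

lemma ip_bs:
  assumes "x \<in> U"
  shows "ip x w (bs x) = b c x \<bullet> w" "ip x (bs x) w = b c x \<bullet> w"
proof -
  show "ip x w (bs x) = b c x \<bullet> w"
    by (simp add: ip_def bs_def matrix_inv_mul_vector(1)[OF invertible_a[OF assms]] inner_commute)
  then show "ip x (bs x) w = b c x \<bullet> w"
    using ip_sym[OF assms] by simp
qed

lemma B_nonneg: "x \<in> U \<Longrightarrow> B x \<ge> 0"
  using ip_nonneg[of x "bs x"] by (simp add: normsq_eq ip_bs)

lemma B_eq_0: "x \<in> U \<Longrightarrow> B x = 0 \<Longrightarrow> b c x = 0"
proof -
  assume x: "x \<in> U" "B x = 0"
  have "bs x = 0" using ip_pos[OF x(1), of "bs x"] x by (auto simp: normsq_eq ip_bs)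
  then show ?thesis using ip_bs(2)[OF x(1), of "b c x"] by simp
qed

text \<open>Cauchy--Schwarz, from the positivity of \<open>\<alpha>\<close> on \<open>\<alpha>\<^sup>2 b - \<beta> y\<close>. It keeps \<open>s\<close> in \<open>[-b, b]\<close>.\<close>

lemma beta_sq_le:
  assumes x: "x \<in> U"
  shows "(b c x \<bullet> y)\<^sup>2 \<le> B x * ip x y y"
proof (cases "y = 0")
  case False
  define w where "w = ip x y y *\<^sub>R bs x - (b c x \<bullet> y) *\<^sub>R y"
  have "0 \<le> ip x w w" using ip_nonneg[OF x] .
  also have "ip x w w = ip x y y * (B x * ip x y y - (b c x \<bullet> y)\<^sup>2)"
    by (simp add: w_def ip_bs[OF x] normsq_eq algebra_simps power2_eq_square)
  finally show ?thesis using ip_pos[OF x False] by (simp add: zero_le_mult_iff)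
qed simp

lemma has_derivative_b [derivative_intros]: "x \<in> U \<Longrightarrow> (b c has_derivative db x) (at x)"
  using smooth_on_differentiable[OF smooth_b] frechet_derivative_works unfolding db_def by blast

lemma has_derivative_beta [derivative_intros]:
  "x \<in> U \<Longrightarrow> ((\<lambda>z. b c z \<bullet> w) has_derivative (\<lambda>v. db x v \<bullet> w)) (at x)"
  by (auto intro!: derivative_eq_intros)

lemma pd_b: "x \<in> U \<Longrightarrow> pd j (\<lambda>z. b c z $ i) x = db x (axis j 1) $ i"
  by (rule pd_eqI[OF bounded_linear.has_derivative[OF bounded_linear_vec_nth has_derivative_b]])

lemma linear_db: "x \<in> U \<Longrightarrow> linear (db x)"
  using has_derivative_linear[OF has_derivative_b] .

lemma bilinear_eqI:
  fixes f g :: "real^'n \<Rightarrow> real^'n \<Rightarrow> real"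
  assumes "\<And>w. linear (\<lambda>e. f e w)" "\<And>e. linear (f e)" "\<And>w. linear (\<lambda>e. g e w)" "\<And>e. linear (g e)"
    and "\<And>i j. f (axis i 1) (axis j 1) = g (axis i 1) (axis j 1)"
  shows "f e w = g e w"
proof -
  have "f (axis i 1) w = g (axis i 1) w" for i
    using linear_sum_axis[OF assms(2), of "axis i 1" w] linear_sum_axis[OF assms(4), of "axis i 1" w] assms(5) by simp
  then show ?thesis
    using linear_sum_axis[OF assms(1), of w e] linear_sum_axis[OF assms(3), of w e] by simp
qed

lemma cov_b:
  assumes x: "x \<in> U"
  shows "db x w \<bullet> e - b c x \<bullet> Gam x e w = t x * (u x * ip x e w + v x * (b c x \<bullet> e) * (b c x \<bullet> w))"
proof (rule bilinear_eqI[where e = e and w = w])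
  note lin = linear_add[OF linear_db[OF x]] linear_cmul[OF linear_db[OF x]]
  show "linear (\<lambda>e. db x w \<bullet> e - b c x \<bullet> Gam x e w)"
       "linear (\<lambda>e. t x * (u x * ip x e w + v x * (b c x \<bullet> e) * (b c x \<bullet> w)))"
       "linear (\<lambda>w. db x w \<bullet> e - b c x \<bullet> Gam x e w)"
       "linear (\<lambda>w. t x * (u x * ip x e w + v x * (b c x \<bullet> e) * (b c x \<bullet> w)))" for e w
    by (rule linearI; simp add: lin x algebra_simps)+
  show "db x (axis j 1) \<bullet> axis i 1 - b c x \<bullet> Gam x (axis i 1) (axis j 1) =
        t x * (u x * ip x (axis i 1) (axis j 1) + v x * (b c x \<bullet> axis i 1) * (b c x \<bullet> axis j 1))" for i j
    using cov[OF x, of i j]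
    by (simp add: cov_deriv_def pd_b[OF x] christoffel_eq[OF x] inner_axis inner_vec_def[of "b c x" "Gam x _ _"]
        ip_def matrix_vector_mult_basis column_def axis_inner_vector mult_ac)
qed

lemma has_derivative_bs [derivative_intros]:
  assumes x: "x \<in> U"
  shows "(bs has_derivative dbs x) (at x)"
proof -
  have "bs differentiable (at x)"
    unfolding bs_def[abs_def]
    by (rule differentiable_matrix_inv_vector[OF open_U x invertible_a smooth_on_differentiable[OF smooth_a x]
          smooth_on_differentiable[OF smooth_b x]])
  then show ?thesis unfolding dbs_def[abs_def] by (simp add: frechet_derivative_works[symmetric])
qed

lemma has_derivative_ip_field:
  assumes x: "x \<in> U" and f: "(f has_derivative f') (at x)"
  shows "((\<lambda>z. ip z w (f z)) has_derivative (\<lambda>h. dip x h w (f x) + ip x w (f' h))) (at x)"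
proof -
  have "bounded_bilinear ((*v) :: real^'n^'n \<Rightarrow> real^'n \<Rightarrow> real^'n)"
    by (simp add: bilinear_conv_bounded_bilinear[symmetric] bilinear_def linearI matrix_vector_mult_add_rdistrib
        scaleR_matrix_vector_assoc matrix_vector_right_distrib matrix_vector_mult_scaleR linear_iff)
  from bounded_bilinear.FDERIV[OF this has_derivative_a[OF x] f]
  have "((\<lambda>z. a c z *v f z) has_derivative
      (\<lambda>h. a c x *v f' h + frechet_derivative (a c) (at x) h *v f x)) (at x)" .
  from bounded_linear.has_derivative[OF bounded_linear_inner_right this, of w]
  show ?thesis by (simp add: ip_def dip_def inner_add_right add.commute)
qed

text \<open>Raising an index commutes with covariant differentiation because the metric is parallel.\<close>

lemma cov_bs:
  assumes x: "x \<in> U"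
  shows "dbs x w + Gam x w (bs x) = t x *\<^sub>R (u x *\<^sub>R w + (v x * (b c x \<bullet> w)) *\<^sub>R bs x)"
proof (rule ip_eqI[OF x])
  fix e
  have "((\<lambda>z. b c z \<bullet> e) has_derivative (\<lambda>h. dip x h e (bs x) + ip x e (dbs x h))) (at x)"
    by (rule has_derivative_transform_within_open[OF has_derivative_ip_field[OF x has_derivative_bs[OF x]] open_U x])
       (simp add: ip_bs)
  from has_derivative_unique[OF this has_derivative_beta[OF x]]
  have "dip x w e (bs x) + ip x e (dbs x w) = db x w \<bullet> e" by meson
  moreover have "dip x w e (bs x) = b c x \<bullet> Gam x w e + ip x e (Gam x w (bs x))"
    by (simp add: metric_compatible[OF x] ip_bs[OF x])
  ultimately have "ip x e (dbs x w + Gam x w (bs x)) = db x w \<bullet> e - b c x \<bullet> Gam x e w"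
    by (simp add: Gam_sym[OF x, of e w])
  then show "ip x e (dbs x w + Gam x w (bs x)) = ip x e (t x *\<^sub>R (u x *\<^sub>R w + (v x * (b c x \<bullet> w)) *\<^sub>R bs x))"
    by (simp add: cov_b[OF x] ip_bs[OF x] algebra_simps)
qed

text \<open>Contract \<open>b\<^bsub>i|j\<^esub>\<close> with \<open>b\<^sup>i\<close>. The factor \<open>u + v b\<^sup>2\<close> is \<open>D(b\<^sup>2)\<close>, which decides whether \<open>b\<^sup>2\<close> varies.\<close>

lemma has_derivative_B [derivative_intros]:
  assumes x: "x \<in> U"
  shows "(B has_derivative (\<lambda>w. 2 * t x * (u x + v x * B x) * (b c x \<bullet> w))) (at x)"
proof -
  have "((\<lambda>z. b c z \<bullet> bs z) has_derivative (\<lambda>w. db x w \<bullet> bs x + b c x \<bullet> dbs x w)) (at x)"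
    using has_derivative_inner[OF has_derivative_b[OF x] has_derivative_bs[OF x]] by (simp add: add.commute)
  moreover have "db x w \<bullet> bs x + b c x \<bullet> dbs x w = 2 * t x * (u x + v x * B x) * (b c x \<bullet> w)" for w
  proof -
    have "b c x \<bullet> dbs x w = b c x \<bullet> (t x *\<^sub>R (u x *\<^sub>R w + (v x * (b c x \<bullet> w)) *\<^sub>R bs x)) - b c x \<bullet> Gam x w (bs x)"
      unfolding cov_bs[OF x, symmetric] by (simp add: inner_add_right)
    moreover have "db x w \<bullet> bs x = b c x \<bullet> Gam x (bs x) w + t x * (u x * ip x (bs x) w + v x * (b c x \<bullet> bs x) * (b c x \<bullet> w))"
      using cov_b[OF x, of w "bs x"] by simp
    ultimately show ?thesis
      by (simp add: Gam_sym[OF x, of w] ip_bs[OF x] normsq_eq inner_add_right algebra_simps)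
  qed
  ultimately show ?thesis unfolding normsq_eq[abs_def] by (simp add: normsq_eq)
qed

lemma has_derivative_t [derivative_intros]:
  assumes x: "x \<in> U"
  shows "(t has_derivative (\<lambda>w. q_coeff k1 k3 (B x) (t x) (l x) * (b c x \<bullet> w))) (at x)"
proof -
  have d: "(t has_derivative frechet_derivative t (at x)) (at x)"
    using diff_t[OF x] frechet_derivative_works by blast
  have "frechet_derivative t (at x) w = q_coeff k1 k3 (B x) (t x) (l x) * (b c x \<bullet> w)" for w
    using has_derivative_sum_axis[OF d, of w] 
    by (simp add: dt[OF x] inner_vec_def sum_distrib_left mult_ac)
  then show ?thesis using d by presburger
qed

end

section \<open>The spray of an \<open>(\<alpha>,\<beta>)\<close>-metric\<close>

lemma has_derivative_sqrt_comp:
  fixes A :: "'a::real_normed_vector \<Rightarrow> real"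
  assumes "(A has_derivative A') (at z)" "A z > 0"
  shows "((\<lambda>z. sqrt (A z)) has_derivative (\<lambda>h. A' h / (2 * sqrt (A z)))) (at z)"
  using assms by (auto intro!: derivative_eq_intros simp: field_simps)

lemma has_derivative_ratio_comp:
  fixes A \<beta> :: "'a::real_normed_vector \<Rightarrow> real"
  assumes A: "(A has_derivative A') (at z)" "A z > 0" and \<beta>: "(\<beta> has_derivative \<beta>') (at z)"
  shows "((\<lambda>z. \<beta> z / sqrt (A z)) has_derivative
    (\<lambda>h. \<beta>' h / sqrt (A z) - (\<beta> z / sqrt (A z)) * A' h / (2 * A z))) (at z)"
proof -
  have "sqrt (A z) > 0" "sqrt (A z) * sqrt (A z) = A z" using A(2) by auto
  then show ?thesis
    using A(2) by (auto intro!: has_derivative_eq_rhs[OF has_derivative_divide[OF \<beta> has_derivative_sqrt_comp[OF A]]]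
        simp: field_simps)
qed

lemma has_derivative_comp_real:
  fixes f :: "'a::real_normed_vector \<Rightarrow> real"
  assumes "(g has_real_derivative g') (at (f z))" "(f has_derivative f') (at z)"
  shows "((\<lambda>z. g (f z)) has_derivative (\<lambda>h. g' * f' h)) (at z)"
  using has_derivative_compose[OF assms(2), of g "(*) g'"] assms(1) by (simp add: has_field_derivative_def)

context ab_chart
begin

abbreviation al :: "real^'n \<Rightarrow> real^'n \<Rightarrow> real" where "al x y \<equiv> sqrt (ip x y y)"

text \<open>\<open>sy\<close> and \<open>sx\<close> are the derivatives of \<open>s = \<beta>/\<alpha>\<close> with respect to \<open>y\<close> and to \<open>x\<close>.\<close>

definition sv :: "real^'n \<Rightarrow> real^'n \<Rightarrow> real" where "sv x y = (b c x \<bullet> y) / al x y"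

definition sy :: "real^'n \<Rightarrow> real^'n \<Rightarrow> real^'n \<Rightarrow> real" where
  "sy x y h = (b c x \<bullet> h) / al x y - sv x y * ip x y h / ip x y y"

definition sx :: "real^'n \<Rightarrow> real^'n \<Rightarrow> real^'n \<Rightarrow> real" where
  "sx x y h = (db x h \<bullet> y) / al x y - sv x y * dip x h y y / (2 * ip x y y)"

lemma al_pos: "x \<in> U \<Longrightarrow> y \<noteq> 0 \<Longrightarrow> al x y > 0"
  by (simp add: ip_pos)

lemma sv_sq_le: "x \<in> U \<Longrightarrow> y \<noteq> 0 \<Longrightarrow> (sv x y)\<^sup>2 \<le> B x"
  using beta_sq_le[of x y] ip_pos[of x y] by (simp add: sv_def power_divide field_simps)

lemma abs_sv_le: "x \<in> U \<Longrightarrow> y \<noteq> 0 \<Longrightarrow> \<bar>sv x y\<bar> \<le> sqrt (B x)"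
  using sv_sq_le real_le_rsqrt by fastforce

lemma sv_in_I: "x \<in> U \<Longrightarrow> y \<noteq> 0 \<Longrightarrow> sv x y \<in> I"
  by (rule s_range[OF _ abs_sv_le])

lemma has_derivative_ip_self: "((\<lambda>z. ip x z z) has_derivative (\<lambda>h. 2 * ip x y h)) (at y)" if "x \<in> U"
proof -
  have "((\<lambda>z. ip x z z) has_derivative (\<lambda>h. ip x h y + ip x y h)) (at y)"
    by (intro derivative_intros)
  then show ?thesis by (simp add: ip_sym[OF that, of _ y])
qed

lemma has_derivative_sv_y [derivative_intros]:
  assumes "x \<in> U" "y \<noteq> 0"
  shows "((\<lambda>z. sv x z) has_derivative sy x y) (at y)"
proof -
  have "((\<lambda>z. b c x \<bullet> z) has_derivative (\<lambda>h. b c x \<bullet> h)) (at y)" by (auto intro!: derivative_eq_intros)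
  from has_derivative_ratio_comp[OF has_derivative_ip_self[OF assms(1)] ip_pos[OF assms] this]
  show ?thesis unfolding sv_def sy_def[abs_def] by (simp add: sv_def)
qed

lemma has_derivative_sv_x [derivative_intros]:
  assumes "x \<in> U" "y \<noteq> 0"
  shows "((\<lambda>z. sv z y) has_derivative sx x y) (at x)"
  using has_derivative_ratio_comp[OF has_derivative_ip[OF assms(1)] ip_pos[OF assms] has_derivative_beta[OF assms(1)]]
  unfolding sv_def sx_def[abs_def] by (simp add: sv_def)

lemma has_derivative_al_y [derivative_intros]:
  assumes "x \<in> U" "y \<noteq> 0"
  shows "((\<lambda>z. al x z) has_derivative (\<lambda>h. ip x y h / al x y)) (at y)"
  using has_derivative_sqrt_comp[OF has_derivative_ip_self[OF assms(1)] ip_pos[OF assms]] by simp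

lemma has_derivative_al_x [derivative_intros]:
  assumes "x \<in> U" "y \<noteq> 0"
  shows "((\<lambda>z. al z y) has_derivative (\<lambda>h. dip x h y y / (2 * al x y))) (at x)"
  using has_derivative_sqrt_comp[OF has_derivative_ip[OF assms(1)] ip_pos[OF assms]] by simp

abbreviation \<phi>1 where "\<phi>1 \<equiv> deriv \<phi>"
abbreviation \<phi>2 where "\<phi>2 \<equiv> deriv (deriv \<phi>)"

lemma smooth_phi1: "smooth_on I \<phi>1" and smooth_phi2: "smooth_on I \<phi>2"
  and smooth_phi3: "smooth_on I (deriv \<phi>2)" and smooth_phi4: "smooth_on I (deriv (deriv \<phi>2))"
  by (intro smooth_on_deriv open_I smooth_phi)+

text \<open>Put \<open>F\<^sup>2 = \<alpha>\<^sup>2 \<Phi>(s)\<close> with \<open>\<Phi> = \<phi>\<^sup>2\<close>. The derivative of \<open>\<alpha>\<^sup>2 \<Phi>(s)\<close> in any direction is \<open>Lk\<close> times the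
  derivative of \<open>\<alpha>\<^sup>2\<close> plus \<open>\<alpha> \<Phi>'\<close> times that of \<open>\<beta>\<close>; this gives the formulas \<open>DL\<close>, \<open>DxL\<close> and, applied
  once more, \<open>DDL\<close> and \<open>DyDxL\<close>.\<close>

definition Phi :: "real \<Rightarrow> real" where "Phi s = (\<phi> s)\<^sup>2"
definition Phi1 :: "real \<Rightarrow> real" where "Phi1 s = 2 * \<phi> s * \<phi>1 s"
definition Phi2 :: "real \<Rightarrow> real" where "Phi2 s = 2 * (\<phi>1 s)\<^sup>2 + 2 * \<phi> s * \<phi>2 s"
definition Lk :: "real \<Rightarrow> real" where "Lk s = Phi s - s * Phi1 s / 2"
definition Lk1 :: "real \<Rightarrow> real" where "Lk1 s = Phi1 s / 2 - s * Phi2 s / 2"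

lemma Phi_derivs:
  assumes "s \<in> I"
  shows "(Phi has_real_derivative Phi1 s) (at s)" "(Phi1 has_real_derivative Phi2 s) (at s)"
    "(Lk has_real_derivative Lk1 s) (at s)"
proof -
  note d = smooth_on_has_real_derivative[OF smooth_phi assms] smooth_on_has_real_derivative[OF smooth_phi1 assms]
  show 1: "(Phi has_real_derivative Phi1 s) (at s)"
    unfolding Phi_def[abs_def] Phi1_def by (auto intro!: derivative_eq_intros d)
  show 2: "(Phi1 has_real_derivative Phi2 s) (at s)"
    unfolding Phi1_def[abs_def] Phi2_def by (auto intro!: derivative_eq_intros d simp: power2_eq_square)
  show "(Lk has_real_derivative Lk1 s) (at s)"
    unfolding Lk_def[abs_def] Lk1_def by (auto intro!: derivative_eq_intros 1 2 simp: field_simps)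
qed

lemma sq_F: "x \<in> U \<Longrightarrow> sq F x y = ip x y y * Phi (sv x y)"
  by (simp add: sq_def ab_metric_def alpha_eq beta_eq sv_def Phi_def power_mult_distrib ip_nonneg)

definition DL where "DL x y w = 2 * ip x w y * Lk (sv x y) + al x y * Phi1 (sv x y) * (b c x \<bullet> w)"

definition DDL where
  "DDL x y w h = 2 * ip x w h * Lk (sv x y) + 2 * ip x w y * (Lk1 (sv x y) * sy x y h)
     + ip x y h / al x y * Phi1 (sv x y) * (b c x \<bullet> w) + al x y * (Phi2 (sv x y) * sy x y h) * (b c x \<bullet> w)"

definition DxL where
  "DxL x y h = dip x h y y * Lk (sv x y) + al x y * Phi1 (sv x y) * (db x h \<bullet> y)"

definition DyDxL where
  "DyDxL x y h w = 2 * dip x h w y * Lk (sv x y) + dip x h y y * (Lk1 (sv x y) * sy x y w)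
     + ip x y w / al x y * Phi1 (sv x y) * (db x h \<bullet> y) + al x y * (Phi2 (sv x y) * sy x y w) * (db x h \<bullet> y)
     + al x y * Phi1 (sv x y) * (db x h \<bullet> w)"

lemma al_mult: "x \<in> U \<Longrightarrow> al x y * al x y = ip x y y"
  by (simp add: ip_nonneg)

lemma comp_y:
  assumes "x \<in> U" "y \<noteq> 0" "(g has_real_derivative g') (at (sv x y))"
  shows "((\<lambda>z. g (sv x z)) has_derivative (\<lambda>h. g' * sy x y h)) (at y)"
  by (rule has_derivative_comp_real[OF assms(3) has_derivative_sv_y[OF assms(1,2)]])

lemma comp_x:
  assumes "x \<in> U" "y \<noteq> 0" "(g has_real_derivative g') (at (sv x y))"
  shows "((\<lambda>z. g (sv z y)) has_derivative (\<lambda>h. g' * sx x y h)) (at x)"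
  by (rule has_derivative_comp_real[OF assms(3) has_derivative_sv_x[OF assms(1,2)]])

lemma has_derivative_L_y:
  assumes x: "x \<in> U" and y: "y \<noteq> 0"
  shows "(sq F x has_derivative DL x y) (at y)"
proof -
  have "((\<lambda>z. ip x z z * Phi (sv x z)) has_derivative
     (\<lambda>h. ip x y y * (Phi1 (sv x y) * sy x y h) + 2 * ip x y h * Phi (sv x y))) (at y)"
    by (rule has_derivative_mult[OF has_derivative_ip_self[OF x] comp_y[OF x y Phi_derivs(1)[OF sv_in_I[OF x y]]]])
  moreover have "ip x y y * (Phi1 (sv x y) * sy x y h) + 2 * ip x y h * Phi (sv x y) = DL x y h" for h
    using al_pos[OF x y] al_mult[OF x, of y] ip_pos[OF x y]
    by (simp add: DL_def sy_def Lk_def ip_sym[OF x, of h y] field_simps)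
  ultimately show ?thesis by (simp add: sq_F[OF x, abs_def])
qed

lemma has_derivative_DL_y:
  assumes x: "x \<in> U" and y: "y \<noteq> 0"
  shows "((\<lambda>z. DL x z w) has_derivative DDL x y w) (at y)"
proof -
  note I = sv_in_I[OF x y]
  have "((\<lambda>z. 2 * ip x w z) has_derivative (\<lambda>h. 2 * ip x w h)) (at y)"
    by (auto intro!: derivative_eq_intros)
  note 1 = has_derivative_mult[OF this comp_y[OF x y Phi_derivs(3)[OF I]]]
  have 2: "((\<lambda>z. al x z * Phi1 (sv x z) * (b c x \<bullet> w)) has_derivative
     (\<lambda>h. (al x y * (Phi2 (sv x y) * sy x y h) + ip x y h / al x y * Phi1 (sv x y)) * (b c x \<bullet> w))) (at y)"
    by (rule has_derivative_mult_left[OF has_derivative_mult[OF has_derivative_al_y[OF x y] comp_y[OF x y Phi_derivs(2)[OF I]]]])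
  show ?thesis
    unfolding DL_def DDL_def[abs_def]
    by (rule has_derivative_eq_rhs[OF has_derivative_add[OF 1 2]]) (simp add: algebra_simps)
qed

lemma has_derivative_L_x:
  assumes x: "x \<in> U" and y: "y \<noteq> 0"
  shows "((\<lambda>z. sq F z y) has_derivative DxL x y) (at x)"
proof -
  have "((\<lambda>z. ip z y y * Phi (sv z y)) has_derivative
     (\<lambda>h. ip x y y * (Phi1 (sv x y) * sx x y h) + dip x h y y * Phi (sv x y))) (at x)"
    by (rule has_derivative_mult[OF has_derivative_ip[OF x] comp_x[OF x y Phi_derivs(1)[OF sv_in_I[OF x y]]]])
  moreover have "ip x y y * (Phi1 (sv x y) * sx x y h) + dip x h y y * Phi (sv x y) = DxL x y h" for h
    using al_pos[OF x y] al_mult[OF x, of y] ip_pos[OF x y]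
    by (simp add: DxL_def sx_def Lk_def field_simps)
  ultimately have "((\<lambda>z. ip z y y * Phi (sv z y)) has_derivative DxL x y) (at x)" by simp
  then show ?thesis
    by (rule has_derivative_transform_within_open[OF _ open_U x]) (simp add: sq_F)
qed

lemma has_derivative_DxL_y:
  assumes x: "x \<in> U" and y: "y \<noteq> 0"
  shows "((\<lambda>z. DxL x z h) has_derivative DyDxL x y h) (at y)"
proof -
  note I = sv_in_I[OF x y]
  have d: "((\<lambda>z. dip x h z z) has_derivative (\<lambda>w. 2 * dip x h w y)) (at y)"
    using has_derivative_dip_vector[OF has_derivative_ident has_derivative_ident, of x h y]
    by (simp add: dip_sym[OF x, of h y])
  note 1 = has_derivative_mult[OF d comp_y[OF x y Phi_derivs(3)[OF I]]]
  have "((\<lambda>z. db x h \<bullet> z) has_derivative (\<lambda>w. db x h \<bullet> w)) (at y)" by (auto intro!: derivative_eq_intros)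
  note 2 = has_derivative_mult[OF has_derivative_mult[OF has_derivative_al_y[OF x y] comp_y[OF x y Phi_derivs(2)[OF I]]] this]
  show ?thesis
    unfolding DxL_def DyDxL_def[abs_def]
    by (rule has_derivative_eq_rhs[OF has_derivative_add[OF 1 2]]) (simp add: algebra_simps)
qed

lemma dy_eqI:
  assumes y: "y \<noteq> 0" and d: "((\<lambda>z. g z) has_derivative g') (at y)" and eq: "\<And>z. z \<noteq> 0 \<Longrightarrow> f x z = g z"
  shows "dy k f x y = g' (axis k 1)"
  unfolding dy_def
  by (rule pd_eqI, rule has_derivative_transform_within_open[OF d, of "- {0}"]) (use y eq in auto)

lemma dy_L: "x \<in> U \<Longrightarrow> y \<noteq> 0 \<Longrightarrow> dy i (sq F) x y = DL x y (axis i 1)"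
  by (rule dy_eqI[OF _ has_derivative_L_y]) auto

lemma dy_dy_L: "x \<in> U \<Longrightarrow> y \<noteq> 0 \<Longrightarrow> dy j (dy i (sq F)) x y = DDL x y (axis i 1) (axis j 1)"
  by (rule dy_eqI[OF _ has_derivative_DL_y]) (auto simp: dy_L)

lemma dx_L: "x \<in> U \<Longrightarrow> y \<noteq> 0 \<Longrightarrow> dx k (sq F) x y = DxL x y (axis k 1)"
  by (rule dx_cong[OF _ has_derivative_L_x]) auto

lemma dy_dx_L: "x \<in> U \<Longrightarrow> y \<noteq> 0 \<Longrightarrow> dy j (dx k (sq F)) x y = DyDxL x y (axis k 1) (axis j 1)"
  by (rule dy_eqI[OF _ has_derivative_DxL_y]) (auto simp: dx_L)

lemma linear_DDL: "x \<in> U \<Longrightarrow> y \<noteq> 0 \<Longrightarrow> linear (DDL x y w)" "x \<in> U \<Longrightarrow> y \<noteq> 0 \<Longrightarrow> linear (\<lambda>w. DDL x y w h)"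
  subgoal by (rule has_derivative_linear[OF has_derivative_DL_y])
  subgoal by (rule linearI) (simp_all add: DDL_def inner_add_right algebra_simps add_divide_distrib)
  done

lemma fund_tensor_F:
  assumes "x \<in> U" "y \<noteq> 0"
  shows "w \<bullet> (fund_tensor F x y *v h) = DDL x y w h / 2"
proof (rule bilinear_eqI[where e = w and w = h])
  show "linear (\<lambda>e. e \<bullet> (fund_tensor F x y *v w))" "linear (\<lambda>w. e \<bullet> (fund_tensor F x y *v w))" for e w
    by (rule linearI; simp add: inner_add_left inner_add_right matrix_vector_right_distrib matrix_vector_mult_scaleR)+
  show "linear (\<lambda>e. DDL x y e w / 2)" "linear (\<lambda>w. DDL x y e w / 2)" for e w
    using linear_DDL[OF assms] by (auto simp: linear_iff field_simps)
  show "axis i 1 \<bullet> (fund_tensor F x y *v axis j 1) = DDL x y (axis i 1) (axis j 1) / 2" for i j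
    by (simp add: axis_inner_vector matrix_vector_mult_basis column_def fund_tensor_def dy_dy_L[OF assms])
qed

text \<open>The fundamental tensor is positive on vectors orthogonal to both \<open>y\<close> and \<open>\<beta>\<close>, where it is
  \<open>\<phi> (\<phi> - s \<phi>')\<close> times the Riemannian metric.\<close>

lemma phi_minus_pos_orthogonal:
  assumes x: "x \<in> U" and y: "y \<noteq> 0" and e: "e \<noteq> 0" "ip x e y = 0" "b c x \<bullet> e = 0"
  shows "\<phi> (sv x y) - sv x y * \<phi>1 (sv x y) > 0"
proof -
  have "0 < DDL x y e e / 2"
    using posdef_F[OF x y e(1)] fund_tensor_F[OF x y] by simp
  also have "DDL x y e e / 2 = ip x e e * (\<phi> (sv x y) * (\<phi> (sv x y) - sv x y * \<phi>1 (sv x y)))"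
    using e(2,3) ip_sym[OF x, of y e] by (simp add: DDL_def Lk_def Phi_def Phi1_def power2_eq_square field_simps)
  finally show ?thesis
    using ip_pos[OF x e(1)] phi_pos[OF sv_in_I[OF x y]] by (simp add: zero_less_mult_iff)
qed

end

lemma exists_orthogonal2:
  fixes p q :: "real^'n::finite"
  assumes "CARD('n) \<ge> 3"
  shows "\<exists>e. e \<noteq> 0 \<and> p \<bullet> e = 0 \<and> q \<bullet> e = 0"
proof -
  have "dim {p, q} \<le> card {p, q}" by (rule dim_le_card') simp
  also have "\<dots> \<le> 2" by (simp add: card_insert_if)
  also have "\<dots> < DIM(real^'n)" using assms by simp
  finally obtain e where "e \<noteq> 0" "\<And>w. w \<in> span {p, q} \<Longrightarrow> orthogonal e w"
    using orthogonal_to_subspace_exists by blast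
  then show ?thesis
    by (metis insertCI inner_commute orthogonal_def span_base)
qed

context ab_chart
begin

lemma phi_minus_pos:
  assumes n: "CARD('n) \<ge> 3" and x: "x \<in> U" and y: "y \<noteq> 0"
  shows "\<phi> (sv x y) - sv x y * \<phi>1 (sv x y) > 0"
proof -
  obtain e where "e \<noteq> 0" "(a c x *v y) \<bullet> e = 0" "b c x \<bullet> e = 0"
    using exists_orthogonal2[OF n] by blast
  then show ?thesis using phi_minus_pos_orthogonal[OF x y] by (simp add: ip_def inner_commute)
qed

text \<open>\<open>r00\<close> is \<open>b\<^bsub>i|j\<^esub> y\<^sup>i y\<^sup>j\<close>. For closed \<open>\<beta>\<close> one seeks the spray of \<open>F\<close> in the form \<open>\<alpha>\<close>-spray \<open>+ P y + T b\<close>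
  with \<open>P = r00 \<Theta>/\<alpha>\<close> and \<open>T = r00 \<Psi>\<close>. The Euler--Lagrange equations then are linear equations for
  \<open>\<Theta>\<close> and \<open>\<Psi>\<close>, with the following solution.\<close>

definition r00 where "r00 x y = t x * (u x * ip x y y + v x * (b c x \<bullet> y)\<^sup>2)"

definition Psi where
  "Psi x s = \<phi>2 s / (2 * (\<phi> s - s * \<phi>1 s + (B x - s\<^sup>2) * \<phi>2 s))"

definition Theta where
  "Theta x s = (\<phi> s * \<phi>1 s - s * (\<phi> s * \<phi>2 s + (\<phi>1 s)\<^sup>2)) / (2 * \<phi> s * (\<phi> s - s * \<phi>1 s + (B x - s\<^sup>2) * \<phi>2 s))"

definition Pf where "Pf x y = r00 x y * Theta x (sv x y) / al x y"
definition Tf where "Tf x y = r00 x y * Psi x (sv x y)"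

definition spr :: "real^'n \<Rightarrow> real^'n \<Rightarrow> real^'n" where
  "spr x y = (1/2) *\<^sub>R Gam x y y + Pf x y *\<^sub>R y + Tf x y *\<^sub>R bs x"

text \<open>The coefficients of \<open>b\<^sub>i\<close> and of \<open>y\<^sub>i\<close> in the Euler--Lagrange equations.\<close>

lemma Theta_Psi_identities:
  assumes x: "x \<in> U" and s: "\<bar>s\<bar> \<le> sqrt (B x)"
  shows "2 * Theta x s * Phi1 s + 2 * Psi x s * (2 * Phi s + (B x - s\<^sup>2) * Phi2 s) = Phi2 s"
    "Theta x s * (2 * Phi s - s * Phi1 s) + Psi x s * (Phi1 s - s * Phi2 s) * (B x - s\<^sup>2) = (Phi1 s - s * Phi2 s) / 2"
proof -
  define M where "M = \<phi> s - s * \<phi>1 s + (B x - s\<^sup>2) * \<phi>2 s"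
  have M: "M > 0" using regular[OF x s] by (simp add: M_def)
  have p: "\<phi> s > 0" using phi_pos[OF s_range[OF x s]] .
  define z where "z = B x - s\<^sup>2"
  have M': "M = \<phi> s - s * \<phi>1 s + z * \<phi>2 s" by (simp add: M_def z_def)
  have T: "Theta x s = (\<phi> s * \<phi>1 s - s * (\<phi> s * \<phi>2 s + (\<phi>1 s)\<^sup>2)) / (2 * \<phi> s * M)"
    and P: "Psi x s = \<phi>2 s / (2 * M)" by (simp_all add: Theta_def Psi_def M_def)
  have TM: "Theta x s * (\<phi> s * M) = (\<phi> s * \<phi>1 s - s * (\<phi> s * \<phi>2 s + (\<phi>1 s)\<^sup>2)) / 2"
    and PM: "Psi x s * M = \<phi>2 s / 2"
    unfolding T P using M p by simp_all
  have "2 * (Theta x s * (\<phi> s * M)) * Phi1 s + 2 * (Psi x s * M) * \<phi> s * (2 * Phi s + z * Phi2 s) = Phi2 s * (\<phi> s * M)"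
    unfolding TM PM Phi_def Phi1_def Phi2_def unfolding M' by (simp add: field_simps power2_eq_square)
  then have "(2 * Theta x s * Phi1 s + 2 * Psi x s * (2 * Phi s + z * Phi2 s)) * (\<phi> s * M) = Phi2 s * (\<phi> s * M)"
    by (simp add: algebra_simps)
  then show "2 * Theta x s * Phi1 s + 2 * Psi x s * (2 * Phi s + (B x - s\<^sup>2) * Phi2 s) = Phi2 s"
    using M p by (simp add: z_def)
  have "(Theta x s * (\<phi> s * M)) * (2 * Phi s - s * Phi1 s) + (Psi x s * M) * \<phi> s * (Phi1 s - s * Phi2 s) * z = (Phi1 s - s * Phi2 s) / 2 * (\<phi> s * M)"
    unfolding TM PM Phi_def Phi1_def Phi2_def unfolding M' by (simp add: field_simps power2_eq_square)
  then have "(Theta x s * (2 * Phi s - s * Phi1 s) + Psi x s * (Phi1 s - s * Phi2 s) * z) * (\<phi> s * M) = (Phi1 s - s * Phi2 s) / 2 * (\<phi> s * M)"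
    by (simp add: algebra_simps)
  then show "Theta x s * (2 * Phi s - s * Phi1 s) + Psi x s * (Phi1 s - s * Phi2 s) * (B x - s\<^sup>2) = (Phi1 s - s * Phi2 s) / 2"
    using M p by (simp add: z_def)
qed

text \<open>The Christoffel terms cancel by metric compatibility, and the terms with \<open>b\<^bsub>i|j\<^esub> y\<^sup>j\<close> because \<open>b\<^bsub>i|j\<^esub>\<close>
  is symmetric. Only terms with the factor \<open>r00\<close> remain, and \<open>\<Theta>\<close> and \<open>\<Psi>\<close> are made for them.\<close>

lemma euler_lagrange:
  assumes x: "x \<in> U" and y: "y \<noteq> 0"
  shows "DyDxL x y y w - DxL x y w = 2 * DDL x y w (spr x y)"
proof -
  define s A where "s = sv x y" and "A = al x y"
  have A: "A > 0" using al_pos[OF x y] by (simp add: A_def)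
  have ipy: "ip x y y = A * A" using al_mult[OF x] by (simp add: A_def)
  have by': "b c x \<bullet> y = s * A" using A by (simp add: s_def sv_def A_def)
  have sy: "sy x y h = (b c x \<bullet> h) / A - s * ip x y h / (A * A)" for h
    unfolding sy_def s_def[symmetric] A_def[symmetric] unfolding ipy ..
  \<comment> \<open>All vectors enter only through the following scalars.\<close>
  define g gw bG where "g = ip x y (Gam x y y)" and "gw = ip x w (Gam x y y)" and "bG = b c x \<bullet> Gam x y y"
  define h where "h = ip x y (Gam x w y)"
  define h' where "h' = b c x \<bullet> Gam x w y"
  define W bw where "W = ip x y w" and "bw = b c x \<bullet> w"
  have ws: "ip x w y = W" using ip_sym[OF x] by (simp add: W_def)
  have d1: "dip x y y y = 2 * g" "dip x y w y = gw + h" "dip x w y y = 2 * h"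
    using ip_sym[OF x, of y] Gam_sym[OF x, of w y]
    by (simp_all add: metric_compatible[OF x] g_def gw_def h_def)
  define R Cw where "R = r00 x y" and "Cw = t x * (u x * W + v x * bw * (s * A))"
  have d2: "db x y \<bullet> y = bG + R" "db x y \<bullet> w = h' + Cw" "db x w \<bullet> y = h' + Cw"
    using cov_b[OF x, of y y] cov_b[OF x, of y w] cov_b[OF x, of w y] Gam_sym[OF x, of w y]
    by (simp_all add: bG_def h'_def R_def Cw_def r00_def power2_eq_square ws W_def[symmetric] bw_def[symmetric] by' mult_ac)
  have E: "DyDxL x y y w - DxL x y w - DDL x y w (Gam x y y) 
      = R * (W * (Phi1 s - s * Phi2 s) / A + Phi2 s * bw)"
    unfolding DyDxL_def DxL_def DDL_def d1 d2 sy ws s_def[symmetric] A_def[symmetric] W_def[symmetric] bw_def[symmetric]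
      g_def[symmetric] gw_def[symmetric] bG_def[symmetric] Lk1_def
    using A by (simp add: field_simps)
  have D1: "DDL x y w y = 2 * W * Lk s + A * Phi1 s * bw"
    unfolding DDL_def sy ws s_def[symmetric] A_def[symmetric] W_def[symmetric] bw_def[symmetric] by' ipy
    using A by (simp add: field_simps)
  have D2: "A * DDL x y w (bs x) = W * (Phi1 s - s * Phi2 s) * (B x - s\<^sup>2) + bw * (2 * Phi s + (B x - s\<^sup>2) * Phi2 s)  * A"
    unfolding DDL_def sy ws s_def[symmetric] A_def[symmetric] W_def[symmetric] ip_bs[OF x] by' normsq_eq[symmetric] bw_def[symmetric]
    using A by (simp add: Lk_def Lk1_def field_simps power2_eq_square)
  note id = Theta_Psi_identities[OF x abs_sv_le[OF x y], folded s_def]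
  have "A * (2 * DDL x y w (Pf x y *\<^sub>R y + Tf x y *\<^sub>R bs x)) = 
     2 * R * (Theta x s * (2 * W * Lk s + A * Phi1 s * bw)) + 2 * R * Psi x s * (A * DDL x y w (bs x))"
    using A linear_DDL(1)[OF x y, of w]
    by (simp add: linear_add linear_cmul D1 Pf_def Tf_def R_def[symmetric] s_def[symmetric] A_def[symmetric] field_simps)
  also have "\<dots> = R * W * 2 * (Theta x s * (2 * Phi s - s * Phi1 s) + Psi x s * (Phi1 s - s * Phi2 s) * (B x - s\<^sup>2))
     + R * A * bw * (2 * Theta x s * Phi1 s + 2 * Psi x s * (2 * Phi s + (B x - s\<^sup>2) * Phi2 s))"
    unfolding D2 by (simp add: Lk_def algebra_simps)
  also have "\<dots> = A * (DyDxL x y y w - DxL x y w - DDL x y w (Gam x y y))"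
    unfolding id E using A by (simp add: field_simps)
  finally have "2 * DDL x y w (Pf x y *\<^sub>R y + Tf x y *\<^sub>R bs x) = DyDxL x y y w - DxL x y w - DDL x y w (Gam x y y)"
    using A by simp
  then show ?thesis
    using linear_DDL(1)[OF x y, of w] by (simp add: spr_def linear_add linear_cmul)
qed

lemma linear_DyDxL: "x \<in> U \<Longrightarrow> linear (\<lambda>h. DyDxL x y h w)"
  using linear_db[of x]
  by (intro linearI) (simp_all add: DyDxL_def linear_add linear_cmul inner_add_left algebra_simps add_divide_distrib)

lemma spray_F:
  assumes x: "x \<in> U" and y: "y \<noteq> 0"
  shows "spray F i x y = spr x y $ i"
proof -
  let ?g = "fund_tensor F x y"
  have inv: "invertible ?g" by (rule posdef_invertible) (rule posdef_F[OF x y])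
  have EL: "(\<Sum>k\<in>UNIV. dy l (dx k (sq F)) x y * y $ k) - dx l (sq F) x y = 4 * (?g *v spr x y) $ l" for l
  proof -
    have "(\<Sum>k\<in>UNIV. dy l (dx k (sq F)) x y * y $ k) = DyDxL x y y (axis l 1)"
      using linear_sum_axis[OF linear_DyDxL[OF x], of y "axis l 1" y] by (simp add: dy_dx_L[OF x y])
    moreover have "(?g *v spr x y) $ l = DDL x y (axis l 1) (spr x y) / 2"
      using fund_tensor_F[OF x y, of "axis l 1" "spr x y"] by (simp add: axis_inner_vector)
    ultimately show ?thesis by (simp add: dx_L[OF x y] euler_lagrange[OF x y])
  qed
  have "spray F i x y = (matrix_inv ?g *v (?g *v spr x y)) $ i"
    unfolding spray_def EL by (simp add: matrix_vector_mult_def[of "matrix_inv _"] sum_distrib_left mult_ac)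
  then show ?thesis by (simp add: matrix_inv_mul_vector(2)[OF inv])
qed

end

section \<open>The equation for \<open>\<rho>\<close>\<close>

text \<open>The functions \<open>r\<close>, \<open>r1\<close>, \<open>r2\<close> stand for \<open>\<rho> = \<phi>''/(\<phi> - s \<phi>')\<close> and its first two derivatives, and \<open>q\<close>
  for a value of \<open>b\<^sup>2\<close>. Subscripts \<open>s\<close> and \<open>B\<close> denote partial derivatives with respect to \<open>s\<close> and
  \<open>q\<close>. The expression \<open>E\<close> is the scalar equation that remains of scalar flag curvature, divided by
  \<open>\<tau>\<^sup>2\<close>; the number \<open>\<mu>\<close> is \<open>\<lambda>/\<tau>\<^sup>2\<close> at the point considered.\<close>

locale riccati =
  fixes k1 k2 k3 :: real and r r1 r2 :: "real \<Rightarrow> real"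
begin

definition D where "D q = 1 + (k1 + k3) * q + k2 * q\<^sup>2"
definition D' where "D' q = k1 + k3 + 2 * k2 * q"
definition kap where "kap s = k1 + k2 * s\<^sup>2"
definition N where "N s q = 1 + (q - s\<^sup>2) * r s"
definition Ns where "Ns s q = (q - s\<^sup>2) * r1 s - 2 * s * r s"
definition Nss where "Nss s q = (q - s\<^sup>2) * r2 s - 4 * s * r1 s - 2 * r s"
definition sig where "sig s = D (s\<^sup>2) * r s - kap s"
definition sig1 where "sig1 s = 2 * s * D' (s\<^sup>2) * r s + D (s\<^sup>2) * r1 s - 2 * k2 * s"
definition sig2 where
  "sig2 s = (2 * (k1 + k3) + 12 * k2 * s\<^sup>2) * r s + 4 * s * D' (s\<^sup>2) * r1 s + D (s\<^sup>2) * r2 s - 2 * k2"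
definition f where "f s q = sig s / (2 * N s q)"
definition fs where "fs s q = (sig1 s * N s q - sig s * Ns s q) / (2 * (N s q)\<^sup>2)"
definition fss where
  "fss s q = sig2 s / (2 * N s q) - sig1 s * Ns s q / (N s q)\<^sup>2 - sig s * Nss s q / (2 * (N s q)\<^sup>2)
     + sig s * (Ns s q)\<^sup>2 / (N s q)^3"
definition fB where "fB s q = - sig s * r s / (2 * (N s q)\<^sup>2)"
definition fsB where
  "fsB s q = - sig1 s * r s / (2 * (N s q)\<^sup>2) - sig s * r1 s / (2 * (N s q)\<^sup>2) + sig s * r s * Ns s q / (N s q)^3"

definition E where
  "E s q \<mu> =
     2 * D q * (2 * fB s q - s * fsB s q)
     + (k3 - 2 * k1 - k1\<^sup>2 * q - \<mu> + D' q) * (2 * f s q - s * fs s q)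
     + 2 * k1 * f s q + s * (k3 + k2 * s\<^sup>2) * fs s q - D (s\<^sup>2) * fss s q
     + 4 * (f s q)\<^sup>2 - 2 * s * f s q * fs s q
     + (q - s\<^sup>2) * (2 * f s q * fss s q - (fs s q)\<^sup>2)"

lemma sig_derivs:
  assumes "(r has_real_derivative r1 s) (at s)" "(r1 has_real_derivative r2 s) (at s)"
  shows "(sig has_real_derivative sig1 s) (at s)" "(sig1 has_real_derivative sig2 s) (at s)"
  unfolding sig_def[abs_def] sig1_def[abs_def] sig2_def D_def D'_def kap_def
  by (auto intro!: derivative_eq_intros assms simp: algebra_simps power2_eq_square eval_nat_numeral)

lemma has_derivative_fst_comp:
  assumes "(g has_real_derivative g') (at s)"
  shows "((\<lambda>p. g (fst p)) has_derivative (\<lambda>d. g' * fst d)) (at (s, q :: real))"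
  by (rule has_derivative_comp_real[where f = fst and f' = fst])
     (use assms in \<open>auto intro: has_derivative_fst[OF has_derivative_ident]\<close>)

lemma N_derivs:
  assumes "(r has_real_derivative r1 s) (at s)" "(r1 has_real_derivative r2 s) (at s)"
  shows "((\<lambda>p. N (fst p) (snd p)) has_derivative (\<lambda>d. Ns s q * fst d + r s * snd d)) (at (s, q))"
    "((\<lambda>p. Ns (fst p) (snd p)) has_derivative (\<lambda>d. Nss s q * fst d + r1 s * snd d)) (at (s, q))"
  unfolding N_def Ns_def Nss_def
  by (auto intro!: derivative_eq_intros has_derivative_fst_comp[OF assms(1)] has_derivative_fst_comp[OF assms(2)] simp: algebra_simps power2_eq_square)

lemma f_derivs:
  assumes r: "(r has_real_derivative r1 s) (at s)" "(r1 has_real_derivative r2 s) (at s)"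
    and N: "N s q \<noteq> 0"
  shows "((\<lambda>p. f (fst p) (snd p)) has_derivative (\<lambda>d. fs s q * fst d + fB s q * snd d)) (at (s, q))"
    "((\<lambda>p. fs (fst p) (snd p)) has_derivative (\<lambda>d. fss s q * fst d + fsB s q * snd d)) (at (s, q))"
proof -
  note d = has_derivative_fst_comp[OF sig_derivs(1)[OF r]] has_derivative_fst_comp[OF sig_derivs(2)[OF r]] N_derivs[OF r]
  show "((\<lambda>p. f (fst p) (snd p)) has_derivative (\<lambda>d. fs s q * fst d + fB s q * snd d)) (at (s, q))"
    unfolding f_def
    by (rule has_derivative_eq_rhs, rule has_derivative_divide[OF d(1) has_derivative_mult_right[OF d(3)]])
       (use N in \<open>auto simp: fs_def fB_def field_simps power2_eq_square\<close>)
  have sq: "((\<lambda>p. 2 * (N (fst p) (snd p))\<^sup>2) has_derivative (\<lambda>d. 4 * N s q * (Ns s q * fst d + r s * snd d))) (at (s, q))"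
    by (auto intro!: derivative_eq_intros d simp: algebra_simps)
  have num: "((\<lambda>p. sig1 (fst p) * N (fst p) (snd p) - sig (fst p) * Ns (fst p) (snd p)) has_derivative
      (\<lambda>h. (sig2 s * N s q - sig s * Nss s q) * fst h + (sig1 s * r s - sig s * r1 s) * snd h)) (at (s, q))"
    by (auto intro!: derivative_eq_intros d simp: algebra_simps)
  show "((\<lambda>p. fs (fst p) (snd p)) has_derivative (\<lambda>d. fss s q * fst d + fsB s q * snd d)) (at (s, q))"
    unfolding fs_def
    by (rule has_derivative_eq_rhs, rule has_derivative_divide[OF num sq])
       (use N in \<open>auto simp: fss_def fsB_def field_simps power2_eq_square power3_eq_cube\<close>)
qed

text \<open>\<open>h\<close> is the factor in \<open>T = \<tau> \<alpha>\<^sup>2 h\<close>. It equals \<open>\<kappa>/2\<close> exactly when \<open>\<sigma> = 0\<close>.\<close>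

definition h where "h s q = kap s / 2 + f s q"
definition hs where "hs s q = k2 * s + fs s q"

lemma h_eq:
  assumes "N s q \<noteq> 0"
  shows "h s q = (1 + k1 * q + (k2 * q + k3) * s\<^sup>2) * r s / (2 * N s q)"
  using assms by (simp add: h_def f_def sig_def kap_def D_def field_simps) (simp add: N_def algebra_simps power2_eq_square power4_eq_xxxx)

lemma h_derivs:
  assumes r: "(r has_real_derivative r1 s) (at s)" "(r1 has_real_derivative r2 s) (at s)"
    and N: "N s q \<noteq> 0"
  shows "((\<lambda>p. h (fst p) (snd p)) has_derivative (\<lambda>d. hs s q * fst d + fB s q * snd d)) (at (s, q))"
    "((\<lambda>p. hs (fst p) (snd p)) has_derivative (\<lambda>d. (k2 + fss s q) * fst d + fsB s q * snd d)) (at (s, q))"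
  unfolding h_def hs_def kap_def
  by (auto intro!: derivative_eq_intros f_derivs[OF assms] simp: hs_def algebra_simps)

text \<open>The right-hand side is what the curvature computation produces. It vanishes identically for
  \<open>h = \<kappa>/2\<close>, whatever \<open>\<mu>\<close> is, so that every term of \<open>E\<close> contains \<open>f\<close>.\<close>

lemma E_eq:
  fixes q :: real
  defines "u \<equiv> 1 + k1 * q" and "v \<equiv> k2 * q + k3"
  shows "E s q \<mu> = (k3 - 2 * k1 - k1\<^sup>2 * q - \<mu>) * (2 * h s q - s * hs s q)
     + (k1\<^sup>2 + k2 - 2 * k1 * k3 - k1 * (k2 - k1\<^sup>2) * q + k1 * \<mu>)
     + 4 * (u + v * q) * fB s q - 2 * s * (u + v * q) * fsB s q - (u + v * s\<^sup>2) * (k2 + fss s q)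
     + 2 * v * h s q + 4 * (h s q)\<^sup>2 - 2 * s * h s q * hs s q
     + (q - s\<^sup>2) * (2 * h s q * (k2 + fss s q) - (hs s q)\<^sup>2)"
  unfolding E_def h_def hs_def kap_def D_def D'_def u_def v_def
  by (simp add: algebra_simps power2_eq_square add_divide_distrib diff_divide_distrib)

end

section \<open>Twice differentiable functions of two variables\<close>

text \<open>The curvature formula asks for the existence of the derivatives of \<open>P\<close>. Closure properties of this
  class provide it without computing them.\<close>

definition pair2 :: "(real \<times> real) set \<Rightarrow> (real \<Rightarrow> real \<Rightarrow> real) \<Rightarrow> bool" where
  "pair2 P g \<longleftrightarrow> (\<exists>gs gB. \<forall>s q. (s, q) \<in> P \<longrightarrow>
     ((\<lambda>p. g (fst p) (snd p)) has_derivative (\<lambda>d. gs s q * fst d + gB s q * snd d)) (at (s, q)) \<and>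
     (\<lambda>p. gs (fst p) (snd p)) differentiable (at (s, q)))"

lemma pair2I:
  assumes "\<And>s q. (s, q) \<in> P \<Longrightarrow>
     ((\<lambda>p. g (fst p) (snd p)) has_derivative (\<lambda>d. gs s q * fst d + gB s q * snd d)) (at (s, q))"
    "\<And>s q. (s, q) \<in> P \<Longrightarrow> (\<lambda>p. gs (fst p) (snd p)) differentiable (at (s, q))"
  shows "pair2 P g"
  unfolding pair2_def using assms by blast

lemma pair2E:
  assumes "pair2 P g"
  obtains gs gB where
    "\<And>s q. (s, q) \<in> P \<Longrightarrow>
     ((\<lambda>p. g (fst p) (snd p)) has_derivative (\<lambda>d. gs s q * fst d + gB s q * snd d)) (at (s, q))"
    "\<And>s q. (s, q) \<in> P \<Longrightarrow> (\<lambda>p. gs (fst p) (snd p)) differentiable (at (s, q))"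
proof -
  from assms obtain gs gB where
    "\<forall>s q. (s, q) \<in> P \<longrightarrow>
     ((\<lambda>p. g (fst p) (snd p)) has_derivative (\<lambda>d. gs s q * fst d + gB s q * snd d)) (at (s, q)) \<and>
     (\<lambda>p. gs (fst p) (snd p)) differentiable (at (s, q))"
    unfolding pair2_def by (elim exE)
  then show thesis by (intro that[of gs gB]) simp_all
qed

lemma pair2_differentiable: "pair2 P g \<Longrightarrow> (s, q) \<in> P \<Longrightarrow> (\<lambda>p. g (fst p) (snd p)) differentiable (at (s, q))"
  by (erule pair2E) (auto simp: differentiable_def)

lemma pair2_const: "pair2 P (\<lambda>s q. k)"
  by (rule pair2I[where gs = "\<lambda>_ _. 0" and gB = "\<lambda>_ _. 0"]) (auto intro!: derivative_eq_intros)

lemma pair2_fst: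
  assumes "\<And>s q. (s, q) \<in> P \<Longrightarrow> (g has_real_derivative g' s) (at s)"
    "\<And>s q. (s, q) \<in> P \<Longrightarrow> (g' has_real_derivative g'' s) (at s)"
  shows "pair2 P (\<lambda>s q. g s)"
proof (rule pair2I[where gs = "\<lambda>s q. g' s" and gB = "\<lambda>_ _. 0"])
  show "((\<lambda>p. g (fst p)) has_derivative (\<lambda>d. g' s * fst d + 0 * snd d)) (at (s, q))" if "(s, q) \<in> P" for s q
    using riccati.has_derivative_fst_comp[OF assms(1)[OF that], of q] by simp
  show "(\<lambda>p. g' (fst p)) differentiable (at (s, q))" if "(s, q) \<in> P" for s q
    using riccati.has_derivative_fst_comp[OF assms(2)[OF that], of q] unfolding differentiable_def by blast
qed

lemma pair2_snd: "pair2 P (\<lambda>s q. q)"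
  by (rule pair2I[where gs = "\<lambda>_ _. 0" and gB = "\<lambda>_ _. 1"]) (auto intro!: derivative_eq_intros)

lemma pair2_add:
  assumes "pair2 P g" "pair2 P g'" shows "pair2 P (\<lambda>s q. g s q + g' s q)"
proof -
  from assms(1) obtain gs gB where g: "\<And>s q. (s, q) \<in> P \<Longrightarrow>
     ((\<lambda>p. g (fst p) (snd p)) has_derivative (\<lambda>d. gs s q * fst d + gB s q * snd d)) (at (s, q))"
    "\<And>s q. (s, q) \<in> P \<Longrightarrow> (\<lambda>p. gs (fst p) (snd p)) differentiable (at (s, q))"
    by (rule pair2E) (rule that)
  from assms(2) obtain gs' gB' where g': "\<And>s q. (s, q) \<in> P \<Longrightarrow>
     ((\<lambda>p. g' (fst p) (snd p)) has_derivative (\<lambda>d. gs' s q * fst d + gB' s q * snd d)) (at (s, q))"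
    "\<And>s q. (s, q) \<in> P \<Longrightarrow> (\<lambda>p. gs' (fst p) (snd p)) differentiable (at (s, q))"
    by (rule pair2E) (rule that)
  note d = g(1) g'(1) g(2) g'(2)
  show ?thesis
  proof (rule pair2I)
    fix s q assume p: "(s, q) \<in> P"
    show "((\<lambda>p. g (fst p) (snd p) + g' (fst p) (snd p)) has_derivative
        (\<lambda>d. (gs s q + gs' s q) * fst d + (gB s q + gB' s q) * snd d)) (at (s, q))"
      by (rule has_derivative_eq_rhs[OF has_derivative_add[OF d(1)[OF p] d(2)[OF p]]]) (simp add: algebra_simps)
    show "(\<lambda>p. gs (fst p) (snd p) + gs' (fst p) (snd p)) differentiable (at (s, q))"
      by (intro differentiable_add d(3)[OF p] d(4)[OF p])
  qed
qed

lemma pair2_mult: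
  assumes "pair2 P g" "pair2 P g'" shows "pair2 P (\<lambda>s q. g s q * g' s q)"
proof -
  from assms(1) obtain gs gB where g: "\<And>s q. (s, q) \<in> P \<Longrightarrow>
     ((\<lambda>p. g (fst p) (snd p)) has_derivative (\<lambda>d. gs s q * fst d + gB s q * snd d)) (at (s, q))"
    "\<And>s q. (s, q) \<in> P \<Longrightarrow> (\<lambda>p. gs (fst p) (snd p)) differentiable (at (s, q))"
    by (rule pair2E) (rule that)
  from assms(2) obtain gs' gB' where g': "\<And>s q. (s, q) \<in> P \<Longrightarrow>
     ((\<lambda>p. g' (fst p) (snd p)) has_derivative (\<lambda>d. gs' s q * fst d + gB' s q * snd d)) (at (s, q))"
    "\<And>s q. (s, q) \<in> P \<Longrightarrow> (\<lambda>p. gs' (fst p) (snd p)) differentiable (at (s, q))"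
    by (rule pair2E) (rule that)
  note d = g(1) g'(1) g(2) g'(2)
  show ?thesis
  proof (rule pair2I)
    fix s q assume p: "(s, q) \<in> P"
    note g = pair2_differentiable[OF assms(1) p] pair2_differentiable[OF assms(2) p]
    show "((\<lambda>p. g (fst p) (snd p) * g' (fst p) (snd p)) has_derivative
        (\<lambda>d. (gs s q * g' s q + g s q * gs' s q) * fst d + (gB s q * g' s q + g s q * gB' s q) * snd d)) (at (s, q))"
      by (rule has_derivative_eq_rhs[OF has_derivative_mult[OF d(1)[OF p] d(2)[OF p]]]) (simp add: algebra_simps)
    show "(\<lambda>p. gs (fst p) (snd p) * g' (fst p) (snd p) + g (fst p) (snd p) * gs' (fst p) (snd p)) differentiable (at (s, q))"
      by (intro differentiable_add differentiable_mult d(3)[OF p] d(4)[OF p] g)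
  qed
qed

lemma pair2_inverse:
  assumes "pair2 P g" "\<And>s q. (s, q) \<in> P \<Longrightarrow> g s q \<noteq> 0" shows "pair2 P (\<lambda>s q. inverse (g s q))"
proof -
  from assms(1) obtain gs gB where d: "\<And>s q. (s, q) \<in> P \<Longrightarrow>
     ((\<lambda>p. g (fst p) (snd p)) has_derivative (\<lambda>d. gs s q * fst d + gB s q * snd d)) (at (s, q))"
    "\<And>s q. (s, q) \<in> P \<Longrightarrow> (\<lambda>p. gs (fst p) (snd p)) differentiable (at (s, q))"
    by (rule pair2E) (rule that)
  show ?thesis
  proof (rule pair2I)
    fix s q assume p: "(s, q) \<in> P"
    note g = pair2_differentiable[OF assms(1) p]
    have nz: "g (fst (s, q)) (snd (s, q)) \<noteq> 0" using assms(2)[OF p] by simp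
    show "((\<lambda>p. inverse (g (fst p) (snd p))) has_derivative
        (\<lambda>d. - (inverse (g s q) * gs s q * inverse (g s q)) * fst d + - (inverse (g s q) * gB s q * inverse (g s q)) * snd d)) (at (s, q))"
      by (rule has_derivative_eq_rhs[OF Deriv.has_derivative_inverse[OF nz d(1)[OF p]]]) (simp add: algebra_simps)
    show "(\<lambda>p. - (inverse (g (fst p) (snd p)) * gs (fst p) (snd p) * inverse (g (fst p) (snd p)))) differentiable (at (s, q))"
      by (intro differentiable_minus differentiable_mult differentiable_inverse d(2)[OF p] g nz)
  qed
qed

lemma pair2_diff: "pair2 P g \<Longrightarrow> pair2 P g' \<Longrightarrow> pair2 P (\<lambda>s q. g s q - g' s q)"
  using pair2_add[OF _ pair2_mult[OF pair2_const[of P "- 1"], of g'], of g] by simp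

lemma pair2_divide:
  "pair2 P g \<Longrightarrow> pair2 P g' \<Longrightarrow> (\<And>s q. (s, q) \<in> P \<Longrightarrow> g' s q \<noteq> 0) \<Longrightarrow> pair2 P (\<lambda>s q. g s q / g' s q)"
  unfolding divide_inverse by (intro pair2_mult pair2_inverse)

section \<open>Contracted curvature of a spray\<close>

text \<open>Index sums become directional derivatives of the vector-valued function \<open>S\<close> in this form. The first
  argument of \<open>Sxy\<close> and \<open>Syy\<close> is the direction of the derivative taken first, which is with respect
  to \<open>y\<close>.\<close>

context riemannian_chart
begin

lemma riemann_curv_contract:
  fixes S :: "real^'n \<Rightarrow> real^'n \<Rightarrow> real^'n"
  assumes x: "x \<in> U" and y: "y \<noteq> 0"
    and spr: "\<And>z w i. z \<in> U \<Longrightarrow> w \<noteq> 0 \<Longrightarrow> spray G i z w = S z w $ i"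
    and Sx: "((\<lambda>z. S z y) has_derivative Sx) (at x)"
    and Sy: "\<And>z w. z \<in> U \<Longrightarrow> w \<noteq> 0 \<Longrightarrow> (S z has_derivative Sy z w) (at w)"
    and Sxy: "\<And>h. ((\<lambda>z. Sy z y h) has_derivative Sxy h) (at x)"
    and Syy: "\<And>h. ((\<lambda>w. Sy x w h) has_derivative Syy h) (at y)"
  shows "(\<Sum>i\<in>UNIV. \<Sum>k\<in>UNIV. \<nu> $ i * w $ k * riemann_curv G i k x y) =
     \<nu> \<bullet> (2 *\<^sub>R Sx w - Sxy w y + 2 *\<^sub>R Syy w (S x y) - Sy x y (Sy x y w))"
proof -
  note nth = bounded_linear.has_derivative[OF bounded_linear_vec_nth]
  have linSy: "linear (Sy z w)" if "z \<in> U" "w \<noteq> 0" for z w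
    by (rule has_derivative_linear[OF Sy[OF that]])
  have lin_Sxy: "linear (\<lambda>h. Sxy h d)" for d
  proof (rule linearI)
    fix p q
    have "((\<lambda>z. Sy z y (p + q)) has_derivative (\<lambda>d. Sxy p d + Sxy q d)) (at x)"
      by (rule has_derivative_transform_within_open[OF has_derivative_add[OF Sxy Sxy] open_U x])
         (simp add: linear_add[OF linSy[OF _ y]])
    from has_derivative_unique[OF this Sxy] show "Sxy (p + q) d = Sxy p d + Sxy q d" by metis
  next
    fix k p
    have "((\<lambda>z. Sy z y (k *\<^sub>R p)) has_derivative (\<lambda>d. k *\<^sub>R Sxy p d)) (at x)"
      by (rule has_derivative_transform_within_open[OF has_derivative_scaleR_right[OF Sxy] open_U x])
         (simp add: linear_cmul[OF linSy[OF _ y]])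
    from has_derivative_unique[OF this Sxy] show "Sxy (k *\<^sub>R p) d = k *\<^sub>R Sxy p d" by metis
  qed
  have op: "open (- {0 :: real^'n})" by (rule open_Compl) simp
  have lin_Syy: "linear (\<lambda>h. Syy h d)" for d
  proof (rule linearI)
    fix p q
    have "((\<lambda>w. Sy x w (p + q)) has_derivative (\<lambda>d. Syy p d + Syy q d)) (at y)"
      by (rule has_derivative_transform_within_open[OF has_derivative_add[OF Syy Syy] op])
         (use y x in \<open>auto simp: linear_add[OF linSy]\<close>)
    from has_derivative_unique[OF this Syy] show "Syy (p + q) d = Syy p d + Syy q d" by metis
  next
    fix k p
    have "((\<lambda>w. Sy x w (k *\<^sub>R p)) has_derivative (\<lambda>d. k *\<^sub>R Syy p d)) (at y)"
      by (rule has_derivative_transform_within_open[OF has_derivative_scaleR_right[OF Syy] op])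
         (use y x in \<open>auto simp: linear_cmul[OF linSy]\<close>)
    from has_derivative_unique[OF this Syy] show "Syy (k *\<^sub>R p) d = k *\<^sub>R Syy p d" by metis
  qed
  have lin_Sx: "linear Sx" by (rule has_derivative_linear[OF Sx])
  note lin_nth = linear_compose[OF _ bounded_linear.linear[OF bounded_linear_vec_nth], unfolded comp_def]
  have dx1: "dx k (spray G i) x y = Sx (axis k 1) $ i" for i k
    by (rule dx_cong[where g = "\<lambda>z y. S z y $ i", OF x nth[OF Sx]]) (simp add: spr y)
  have dy1: "dy k (spray G i) z w = Sy z w (axis k 1) $ i" if "z \<in> U" "w \<noteq> 0" for i k z w
    unfolding dy_def
    by (rule pd_eqI, rule has_derivative_transform_within_open[OF nth[OF Sy[OF that]] op])
       (use that spr in auto)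
  have dxy: "dx j (dy k (spray G i)) x y = Sxy (axis k 1) (axis j 1) $ i" for i j k
    by (rule dx_cong[where g = "\<lambda>z y. Sy z y (axis k 1) $ i", OF x nth[OF Sxy]]) (simp add: dy1 y)
  have dyy: "dy j (dy k (spray G i)) x y = Syy (axis k 1) (axis j 1) $ i" for i j k
    unfolding dy_def[of j]
    by (rule pd_eqI, rule has_derivative_transform_within_open[OF nth[OF Syy] op])
       (use y x dy1 in auto)
  define Q where "Q h = 2 *\<^sub>R Sx h - Sxy h y + 2 *\<^sub>R Syy h (S x y) - Sy x y (Sy x y h)" for h
  have "riemann_curv G i k x y = Q (axis k 1) $ i" for i k
  proof -
    have 1: "(\<Sum>j\<in>UNIV. y $ j * dx j (dy k (spray G i)) x y) = Sxy (axis k 1) y $ i"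
      using linear_sum_axis[OF lin_nth[OF has_derivative_linear[OF Sxy]], of "axis k 1" i y]
      by (simp add: dxy mult.commute)
    have 2: "(\<Sum>j\<in>UNIV. spray G j x y * dy j (dy k (spray G i)) x y) = Syy (axis k 1) (S x y) $ i"
      using linear_sum_axis[OF lin_nth[OF has_derivative_linear[OF Syy]], of "axis k 1" i "S x y"]
      by (simp add: dyy mult.commute spr[OF x y])
    have 3: "(\<Sum>j\<in>UNIV. dy j (spray G i) x y * dy k (spray G j) x y) = Sy x y (Sy x y (axis k 1)) $ i"
      using linear_sum_axis[OF lin_nth[OF linSy[OF x y]], of i "Sy x y (axis k 1)"]
      by (simp add: dy1[OF x y])
    show ?thesis unfolding riemann_curv_def 1 2 3 Q_def dx1 by simp
  qed
  moreover have "linear (\<lambda>h. \<nu> \<bullet> Q h)"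
  proof (rule linearI)
    show "\<nu> \<bullet> Q (p + q) = \<nu> \<bullet> Q p + \<nu> \<bullet> Q q" for p q
      unfolding Q_def
      by (simp add: linear_add[OF lin_Sx] linear_add[OF lin_Sxy] linear_add[OF lin_Syy] linear_add[OF linSy[OF x y]]
          inner_add_right inner_diff_right algebra_simps)
    show "\<nu> \<bullet> Q (k *\<^sub>R p) = k *\<^sub>R (\<nu> \<bullet> Q p)" for k p
      unfolding Q_def
      by (simp add: linear_cmul[OF lin_Sx] linear_cmul[OF lin_Sxy] linear_cmul[OF lin_Syy] linear_cmul[OF linSy[OF x y]]
          inner_add_right inner_diff_right algebra_simps)
  qed
  from linear_sum_axis[OF this, of w] have "(\<Sum>k\<in>UNIV. (\<nu> \<bullet> Q (axis k 1)) * w $ k) = \<nu> \<bullet> Q w" .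
  moreover have "(\<Sum>k\<in>UNIV. (\<nu> \<bullet> Q (axis k 1)) * w $ k) = (\<Sum>i\<in>UNIV. \<Sum>k\<in>UNIV. \<nu> $ i * w $ k * (Q (axis k 1) $ i))"
    by (subst sum.swap) (simp add: inner_vec_def sum_distrib_left mult_ac)
  ultimately show ?thesis unfolding Q_def by simp
qed

definition dGam where "dGam x h p q = frechet_derivative (\<lambda>z. Gam z p q) (at x) h"

lemma has_derivative_Gam_x: "x \<in> U \<Longrightarrow> ((\<lambda>z. Gam z p q) has_derivative (\<lambda>h. dGam x h p q)) (at x)"
  unfolding dGam_def using differentiable_Gam[of x p q] by (simp add: frechet_derivative_works[symmetric])

lemma has_derivative_Gam_y:
  assumes "x \<in> U" "(p has_derivative p') (at y)"
  shows "((\<lambda>w. Gam x h (p w)) has_derivative (\<lambda>d. Gam x h (p' d))) (at y)"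
  using bounded_linear.has_derivative[OF bounded_linear_Gam(1)[OF assms(1)] assms(2)] .

lemma has_derivative_Gam_self:
  assumes "x \<in> U"
  shows "((\<lambda>w. (1/2) *\<^sub>R Gam x w w) has_derivative (\<lambda>d. Gam x y d)) (at y)"
proof -
  have "bounded_bilinear (Gam x)"
    unfolding bilinear_conv_bounded_bilinear[symmetric] bilinear_def
    using bounded_linear_Gam[OF assms] by (simp add: linear_conv_bounded_linear)
  from bounded_bilinear.FDERIV[OF this has_derivative_ident has_derivative_ident]
  have "((\<lambda>w. Gam x w w) has_derivative (\<lambda>d. Gam x y d + Gam x d y)) (at y)" .
  from has_derivative_scaleR_right[OF this, of "1/2"] show ?thesis
    by (simp add: Gam_sym[OF assms, of _ y] scaleR_2[symmetric])
qed

lemma riemann_curv_alpha_contract: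
  assumes x: "x \<in> U" and y: "y \<noteq> 0"
  shows "(\<Sum>i\<in>UNIV. \<Sum>k\<in>UNIV. \<nu> $ i * w $ k * riemann_curv (alpha a c) i k x y) =
     \<nu> \<bullet> (dGam x w y y - dGam x y y w + Gam x w (Gam x y y) - Gam x y (Gam x y w))"
proof -
  have "((\<lambda>w. Gam x w h) has_derivative (\<lambda>d. Gam x h d)) (at y)" for h
    using has_derivative_Gam_y[OF x has_derivative_ident, of h y] by (simp add: Gam_sym[OF x, of _ h])
  from riemann_curv_contract[OF x y _ has_derivative_scaleR_right[OF has_derivative_Gam_x[OF x]]
      has_derivative_Gam_self has_derivative_Gam_x[OF x] this, of "alpha a c" \<nu> w]
  show ?thesis by (simp add: spray_alpha x)
qed

text \<open>A term \<open>P y\<close> is a projective change of the spray: it adds to \<open>R\<^sup>i\<^sub>k\<close> only multiples of \<open>\<delta>\<^sup>i\<^sub>k\<close> and of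
  \<open>y\<^sup>i\<close>, which vanish when contracted with \<open>\<nu>\<close> and \<open>w\<close>. The terms with \<open>T\<close> combine to horizontal
  derivatives of \<open>T\<close> and to covariant derivatives of the vector field \<open>bv\<close>.\<close>

lemma riemann_curv_perturbed_contract:
  fixes P T :: "real^'n \<Rightarrow> real^'n \<Rightarrow> real" and bv :: "real^'n \<Rightarrow> real^'n"
  assumes x: "x \<in> U" and y: "y \<noteq> 0"
    and spr: "\<And>z w i. z \<in> U \<Longrightarrow> w \<noteq> 0 \<Longrightarrow>
        spray G i z w = ((1/2) *\<^sub>R Gam z w w + P z w *\<^sub>R w + T z w *\<^sub>R bv z) $ i"
    and bv: "(bv has_derivative dbv) (at x)"
    and Px: "((\<lambda>z. P z y) has_derivative Px) (at x)"
    and Py: "\<And>z w. z \<in> U \<Longrightarrow> w \<noteq> 0 \<Longrightarrow> (P z has_derivative Py z w) (at w)"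
    and Pxy: "\<And>h. ((\<lambda>z. Py z y h) has_derivative Pxy h) (at x)"
    and Pyy: "\<And>h. ((\<lambda>w. Py x w h) has_derivative Pyy h) (at y)"
    and Tx: "((\<lambda>z. T z y) has_derivative Tx) (at x)"
    and Ty: "\<And>z w. z \<in> U \<Longrightarrow> w \<noteq> 0 \<Longrightarrow> (T z has_derivative Ty z w) (at w)"
    and Txy: "\<And>h. ((\<lambda>z. Ty z y h) has_derivative Txy h) (at x)"
    and Tyy: "\<And>h. ((\<lambda>w. Ty x w h) has_derivative Tyy h) (at y)"
    and hom: "Ty x y y = 2 * T x y" "Tyy w y = Ty x y w"
    and nu: "\<nu> \<bullet> y = 0" "\<nu> \<bullet> w = 0"
  shows "(\<Sum>i\<in>UNIV. \<Sum>k\<in>UNIV. \<nu> $ i * w $ k * riemann_curv G i k x y) =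
     (\<Sum>i\<in>UNIV. \<Sum>k\<in>UNIV. \<nu> $ i * w $ k * riemann_curv (alpha a c) i k x y)
     + (\<nu> \<bullet> bv x) * (2 * Tx w - Txy w y + Tyy w (Gam x y y) + 2 * T x y * Tyy w (bv x)
          - Ty x y (Gam x y w) - Ty x y (bv x) * Ty x y w)
     + 2 * T x y * (\<nu> \<bullet> (dbv w + Gam x w (bv x))) - Ty x y w * (\<nu> \<bullet> (dbv y + Gam x y (bv x)))"
proof -
  let ?S = "\<lambda>z w. (1/2) *\<^sub>R Gam z w w + P z w *\<^sub>R w + T z w *\<^sub>R bv z"
  let ?Sx = "\<lambda>h. (1/2) *\<^sub>R dGam x h y y + Px h *\<^sub>R y + (T x y *\<^sub>R dbv h + Tx h *\<^sub>R bv x)"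
  let ?Sy = "\<lambda>z w h. Gam z w h + (P z w *\<^sub>R h + Py z w h *\<^sub>R w) + Ty z w h *\<^sub>R bv z"
  let ?Sxy = "\<lambda>h d. dGam x d y h + (Px d *\<^sub>R h + Pxy h d *\<^sub>R y) + (Ty x y h *\<^sub>R dbv d + Txy h d *\<^sub>R bv x)"
  let ?Syy = "\<lambda>h d. Gam x h d + (Py x y d *\<^sub>R h + (Py x y h *\<^sub>R d + Pyy h d *\<^sub>R y)) + Tyy h d *\<^sub>R bv x"
  have Sx: "((\<lambda>z. ?S z y) has_derivative ?Sx) (at x)"
    by (intro has_derivative_add has_derivative_scaleR has_derivative_scaleR_left has_derivative_scaleR_right
        has_derivative_Gam_x x Px Tx bv)
  have Sy: "(?S z has_derivative ?Sy z w) (at w)" if "z \<in> U" "w \<noteq> 0" for z w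
    using that by (intro has_derivative_add has_derivative_Gam_self has_derivative_scaleR_left Ty
        has_derivative_scaleR[OF Py has_derivative_ident])
  have Sxy: "((\<lambda>z. ?Sy z y h) has_derivative ?Sxy h) (at x)" for h
    by (intro has_derivative_add has_derivative_scaleR has_derivative_scaleR_left has_derivative_scaleR_right
        has_derivative_Gam_x x Px Pxy Txy bv)
  have G: "((\<lambda>w. Gam x w h) has_derivative (\<lambda>d. Gam x h d)) (at y)" for h
    using has_derivative_Gam_y[OF x has_derivative_ident, of h y] by (simp add: Gam_sym[OF x, of _ h])
  have Syy: "((\<lambda>w. ?Sy x w h) has_derivative ?Syy h) (at y)" for h
    by (intro has_derivative_add G has_derivative_scaleR_left Tyy Py[OF x y]
        has_derivative_scaleR[OF Pyy has_derivative_ident])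
  have linT: "linear (Tyy w)" "linear (Ty x y)" 
    using has_derivative_linear[OF Tyy] has_derivative_linear[OF Ty[OF x y]] by auto
  have linP: "linear (Py x y)" 
    using has_derivative_linear[OF Py[OF x y]] .
  have eq: "(\<Sum>i\<in>UNIV. \<Sum>k\<in>UNIV. \<nu> $ i * w $ k * riemann_curv G i k x y) =
     \<nu> \<bullet> (2 *\<^sub>R ?Sx w - ?Sxy w y + 2 *\<^sub>R ?Syy w (?S x y) - ?Sy x y (?Sy x y w))"
    by (rule riemann_curv_contract[OF x y _ Sx Sy Sxy Syy]) (rule spr)
  show ?thesis
    unfolding eq riemann_curv_alpha_contract[OF x y]
    by (simp only: inner_add_right inner_diff_right inner_scaleR_right nu Gam_linear[OF x]
          linear_add[OF linT(1)] linear_add[OF linT(2)] linear_cmul[OF linT(1)] linear_cmul[OF linT(2)]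
          linear_add[OF linP] linear_cmul[OF linP] hom real_scaleR_def)
       (simp add: Gam_sym[OF x, of w y] algebra_simps)
qed

end

section \<open>The functions \<open>P\<close> and \<open>T\<close>\<close>

lemma has_derivative_pair_comp:
  fixes g :: "real \<Rightarrow> real \<Rightarrow> real"
  assumes "((\<lambda>p. g (fst p) (snd p)) has_derivative (\<lambda>d. gs * fst d + gB * snd d)) (at (\<sigma> z, \<beta> z))"
    "(\<sigma> has_derivative \<sigma>') (at z)" "(\<beta> has_derivative \<beta>') (at z)"
  shows "((\<lambda>z. g (\<sigma> z) (\<beta> z)) has_derivative (\<lambda>h. gs * \<sigma>' h + gB * \<beta>' h)) (at z)"
  using has_derivative_compose[OF has_derivative_Pair[OF assms(2,3)] assms(1)] by simp

lemma differentiable_pair_comp: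
  fixes g :: "real \<Rightarrow> real \<Rightarrow> real"
  assumes "(\<lambda>p. g (fst p) (snd p)) differentiable (at (\<sigma> z, \<beta> z))"
    "\<sigma> differentiable (at z)" "\<beta> differentiable (at z)"
  shows "(\<lambda>z. g (\<sigma> z) (\<beta> z)) differentiable (at z)"
proof -
  from assms(2,3) obtain \<sigma>' \<beta>' where "(\<sigma> has_derivative \<sigma>') (at z)" "(\<beta> has_derivative \<beta>') (at z)"
    unfolding differentiable_def by blast
  moreover obtain g' where "((\<lambda>p. g (fst p) (snd p)) has_derivative g') (at (\<sigma> z, \<beta> z))"
    using assms(1) unfolding differentiable_def by blast
  ultimately show ?thesis
    using has_derivative_compose[OF has_derivative_Pair, of \<sigma> \<sigma>' z UNIV \<beta> \<beta>' "\<lambda>p. g (fst p) (snd p)" g']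
    by (auto intro: differentiableI)
qed

context ab_chart
begin

definition Pdom :: "(real \<times> real) set" where
  "Pdom = {(s, q). s \<in> I \<and> \<phi> s - s * \<phi>1 s > 0 \<and> \<phi> s - s * \<phi>1 s + (q - s\<^sup>2) * \<phi>2 s > 0}"

lemma in_Pdom:
  assumes "CARD('n) \<ge> 3" "x \<in> U" "y \<noteq> 0"
  shows "(sv x y, B x) \<in> Pdom"
  using sv_in_I[OF assms(2,3)] phi_minus_pos[OF assms] regular[OF assms(2) abs_sv_le[OF assms(2,3)]]
  by (simp add: Pdom_def)

text \<open>Both \<open>P = \<tau> \<alpha> gP(s, b\<^sup>2)\<close> and \<open>T = \<tau> \<alpha>\<^sup>2 h(s, b\<^sup>2)\<close> have this form. If \<open>gs\<close> is the partial derivative of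
  \<open>g\<close> in its first argument then \<open>hom_fun_y\<close> is the derivative in the direction of the fibre.\<close>

definition hom_fun where
  "hom_fun m g x y = t x * al x y ^ m * g (sv x y) (B x)"

definition hom_fun_y where
  "hom_fun_y m g gs x y h =
     t x * (al x y ^ m * (real m * g (sv x y) (B x) * (ip x y h / ip x y y) + gs (sv x y) (B x) * sy x y h))"

lemma has_derivative_al_power_y:
  assumes x: "x \<in> U" and y: "y \<noteq> 0"
  shows "((\<lambda>w. al x w ^ m) has_derivative (\<lambda>h. al x y ^ m * (real m * (ip x y h / ip x y y)))) (at y)"
proof (cases m)
  case (Suc k)
  define A where "A = al x y"
  have A: "A > 0" "ip x y y = A * A" using al_pos[OF x y] al_mult[OF x, of y] by (simp_all add: A_def)
  have "((\<lambda>w. al x w ^ Suc k) has_derivative (\<lambda>h. of_nat (Suc k) * (ip x y h / A) * A ^ (Suc k - 1))) (at y)"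
    unfolding A_def by (rule has_derivative_power[OF has_derivative_al_y[OF x y]])
  moreover have "of_nat (Suc k) * (ip x y h / A) * A ^ (Suc k - 1) = A ^ Suc k * (real (Suc k) * (ip x y h / ip x y y))" for h
    unfolding A(2) using A(1) by (simp add: field_simps)
  ultimately show ?thesis unfolding Suc A_def[symmetric] by (simp only:)
qed simp

lemma has_derivative_hom_fun_y:
  assumes x: "x \<in> U" and y: "y \<noteq> 0"
    and g: "((\<lambda>p. g (fst p) (snd p)) has_derivative (\<lambda>d. gs (sv x y) (B x) * fst d + gB * snd d)) (at (sv x y, B x))"
  shows "(hom_fun m g x has_derivative hom_fun_y m g gs x y) (at y)"
proof -
  have "((\<lambda>w. g (sv x w) (B x)) has_derivative (\<lambda>h. gs (sv x y) (B x) * sy x y h + gB * 0)) (at y)"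
    by (rule has_derivative_pair_comp[OF g has_derivative_sv_y[OF x y] has_derivative_const])
  from has_derivative_mult[OF has_derivative_al_power_y[OF x y, of m] this]
  have "((\<lambda>w. t x * (al x w ^ m * g (sv x w) (B x))) has_derivative hom_fun_y m g gs x y) (at y)"
    by (rule has_derivative_eq_rhs[OF has_derivative_mult_right])
       (simp add: hom_fun_y_def[abs_def] algebra_simps)
  then show ?thesis by (simp add: hom_fun_def[abs_def] mult.assoc)
qed

lemma differentiable_hom_fun:
  assumes x: "x \<in> U" and y: "y \<noteq> 0"
    and g: "(\<lambda>p. g (fst p) (snd p)) differentiable (at (sv x y, B x))"
    and gs: "(\<lambda>p. gs (fst p) (snd p)) differentiable (at (sv x y, B x))"
  shows "(\<lambda>z. hom_fun m g z y) differentiable (at x)"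
    "(\<lambda>z. hom_fun_y m g gs z y h) differentiable (at x)"
    "(\<lambda>w. hom_fun_y m g gs x w h) differentiable (at y)"
proof -
  note D = differentiableI
  have ipp: "ip x y y \<noteq> 0" using ip_pos[OF x y] by simp
  note sx = D[OF has_derivative_sv_x[OF x y]] and sy = D[OF has_derivative_sv_y[OF x y]]
  note Bx = D[OF has_derivative_B[OF x]]
  note tx = D[OF has_derivative_t[OF x]]
  note ax = D[OF has_derivative_al_x[OF x y]] and ay = D[OF has_derivative_al_y[OF x y]]
  have al0: "al x y \<noteq> 0" using al_pos[OF x y] by simp
  have ipx: "(\<lambda>z. ip z p q) differentiable (at x)" for p q by (rule D[OF has_derivative_ip[OF x]])
  have ipy: "(\<lambda>w. ip x w w) differentiable (at y)" by (rule D[OF has_derivative_ip_self[OF x]])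
  have ipy': "(\<lambda>w. ip x w h) differentiable (at y)"
    by (rule D[OF ip_has_derivative_vector[OF has_derivative_ident has_derivative_const]])
  have bx: "(\<lambda>z. b c z \<bullet> h) differentiable (at x)" by (rule D[OF has_derivative_beta[OF x]])
  have gx: "(\<lambda>z. g (sv z y) (B z)) differentiable (at x)" "(\<lambda>z. gs (sv z y) (B z)) differentiable (at x)"
    by (rule differentiable_pair_comp[OF g sx Bx], rule differentiable_pair_comp[OF gs sx Bx])
  have gy: "(\<lambda>w. g (sv x w) (B x)) differentiable (at y)" "(\<lambda>w. gs (sv x w) (B x)) differentiable (at y)"
    by (rule differentiable_pair_comp[OF g sy], simp, rule differentiable_pair_comp[OF gs sy], simp)
  have syx: "(\<lambda>z. sy z y h) differentiable (at x)" unfolding sy_def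
    by (intro differentiable_diff differentiable_divide differentiable_mult bx ax sx ipx al0 ipp)
  have syy: "(\<lambda>w. sy x w h) differentiable (at y)" unfolding sy_def
    by (intro differentiable_diff differentiable_divide differentiable_mult differentiable_const ay sy ipy ipy' al0 ipp)
  show "(\<lambda>z. hom_fun m g z y) differentiable (at x)" unfolding hom_fun_def
    by (intro differentiable_mult differentiable_power tx ax gx)
  show "(\<lambda>z. hom_fun_y m g gs z y h) differentiable (at x)" unfolding hom_fun_y_def
    by (intro differentiable_mult differentiable_add differentiable_divide differentiable_const differentiable_power tx ax gx ipx ipp syx)
  show "(\<lambda>w. hom_fun_y m g gs x w h) differentiable (at y)" unfolding hom_fun_y_def
    by (intro differentiable_mult differentiable_add differentiable_divide differentiable_const differentiable_power ay gy ipy ipy' ipp syy)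
qed

definition rho :: "real \<Rightarrow> real" where "rho s = \<phi>2 s / (\<phi> s - s * \<phi>1 s)"

lemma phi_has_derivs:
  assumes "s \<in> I"
  shows "(\<phi> has_real_derivative \<phi>1 s) (at s)" "(\<phi>1 has_real_derivative \<phi>2 s) (at s)"
    "(\<phi>2 has_real_derivative deriv \<phi>2 s) (at s)" "(deriv \<phi>2 has_real_derivative deriv (deriv \<phi>2) s) (at s)"
  using smooth_on_has_real_derivative[OF _ assms] smooth_phi smooth_phi1 smooth_phi2 smooth_phi3 by auto

lemma rho_derivs:
  assumes s: "s \<in> I" "\<phi> s - s * \<phi>1 s > 0"
  shows "(rho has_real_derivative deriv rho s) (at s)"
    "(deriv rho has_real_derivative deriv (deriv rho) s) (at s)"
    "isCont (deriv (deriv rho)) s"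
proof -
  define G where "G s = \<phi> s - s * \<phi>1 s" for s
  define V where "V = I \<inter> {s. G s > 0}"
  have Gd: "(G has_real_derivative - s * \<phi>2 s) (at s)" if "s \<in> I" for s
    unfolding G_def[abs_def]
    by (rule DERIV_cong[OF DERIV_diff[OF phi_has_derivs(1)[OF that] DERIV_mult[OF DERIV_ident phi_has_derivs(2)[OF that]]]]) simp
  have "continuous_on I G"
    by (intro continuous_at_imp_continuous_on ballI DERIV_isCont[OF Gd])
  then have V: "open V" unfolding V_def
    using continuous_open_preimage[OF _ open_I open_greaterThan, of G 0] by (simp add: vimage_def)
  have VD: "s \<in> I" "G s \<noteq> 0" "G s * G s \<noteq> 0" if "s \<in> V" for s using that by (auto simp: V_def)
  define R where "R s = (deriv \<phi>2 s * G s + s * \<phi>2 s * \<phi>2 s) / (G s * G s)" for s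
  define R1 where "R1 s = (((deriv (deriv \<phi>2) s * G s + (- s * \<phi>2 s) * deriv \<phi>2 s) +
        ((1 * \<phi>2 s + deriv \<phi>2 s * s) * \<phi>2 s + deriv \<phi>2 s * (s * \<phi>2 s))) * (G s * G s)
        - (deriv \<phi>2 s * G s + s * \<phi>2 s * \<phi>2 s) * ((- s * \<phi>2 s) * G s + (- s * \<phi>2 s) * G s)) / ((G s * G s) * (G s * G s))" for s
  have d: "(rho has_real_derivative R s) (at s)" if "s \<in> V" for s
    unfolding rho_def[abs_def] G_def[symmetric] R_def
    by (rule DERIV_cong[OF DERIV_divide[OF phi_has_derivs(3)[OF VD(1)[OF that]] Gd[OF VD(1)[OF that]] VD(2)[OF that]]]) simp
  have Rd: "(R has_real_derivative R1 s) (at s)" if "s \<in> V" for s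
    unfolding R_def[abs_def] R1_def
    by (intro DERIV_divide DERIV_add DERIV_mult DERIV_ident phi_has_derivs[OF VD(1)[OF that]] Gd[OF VD(1)[OF that]] VD(3)[OF that])
  have d2: "(deriv rho has_real_derivative R1 s) (at s)" if "s \<in> V" for s
    by (rule has_field_derivative_transform_within_open[OF Rd[OF that] V that]) (simp add: DERIV_imp_deriv[OF d])
  have sV: "s \<in> V" using s by (simp add: V_def G_def)
  show "(rho has_real_derivative deriv rho s) (at s)"
    unfolding DERIV_imp_deriv[OF d[OF sV]] by (rule d[OF sV])
  show "(deriv rho has_real_derivative deriv (deriv rho) s) (at s)"
    unfolding DERIV_imp_deriv[OF d2[OF sV]] by (rule d2[OF sV])
  have "isCont R1 s" unfolding R1_def[abs_def]
    using VD[OF sV] DERIV_isCont[OF Gd] smooth_on_has_real_derivative[OF smooth_phi4 VD(1)[OF sV]]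
      phi_has_derivs[OF VD(1)[OF sV], THEN DERIV_isCont]
    by (intro continuous_intros) (auto dest: DERIV_isCont)
  moreover have "eventually (\<lambda>s. deriv (deriv rho) s = R1 s) (nhds s)"
    using V sV by (auto simp: eventually_nhds intro: DERIV_imp_deriv[OF d2])
  ultimately show "isCont (deriv (deriv rho)) s" by (simp add: isCont_cong)
qed

sublocale riccati k1 k2 k3 rho "deriv rho" "deriv (deriv rho)" .

lemma N_eq:
  assumes "\<phi> s - s * \<phi>1 s > 0"
  shows "N s q = (\<phi> s - s * \<phi>1 s + (q - s\<^sup>2) * \<phi>2 s) / (\<phi> s - s * \<phi>1 s)"
  using assms by (simp add: N_def rho_def field_simps)

lemma N_pos: "(s, q) \<in> Pdom \<Longrightarrow> N s q > 0"
  by (auto simp: Pdom_def N_eq)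

definition gP where
  "gP s q = (1 + k1 * q + (k2 * q + k3) * s\<^sup>2) * (\<phi> s * \<phi>1 s - s * (\<phi> s * \<phi>2 s + (\<phi>1 s)\<^sup>2))
     / (2 * \<phi> s * (\<phi> s - s * \<phi>1 s + (q - s\<^sup>2) * \<phi>2 s))"

lemma pair2_gP: "pair2 Pdom gP"
proof -
  have I: "s \<in> I" if "(s, q) \<in> Pdom" for s q using that by (simp add: Pdom_def)
  have p: "pair2 Pdom (\<lambda>s q. \<phi> s)" "pair2 Pdom (\<lambda>s q. \<phi>1 s)" "pair2 Pdom (\<lambda>s q. \<phi>2 s)"
    by (rule pair2_fst[OF phi_has_derivs(1) phi_has_derivs(2)], (erule I)+,
        rule pair2_fst[OF phi_has_derivs(2) phi_has_derivs(3)], (erule I)+,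
        rule pair2_fst[OF phi_has_derivs(3) phi_has_derivs(4)], (erule I)+)
  have s: "pair2 Pdom (\<lambda>s q. s)"
    by (rule pair2_fst[where g' = "\<lambda>_. 1" and g'' = "\<lambda>_. 0"]) (auto intro!: derivative_eq_intros)
  have nz: "2 * \<phi> s * (\<phi> s - s * \<phi>1 s + (q - s * s) * \<phi>2 s) \<noteq> 0" if "(s, q) \<in> Pdom" for s q
    using that phi_pos[OF I[OF that]] by (auto simp: Pdom_def power2_eq_square)
  show ?thesis unfolding gP_def[abs_def] power2_eq_square
    by (intro pair2_divide pair2_mult pair2_add pair2_diff pair2_const pair2_snd s p nz)
qed

lemma r00_eq: "x \<in> U \<Longrightarrow> y \<noteq> 0 \<Longrightarrow> r00 x y = t x * al x y ^ 2 * (u x + v x * (sv x y)\<^sup>2)"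
  using al_mult[of x y] al_pos[of x y] by (simp add: r00_def sv_def field_simps power2_eq_square)

lemma Pf_eq: "x \<in> U \<Longrightarrow> y \<noteq> 0 \<Longrightarrow> Pf x y = hom_fun 1 gP x y"
  using al_pos[of x y] unfolding Pf_def r00_eq hom_fun_def gP_def Theta_def
  by (simp add: power2_eq_square[of "al x y"] del: real_sqrt_gt_0_iff real_sqrt_mult_self) 

lemma Tf_eq:
  assumes "CARD('n) \<ge> 3" "x \<in> U" "y \<noteq> 0"
  shows "Tf x y = hom_fun 2 h x y"
proof -
  define s g M where "s = sv x y" and "g = \<phi> s - s * \<phi>1 s" and "M = g + (B x - s\<^sup>2) * \<phi>2 s"
  have P: "(s, B x) \<in> Pdom" using in_Pdom[OF assms] by (simp add: s_def)
  then have g: "g > 0" and M: "M > 0" by (auto simp: Pdom_def g_def M_def)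
  have N: "N s (B x) = M / g" using g by (simp add: N_eq g_def M_def)
  have "h s (B x) = (u x + v x * s\<^sup>2) * rho s / (2 * N s (B x))"
    using N_pos[OF P] by (simp add: h_eq)
  also have "\<dots> = (u x + v x * s\<^sup>2) * (\<phi>2 s / (2 * M))"
    using g M unfolding N by (simp add: rho_def g_def[symmetric])
  finally show ?thesis
    using assms by (simp add: Tf_def r00_eq hom_fun_def Psi_def s_def[symmetric] M_def g_def)
qed

lemma contract_scalar_curvature:
  assumes sc: "\<And>i k. riemann_curv F i k x y = K * (F x y)\<^sup>2 * (kron i k - y $ i / F x y * dy k F x y)"
    and nu: "\<nu> \<bullet> y = 0" "\<nu> \<bullet> w = 0"
  shows "(\<Sum>i\<in>UNIV. \<Sum>k\<in>UNIV. \<nu> $ i * w $ k * riemann_curv F i k x y) = 0"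
proof -
  have "(\<Sum>i\<in>UNIV. \<Sum>k\<in>UNIV. \<nu> $ i * w $ k * riemann_curv F i k x y) =
     (\<Sum>i\<in>UNIV. \<Sum>k\<in>UNIV. K * (F x y)\<^sup>2 * (\<nu> $ i * (w $ k * kron i k)))
      - (\<Sum>i\<in>UNIV. \<Sum>k\<in>UNIV. (\<nu> $ i * y $ i) * (K * (F x y)\<^sup>2 / F x y * dy k F x y * w $ k))"
    unfolding sc sum_subtractf[symmetric] by (intro sum.cong refl) (simp add: algebra_simps)
  also have "(\<Sum>i\<in>UNIV. \<Sum>k\<in>UNIV. K * (F x y)\<^sup>2 * (\<nu> $ i * (w $ k * kron i k))) = K * (F x y)\<^sup>2 * (\<nu> \<bullet> w)"
    by (simp add: kron_def inner_vec_def sum_distrib_left if_distrib cong: if_cong)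
  also have "(\<Sum>i\<in>UNIV. \<Sum>k\<in>UNIV. (\<nu> $ i * y $ i) * (K * (F x y)\<^sup>2 / F x y * dy k F x y * w $ k)) =
     (\<nu> \<bullet> y) * (\<Sum>k\<in>UNIV. K * (F x y)\<^sup>2 / F x y * dy k F x y * w $ k)"
    by (simp add: inner_vec_def sum_product)
  finally show ?thesis by (simp add: nu)
qed

text \<open>Of the given curvature of \<open>\<alpha>\<close> only two terms with the factor \<open>b\<^sup>i\<close> survive the contraction.\<close>

lemma contract_alpha_curvature:
  assumes cu: "\<And>i k. riemann_curv (alpha a c) i k x y =
        L * ((alpha a c x y)\<^sup>2 * kron i k - y $ i * y_low a c x y k)
        + et * ((beta b c x y)\<^sup>2 * kron i k + (alpha a c x y)\<^sup>2 * b_up a b c x i * b c x $ k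
           - beta b c x y * b_up a b c x i * y_low a c x y k
           - beta b c x y * b c x $ k * y $ i)"
    and nu: "\<nu> \<bullet> y = 0" "\<nu> \<bullet> w = 0"
  shows "(\<Sum>i\<in>UNIV. \<Sum>k\<in>UNIV. \<nu> $ i * w $ k * riemann_curv (alpha a c) i k x y)
     = et * (\<nu> \<bullet> bs x) * ((alpha a c x y)\<^sup>2 * (b c x \<bullet> w) - beta b c x y * ip x w y)"
proof -
  have k: "(\<Sum>i\<in>UNIV. \<Sum>k\<in>UNIV. C * (\<nu> $ i * w $ k * kron i k)) = C * (\<nu> \<bullet> w)" for C
    by (simp add: kron_def inner_vec_def sum_distrib_left if_distrib cong: if_cong)
  have p: "(\<Sum>i\<in>UNIV. \<Sum>k\<in>UNIV. C * ((\<nu> $ i * p $ i) * (w $ k * q $ k))) = C * ((\<nu> \<bullet> p) * (w \<bullet> q))" for p q C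
    unfolding inner_vec_def inner_real_def sum_product by (simp add: sum_distrib_left)
  have "(\<Sum>i\<in>UNIV. \<Sum>k\<in>UNIV. \<nu> $ i * w $ k * riemann_curv (alpha a c) i k x y)
    = (\<Sum>i\<in>UNIV. \<Sum>k\<in>UNIV. (L * (alpha a c x y)\<^sup>2 + et * (beta b c x y)\<^sup>2) * (\<nu> $ i * w $ k * kron i k)
        + - L * ((\<nu> $ i * y $ i) * (w $ k * (a c x *v y) $ k))
        + et * (alpha a c x y)\<^sup>2 * ((\<nu> $ i * bs x $ i) * (w $ k * b c x $ k))
        + - et * beta b c x y * ((\<nu> $ i * bs x $ i) * (w $ k * (a c x *v y) $ k))
        + - et * beta b c x y * ((\<nu> $ i * y $ i) * (w $ k * b c x $ k)))"
    unfolding cu b_up_eq y_low_eq by (intro sum.cong refl) (simp add: algebra_simps)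
  also have "\<dots> = et * (\<nu> \<bullet> bs x) * ((alpha a c x y)\<^sup>2 * (b c x \<bullet> w) - beta b c x y * ip x w y)"
    unfolding sum.distrib k p nu
    by (simp add: ip_def inner_commute[of w "b c x"] algebra_simps)
  finally show ?thesis .
qed

end

section \<open>The curvature equation\<close>

lemma frechet_derivative_eqI: "(f has_derivative f') (at x) \<Longrightarrow> frechet_derivative f (at x) h = f' h"
  by (metis frechet_derivative_at)

context ab_chart
begin

text \<open>Restricting to a unit vector \<open>y\<close> and to directions \<open>w\<close> orthogonal to it removes most terms of the
  second derivatives of \<open>T\<close>.\<close>

lemma T_second_derivs:
  assumes n: "CARD('n) \<ge> 3" and x: "x \<in> U" and y: "y \<noteq> 0" and A: "ip x y y = 1" and w: "ip x y w = 0"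
  defines "s \<equiv> b c x \<bullet> y" and "bw \<equiv> b c x \<bullet> w" and "q \<equiv> q_coeff k1 k3 (B x) (t x) (l x)"
    and "dB \<equiv> 2 * t x * (u x + v x * B x)"
  shows "frechet_derivative (\<lambda>z. hom_fun 2 h z y) (at x) k =
      q * (b c x \<bullet> k) * h s (B x) + t x * dip x k y y * h s (B x)
      + t x * (hs s (B x) * (db x k \<bullet> y - s * dip x k y y / 2) + fB s (B x) * (dB * (b c x \<bullet> k)))" (is ?th1)
    "frechet_derivative (\<lambda>z. hom_fun_y 2 h hs z y w) (at x) k =
      q * (b c x \<bullet> k) * (hs s (B x) * bw) + t x * dip x k y y * (hs s (B x) * bw)
      + t x * (2 * h s (B x) * dip x k y w
         + ((k2 + fss s (B x)) * (db x k \<bullet> y - s * dip x k y y / 2) + fsB s (B x) * (dB * (b c x \<bullet> k))) * bw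
         + hs s (B x) * (db x k \<bullet> w - bw * dip x k y y / 2 - s * dip x k y w))" (is ?th2)
    "frechet_derivative (\<lambda>z. hom_fun_y 2 h hs x z w) (at y) k =
      t x * (2 * ip x y k * (hs s (B x) * bw) + 2 * h s (B x) * ip x k w
         + (k2 + fss s (B x)) * (b c x \<bullet> k - s * ip x y k) * bw
         + hs s (B x) * (- bw * ip x y k - s * ip x k w))" (is ?th3)
    "hom_fun_y 2 h hs x y k = t x * (2 * h s (B x) * ip x y k + hs s (B x) * (b c x \<bullet> k - s * ip x y k))" (is ?th4)
proof -
  have al: "al x y = 1" using A by simp
  have sv: "sv x y = s" by (simp add: sv_def al s_def)
  have sy: "sy x y k = b c x \<bullet> k - s * ip x y k" for k by (simp add: sy_def A sv)
  have sx: "sx x y k = db x k \<bullet> y - s * dip x k y y / 2" for k by (simp add: sx_def A sv)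
  have P: "(s, B x) \<in> Pdom" using in_Pdom[OF n x y] by (simp add: sv)
  have r: "(rho has_real_derivative deriv rho s) (at s)" "(deriv rho has_real_derivative deriv (deriv rho) s) (at s)"
    using rho_derivs(1,2)[of s] P by (auto simp: Pdom_def)
  have N: "N s (B x) \<noteq> 0" using N_pos[OF P] by simp
  note hd = h_derivs[OF r N]
  have Bd: "(B has_derivative (\<lambda>k. dB * (b c x \<bullet> k))) (at x)"
    unfolding dB_def by (rule has_derivative_B[OF x])
  have td: "(t has_derivative (\<lambda>k. q * (b c x \<bullet> k))) (at x)"
    unfolding q_def by (rule has_derivative_t[OF x])
  have al2: "((\<lambda>z. (al z y)\<^sup>2) has_derivative (\<lambda>k. dip x k y y)) (at x)"
    by (rule has_derivative_transform_within_open[OF has_derivative_ip[OF x] open_U x])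
       (simp add: ip_nonneg)
  have hx: "((\<lambda>z. h (sv z y) (B z)) has_derivative (\<lambda>k. hs s (B x) * sx x y k + fB s (B x) * (dB * (b c x \<bullet> k)))) (at x)"
    by (rule has_derivative_pair_comp[OF _ has_derivative_sv_x[OF x y] Bd]) (simp add: sv hd)
  have hsx: "((\<lambda>z. hs (sv z y) (B z)) has_derivative (\<lambda>k. (k2 + fss s (B x)) * sx x y k + fsB s (B x) * (dB * (b c x \<bullet> k)))) (at x)"
    by (rule has_derivative_pair_comp[OF _ has_derivative_sv_x[OF x y] Bd]) (simp add: sv hd)
  have hy: "((\<lambda>z. h (sv x z) (B x)) has_derivative (\<lambda>k. hs s (B x) * sy x y k + fB s (B x) * 0)) (at y)"
    by (rule has_derivative_pair_comp[OF _ has_derivative_sv_y[OF x y] has_derivative_const]) (simp add: sv hd)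
  have hsy: "((\<lambda>z. hs (sv x z) (B x)) has_derivative (\<lambda>k. (k2 + fss s (B x)) * sy x y k + fsB s (B x) * 0)) (at y)"
    by (rule has_derivative_pair_comp[OF _ has_derivative_sv_y[OF x y] has_derivative_const]) (simp add: sv hd)
  have t1: "((\<lambda>z. hom_fun 2 h z y) has_derivative (\<lambda>k. q * (b c x \<bullet> k) * h s (B x) + t x * dip x k y y * h s (B x)
      + t x * (hs s (B x) * sx x y k + fB s (B x) * (dB * (b c x \<bullet> k))))) (at x)"
    unfolding hom_fun_def
    by (rule has_derivative_eq_rhs[OF has_derivative_mult[OF has_derivative_mult[OF td al2] hx]])
       (auto simp: fun_eq_iff sv A algebra_simps)
  show ?th1 unfolding frechet_derivative_eqI[OF t1] sx by simp
  show ?th4 unfolding hom_fun_y_def by (simp add: sv sy A)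
  have Xx: "((\<lambda>z. ip z y w / ip z y y) has_derivative (\<lambda>k. dip x k y w)) (at x)"
    by (rule has_derivative_eq_rhs[OF has_derivative_divide[OF has_derivative_ip[OF x] has_derivative_ip[OF x]]])
       (auto simp: A w)
  have bx: "((\<lambda>z. (b c z \<bullet> w) / al z y) has_derivative (\<lambda>k. db x k \<bullet> w - bw * dip x k y y / 2)) (at x)"
    by (rule has_derivative_eq_rhs[OF has_derivative_divide[OF has_derivative_beta[OF x] has_derivative_al_x[OF x y]]])
       (auto simp: A bw_def)
  have syx: "((\<lambda>z. sy z y w) has_derivative (\<lambda>k. db x k \<bullet> w - bw * dip x k y y / 2 - s * dip x k y w)) (at x)"
    unfolding sy_def times_divide_eq_right[symmetric]
    by (rule has_derivative_eq_rhs[OF has_derivative_diff[OF bx has_derivative_mult[OF has_derivative_sv_x[OF x y] Xx]]])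
       (auto simp: w sv)
  have syw: "sy x y w = bw" by (simp add: sy w bw_def)
  have t2: "((\<lambda>z. hom_fun_y 2 h hs z y w) has_derivative (\<lambda>k. q * (b c x \<bullet> k) * (hs s (B x) * bw) + t x * dip x k y y * (hs s (B x) * bw)
      + t x * (2 * h s (B x) * dip x k y w
         + ((k2 + fss s (B x)) * sx x y k + fsB s (B x) * (dB * (b c x \<bullet> k))) * bw
         + hs s (B x) * (db x k \<bullet> w - bw * dip x k y y / 2 - s * dip x k y w)))) (at x)"
    unfolding hom_fun_y_def
    by (rule has_derivative_eq_rhs[OF has_derivative_mult[OF td has_derivative_mult[OF al2 has_derivative_add[OF 
           has_derivative_mult[OF has_derivative_mult[OF has_derivative_const hx] Xx] has_derivative_mult[OF hsx syx]]]]])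
       (auto simp: fun_eq_iff sv A w syw algebra_simps)
  show ?th2 unfolding frechet_derivative_eqI[OF t2] sx by simp
  have al2y: "((\<lambda>z. (al x z)\<^sup>2) has_derivative (\<lambda>k. 2 * ip x y k)) (at y)"
    by (rule has_derivative_transform_within_open[OF has_derivative_ip_self[OF x] open_UNIV])
       (simp_all add: ip_nonneg x)
  have ipw: "((\<lambda>z. ip x z w) has_derivative (\<lambda>k. ip x k w)) (at y)"
    by (auto intro!: derivative_eq_intros)
  have Xy: "((\<lambda>z. ip x z w / ip x z z) has_derivative (\<lambda>k. ip x k w)) (at y)"
    by (rule has_derivative_eq_rhs[OF has_derivative_divide[OF ipw has_derivative_ip_self[OF x]]])
       (auto simp: A w)
  have by': "((\<lambda>z. (b c x \<bullet> w) / al x z) has_derivative (\<lambda>k. - bw * ip x y k)) (at y)"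
    by (rule has_derivative_eq_rhs[OF has_derivative_divide[OF has_derivative_const has_derivative_al_y[OF x y]]])
       (auto simp: A bw_def)
  have syy: "((\<lambda>z. sy x z w) has_derivative (\<lambda>k. - bw * ip x y k - s * ip x k w)) (at y)"
    unfolding sy_def times_divide_eq_right[symmetric]
    by (rule has_derivative_eq_rhs[OF has_derivative_diff[OF by' has_derivative_mult[OF has_derivative_sv_y[OF x y] Xy]]])
       (auto simp: w sv)
  have t3: "((\<lambda>z. hom_fun_y 2 h hs x z w) has_derivative (\<lambda>k. t x * (2 * ip x y k * (hs s (B x) * bw) + 2 * h s (B x) * ip x k w
         + (k2 + fss s (B x)) * sy x y k * bw
         + hs s (B x) * (- bw * ip x y k - s * ip x k w)))) (at y)"
    unfolding hom_fun_y_def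
    by (rule has_derivative_eq_rhs[OF has_derivative_mult[OF has_derivative_const has_derivative_mult[OF al2y has_derivative_add[OF 
           has_derivative_mult[OF has_derivative_mult[OF has_derivative_const hy] Xy] has_derivative_mult[OF hsy syy]]]]])
       (auto simp: fun_eq_iff sv A w syw algebra_simps)
  show ?th3 unfolding frechet_derivative_eqI[OF t3] sy by simp
qed

text \<open>Let \<open>w\<^sub>0 = b - s y\<close>, and let \<open>e\<close> be orthogonal to \<open>y\<close> and \<open>b\<close> and of the same length as \<open>w\<^sub>0\<close>. Contract
  the curvature of \<open>F\<close> with \<open>w = w\<^sub>0 + e\<close> and with the covector \<open>\<nu>\<close> dual to \<open>w\<^sub>0 - e\<close>. Then \<open>\<nu>\<close> annihilates
  \<open>y\<close> and, by the equality of the lengths, also \<open>w\<close>, while \<open>\<nu>(b) = \<beta>(w) = b\<^sup>2 - s\<^sup>2\<close> does not vanish.\<close>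

lemma equation_at_unit:
  assumes n: "CARD('n) \<ge> 3" and x: "x \<in> U" and y: "y \<noteq> 0" and A: "ip x y y = 1"
    and e: "ip x y e = 0" "b c x \<bullet> e = 0" "ip x e e = B x - (b c x \<bullet> y)\<^sup>2"
    and sc: "\<And>i k. riemann_curv F i k x y = K * (F x y)\<^sup>2 * (kron i k - y $ i / F x y * dy k F x y)"
    and cu: "\<And>i k. riemann_curv (alpha a c) i k x y =
        l x * ((alpha a c x y)\<^sup>2 * kron i k - y $ i * y_low a c x y k)
        + eta_coeff k1 k2 k3 (B x) (t x) (l x) * ((beta b c x y)\<^sup>2 * kron i k + (alpha a c x y)\<^sup>2 * b_up a b c x i * b c x $ k
           - beta b c x y * b_up a b c x i * y_low a c x y k
           - beta b c x y * b c x $ k * y $ i)"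
    and t0: "t x \<noteq> 0" and s2: "(b c x \<bullet> y)\<^sup>2 < B x"
  shows "E (b c x \<bullet> y) (B x) (l x / (t x)\<^sup>2) = 0"
proof -
  define s z q where "s = b c x \<bullet> y" and "z = B x - s\<^sup>2" and "q = q_coeff k1 k3 (B x) (t x) (l x)"
  have zpos: "z > 0" using s2 by (simp add: z_def s_def)
  define w0 where "w0 = bs x - s *\<^sub>R y"
  define w where "w = w0 + e"
  define \<nu> where "\<nu> = a c x *v (w0 - e)"
  have nu: "\<nu> \<bullet> p = ip x (w0 - e) p" for p
    using ip_sym[OF x, of p "w0 - e"] by (simp add: \<nu>_def ip_def inner_commute)
  note S = ip_sym[OF x]
  have w0: "ip x w0 y = 0" "ip x y w0 = 0" "ip x w0 e = 0" "ip x e w0 = 0" "ip x w0 w0 = z" "b c x \<bullet> w0 = z"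
    using e S[of e y] by (simp_all add: w0_def ip_bs[OF x] S[of y "bs x"] A s_def[symmetric] normsq_eq z_def
       inner_diff_right power2_eq_square algebra_simps)
  have ey: "ip x e y = 0" using e S by simp
  have ee: "ip x e e = z" using e by (simp add: z_def s_def)
  have nuy: "\<nu> \<bullet> y = 0" and nuw: "\<nu> \<bullet> w = 0" and nub: "\<nu> \<bullet> bs x = z"
    unfolding nu w_def by (simp_all add: w0 ey ee ip_bs[OF x] inner_diff_right e)
  have wy: "ip x y w = 0" "ip x w y = 0" and bw: "b c x \<bullet> w = z"
    by (simp_all add: w_def w0 e ey inner_add_right)
  have dom: "(sv z w, B z) \<in> Pdom" if "z \<in> U" "w \<noteq> 0" for z w by (rule in_Pdom[OF n that])
  obtain gs gB where gP: "\<And>s q. (s, q) \<in> Pdom \<Longrightarrow>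
     ((\<lambda>p. gP (fst p) (snd p)) has_derivative (\<lambda>d. gs s q * fst d + gB s q * snd d)) (at (s, q))"
    "\<And>s q. (s, q) \<in> Pdom \<Longrightarrow> (\<lambda>p. gs (fst p) (snd p)) differentiable (at (s, q))"
    by (rule pair2E[OF pair2_gP]) (rule that)
  have hd: "((\<lambda>p. h (fst p) (snd p)) has_derivative (\<lambda>d. hs s q * fst d + fB s q * snd d)) (at (s, q))"
    "((\<lambda>p. hs (fst p) (snd p)) has_derivative (\<lambda>d. (k2 + fss s q) * fst d + fsB s q * snd d)) (at (s, q))"
    if "(s, q) \<in> Pdom" for s q
  proof -
    have "s \<in> I" "\<phi> s - s * \<phi>1 s > 0" using that by (auto simp: Pdom_def)
    note r = rho_derivs(1,2)[OF this]
    show "((\<lambda>p. h (fst p) (snd p)) has_derivative (\<lambda>d. hs s q * fst d + fB s q * snd d)) (at (s, q))"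
      "((\<lambda>p. hs (fst p) (snd p)) has_derivative (\<lambda>d. (k2 + fss s q) * fst d + fsB s q * snd d)) (at (s, q))"
      using h_derivs[OF r] N_pos[OF that] by auto
  qed
  note fw = frechet_derivative_works[THEN iffD1]
  note dg = dom[OF x y]
  note Pd = differentiable_hom_fun[OF x y differentiableI[OF gP(1)[OF dg]] gP(2)[OF dg]]
  note Td = differentiable_hom_fun[OF x y differentiableI[OF hd(1)[OF dg]] differentiableI[OF hd(2)[OF dg]]]
  note D = T_second_derivs[OF n x y A wy(1)]
  have spr: "spray F i z w = ((1/2) *\<^sub>R Gam z w w + hom_fun 1 gP z w *\<^sub>R w + hom_fun 2 h z w *\<^sub>R bs z) $ i"
    if "z \<in> U" "w \<noteq> 0" for z w i
    using that by (simp add: spray_F spr_def Pf_eq Tf_eq n)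
  have Ty: "hom_fun_y 2 h hs x y k = t x * (2 * h s (B x) * ip x y k + hs s (B x) * (b c x \<bullet> k - s * ip x y k))" for k
    using D(4) by (simp add: s_def)
  have T0: "hom_fun 2 h x y = t x * h s (B x)" by (simp add: hom_fun_def A sv_def s_def)
  have Pyd: "(hom_fun 1 gP z has_derivative hom_fun_y 1 gP gs z w) (at w)" if "z \<in> U" "w \<noteq> 0" for z w
    by (rule has_derivative_hom_fun_y[OF that]) (rule gP(1)[OF dom[OF that]])
  have Tyd: "(hom_fun 2 h z has_derivative hom_fun_y 2 h hs z w) (at w)" if "z \<in> U" "w \<noteq> 0" for z w
    by (rule has_derivative_hom_fun_y[OF that]) (rule hd(1)[OF dom[OF that]])
  have "0 = (\<Sum>i\<in>UNIV. \<Sum>k\<in>UNIV. \<nu> $ i * w $ k * riemann_curv F i k x y)"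
    by (rule contract_scalar_curvature[OF sc nuy nuw, symmetric])
  also have "\<dots> = (\<Sum>i\<in>UNIV. \<Sum>k\<in>UNIV. \<nu> $ i * w $ k * riemann_curv (alpha a c) i k x y)
     + (\<nu> \<bullet> bs x) * (2 * frechet_derivative (\<lambda>z. hom_fun 2 h z y) (at x) w
         - frechet_derivative (\<lambda>z. hom_fun_y 2 h hs z y w) (at x) y
         + frechet_derivative (\<lambda>z. hom_fun_y 2 h hs x z w) (at y) (Gam x y y)
         + 2 * hom_fun 2 h x y * frechet_derivative (\<lambda>z. hom_fun_y 2 h hs x z w) (at y) (bs x)
          - hom_fun_y 2 h hs x y (Gam x y w) - hom_fun_y 2 h hs x y (bs x) * hom_fun_y 2 h hs x y w)
     + 2 * hom_fun 2 h x y * (\<nu> \<bullet> (dbs x w + Gam x w (bs x))) - hom_fun_y 2 h hs x y w * (\<nu> \<bullet> (dbs x y + Gam x y (bs x)))"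
  proof (rule riemann_curv_perturbed_contract[where P = "hom_fun 1 gP" and Py = "hom_fun_y 1 gP gs", OF x y spr
        has_derivative_bs[OF x] fw[OF Pd(1)] Pyd fw[OF Pd(2)] fw[OF Pd(3)]
        fw[OF Td(1)] Tyd fw[OF Td(2)] fw[OF Td(3)] _ _ nuy nuw])
    show "hom_fun_y 2 h hs x y y = 2 * hom_fun 2 h x y"
      by (simp add: Ty T0 A s_def)
    show "frechet_derivative (\<lambda>wa. hom_fun_y 2 h hs x wa w) (at y) y = hom_fun_y 2 h hs x y w"
      unfolding D(3) Ty by (simp add: A wy s_def)
  qed
  also have "\<dots> = z\<^sup>2 * (t x)\<^sup>2 * E s (B x) (l x / (t x)\<^sup>2)"
  proof -
    \<comment> \<open>The contributions of the Christoffel symbols, which cancel in the end.\<close>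
    define \<gamma> \<gamma>0 \<gamma>1 \<beta>0 \<beta>1 where "\<gamma> = ip x y (Gam x y w)" and "\<gamma>0 = ip x y (Gam x y y)" and "\<gamma>1 = ip x w (Gam x y y)"
      and "\<beta>0 = b c x \<bullet> Gam x y y" and "\<beta>1 = b c x \<bullet> Gam x y w"
    have dip: "dip x w y y = 2 * \<gamma>" "dip x y y y = 2 * \<gamma>0" "dip x y y w = \<gamma>1 + \<gamma>"
      using S[of y] S[of w] Gam_sym[OF x, of w y]
      by (simp_all add: metric_compatible[OF x] \<gamma>_def \<gamma>0_def \<gamma>1_def)
    have db: "db x w \<bullet> y = \<beta>1 + t x * v x * s * z" "db x y \<bullet> w = \<beta>1 + t x * v x * s * z"
      "db x y \<bullet> y = \<beta>0 + t x * (u x + v x * s\<^sup>2)"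
      using cov_b[OF x, of w y] cov_b[OF x, of y w] cov_b[OF x, of y y] Gam_sym[OF x, of w y]
      by (simp_all add: \<beta>0_def \<beta>1_def wy bw A s_def[symmetric] power2_eq_square mult_ac)
    have nb: "\<nu> \<bullet> (dbs x w + Gam x w (bs x)) = t x * v x * z * z" "\<nu> \<bullet> (dbs x y + Gam x y (bs x)) = t x * v x * s * z"
      by (simp_all add: cov_bs[OF x] inner_add_right nuy nuw nub bw s_def[symmetric] mult_ac)
    have sym: "ip x (Gam x y y) w = \<gamma>1" "ip x (bs x) w = z" "ip x y (bs x) = s" "b c x \<bullet> bs x = B x"
      using S[of w] by (simp_all add: \<gamma>1_def ip_bs[OF x] bw s_def[symmetric] normsq_eq)
    have al1: "(alpha a c x y)\<^sup>2 = 1" by (simp add: alpha_eq A)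
    define X where "X = B x"
    have zX: "X - s\<^sup>2 = z" by (simp add: X_def z_def)
    have X: "X = z + s * s" by (simp add: X_def z_def power2_eq_square)
    define \<mu> where "\<mu> = l x / (t x)\<^sup>2"
    have l: "l x = \<mu> * (t x)\<^sup>2" using t0 by (simp add: \<mu>_def)
    have q': "q_coeff k1 k3 (B x) (t x) (l x) = (k3 - 2 * k1 - k1\<^sup>2 * X - \<mu>) * (t x)\<^sup>2"
      by (simp add: q_coeff_def X_def l algebra_simps)
    have eta: "eta_coeff k1 k2 k3 (B x) (t x) (l x) = (k1\<^sup>2 + k2 - 2 * k1 * k3 - k1 * (k2 - k1\<^sup>2) * X + k1 * \<mu>) * (t x)\<^sup>2"
      by (simp add: eta_coeff_def X_def l algebra_simps)
    define H H1 H2 H3 H4 where H_def: "H = h s X" "H1 = hs s X" "H2 = fss s X" "H3 = fB s X" "H4 = fsB s X"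
    show ?thesis
      unfolding contract_alpha_curvature[OF cu nuy nuw] D Ty T0 nub nb wy bw dip db sym al1
        s_def[symmetric] \<beta>0_def[symmetric] \<beta>1_def[symmetric] \<gamma>0_def[symmetric] \<gamma>1_def[symmetric] \<gamma>_def[symmetric]
        q' eta \<mu>_def[symmetric]
      unfolding X_def[symmetric] E_eq zX H_def[symmetric]
      unfolding X by (simp add: algebra_simps power2_eq_square)
  qed
  finally show ?thesis using zpos t0 by (simp add: s_def)
qed

end

section \<open>Elimination of \<open>\<mu>\<close>\<close>

lemma poly_eqI_infinite:
  fixes p q :: "real poly"
  assumes "infinite S" "\<And>x. x \<in> S \<Longrightarrow> poly p x = poly q x"
  shows "p = q"
proof (rule ccontr)
  assume "p \<noteq> q"
  then have "finite {x. poly (p - q) x = 0}" using poly_roots_finite[of "p - q"] by simp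
  moreover have "S \<subseteq> {x. poly (p - q) x = 0}" using assms(2) by auto
  ultimately show False using assms(1) finite_subset by blast
qed

context riccati
begin

text \<open>\<open>W = 0\<close> is the differential equation of \<open>\<rho> = k/(1 + k s\<^sup>2)\<close>. Multiplied by \<open>4 N\<^sup>4\<close>, the expression
  \<open>E s q \<mu>\<close> becomes the polynomial \<open>RP s - 2 \<mu> N\<^sup>2 AP s\<close> in \<open>q\<close>.\<close>

definition W where "W s = r1 s + 2 * s * (r s)\<^sup>2"

definition NP where "NP s = [:1 - s\<^sup>2 * r s, r s:]"
definition NsP where "NsP s = [:- 2 * s * r s - s\<^sup>2 * r1 s, r1 s:]"
definition NssP where "NssP s = [:- 2 * r s - 4 * s * r1 s - s\<^sup>2 * r2 s, r2 s:]"
definition AP where "AP s = smult (2 * sig s - s * sig1 s) (NP s) + smult (s * sig s) (NsP s)"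

definition RP where
  "RP s = 8 * [:1, k1 + k3, k2:] * (smult (- sig s * r s) (NP s ^ 2)
        + smult (s / 2) (NP s * (smult (sig1 s * r s + sig s * r1 s) (NP s) - smult (2 * sig s * r s) (NsP s))))
     + 2 * ([:k3 - 2 * k1, - (k1\<^sup>2):] + [:k1 + k3, 2 * k2:]) * NP s ^ 2 * AP s
     + smult (4 * k1 * sig s) (NP s ^ 3)
     + smult (2 * s * (k3 + k2 * s\<^sup>2)) ((smult (sig1 s) (NP s) - smult (sig s) (NsP s)) * NP s ^ 2)
     - smult (D (s\<^sup>2)) (smult (2 * sig2 s) (NP s ^ 3) - smult (4 * sig1 s) (NsP s * NP s ^ 2)
          - smult (2 * sig s) (NssP s * NP s ^ 2) + smult (4 * sig s) (NsP s ^ 2 * NP s))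
     + smult (4 * (sig s)\<^sup>2) (NP s ^ 2)
     - smult (2 * s * sig s) ((smult (sig1 s) (NP s) - smult (sig s) (NsP s)) * NP s)
     + [:- (s\<^sup>2), 1:] * (smult (2 * sig s * sig2 s) (NP s ^ 2) - smult (4 * sig s * sig1 s) (NsP s * NP s)
         - smult (2 * (sig s)\<^sup>2) (NssP s * NP s) + smult (4 * (sig s)\<^sup>2) (NsP s ^ 2)
         - (smult (sig1 s) (NP s) - smult (sig s) (NsP s)) ^ 2)"

lemma poly_NP: "poly (NP s) q = N s q" and poly_NsP: "poly (NsP s) q = Ns s q"
  and poly_NssP: "poly (NssP s) q = Nss s q"
  by (simp_all add: NP_def NsP_def NssP_def N_def Ns_def Nss_def algebra_simps)

lemma poly_AP: "poly (AP s) q = (2 * sig s - s * sig1 s) * N s q + s * sig s * Ns s q"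
  by (simp add: AP_def poly_NP poly_NsP)

lemma E_mu: "E s q \<mu> = E s q 0 - \<mu> * (2 * f s q - s * fs s q)"
  by (simp add: E_def algebra_simps)

lemma poly_AP_eq:
  assumes "N s q \<noteq> 0"
  shows "2 * (N s q)\<^sup>2 * (2 * f s q - s * fs s q) = poly (AP s) q"
  using assms by (simp add: poly_AP f_def fs_def field_simps power2_eq_square)

lemma poly_RP_eq:
  assumes "N s q \<noteq> 0"
  shows "poly (RP s) q = 4 * (N s q)^4 * E s q 0"
proof -
  define n ns nss where "n = N s q" and "ns = Ns s q" and "nss = Nss s q"
  define F F1 F2 FB F1B where "F = f s q" and "F1 = fs s q" and "F2 = fss s q" and "FB = fB s q" and "F1B = fsB s q"
  have n: "n \<noteq> 0" using assms by (simp add: n_def)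
  have e: "2 * n * F = sig s" "2 * n^2 * F1 = sig1 s * n - sig s * ns"
    "2 * n^3 * F2 = sig2 s * n^2 - 2 * sig1 s * ns * n - sig s * nss * n + 2 * sig s * ns^2"
    "2 * n^2 * FB = - sig s * r s"
    "2 * n^3 * F1B = - sig1 s * r s * n - sig s * r1 s * n + 2 * sig s * r s * ns"
    using n unfolding F_def F1_def F2_def FB_def F1B_def f_def fs_def fss_def fB_def fsB_def n_def[symmetric] ns_def[symmetric] nss_def[symmetric]
    by (simp_all add: field_simps power2_eq_square power3_eq_cube)
  have A: "poly (AP s) q = 2 * n^2 * (2 * F - s * F1)"
    using poly_AP_eq[OF assms] by (simp add: F_def F1_def n_def)
  have "poly (RP s) q = 8 * D q * ((- sig s * r s) * n^2 - s * n / 2 * (- sig1 s * r s * n - sig s * r1 s * n + 2 * sig s * r s * ns))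
     + 2 * (k3 - 2 * k1 - k1\<^sup>2 * q + D' q) * n^2 * poly (AP s) q
     + 4 * k1 * sig s * n^3 + 2 * s * (k3 + k2 * s\<^sup>2) * (sig1 s * n - sig s * ns) * n^2
     - 2 * D (s\<^sup>2) * n * (sig2 s * n^2 - 2 * sig1 s * ns * n - sig s * nss * n + 2 * sig s * ns^2)
     + 4 * (sig s)^2 * n^2 - 2 * s * sig s * (sig1 s * n - sig s * ns) * n
     + (q - s\<^sup>2) * (2 * sig s * (sig2 s * n^2 - 2 * sig1 s * ns * n - sig s * nss * n + 2 * sig s * ns^2) - (sig1 s * n - sig s * ns)^2)"
    unfolding RP_def
    by (simp add: poly_NP poly_NsP poly_NssP n_def[symmetric] ns_def[symmetric] nss_def[symmetric])
       (simp add: D_def D'_def algebra_simps add_divide_distrib diff_divide_distrib power2_eq_square power3_eq_cube)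
  also have "\<dots> = 4 * n^4 * (2 * D q * (2 * FB - s * F1B)
     + (k3 - 2 * k1 - k1\<^sup>2 * q - 0 + D' q) * (2 * F - s * F1)
     + 2 * k1 * F + s * (k3 + k2 * s\<^sup>2) * F1 - D (s\<^sup>2) * F2
     + 4 * F\<^sup>2 - 2 * s * F * F1 + (q - s\<^sup>2) * (2 * F * F2 - F1\<^sup>2))"
    unfolding A unfolding e(3)[symmetric] unfolding e(5)[symmetric] unfolding e(2)[symmetric] unfolding e(4)[symmetric]
    unfolding e(1)[symmetric] by (simp add: algebra_simps power2_eq_square power3_eq_cube power4_eq_xxxx)
  also have "\<dots> = 4 * (N s q)^4 * E s q 0"
    unfolding E_def F_def F1_def F2_def FB_def F1B_def n_def ..
  finally show ?thesis .
qed

lemma poly_RP_root: "N s q = 0 \<Longrightarrow> poly (RP s) q = 3 * (q - s\<^sup>2) * (sig s)\<^sup>2 * (Ns s q)\<^sup>2"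
  unfolding RP_def
  by (simp add: poly_NP poly_NsP poly_NssP power_mult_distrib) (simp add: algebra_simps power2_eq_square)

lemma AP_eq_0_iff:
  assumes "AP s = 0" shows "sig s * W s = 0"
proof -
  have c: "(2 * sig s - s * sig1 s) * (1 - s\<^sup>2 * r s) + s * sig s * (- 2 * s * r s - s\<^sup>2 * r1 s) = 0"
    "(2 * sig s - s * sig1 s) * r s + s * sig s * r1 s = 0"
    using assms by (simp_all add: AP_def NP_def NsP_def)
  have "s * (sig s * W s) = 
     ((2 * sig s - s * sig1 s) * r s + s * sig s * r1 s) * (1 - s\<^sup>2 * r s)
     - ((2 * sig s - s * sig1 s) * (1 - s\<^sup>2 * r s) + s * sig s * (- 2 * s * r s - s\<^sup>2 * r1 s)) * r s"
    by (simp add: W_def algebra_simps power2_eq_square)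
  also have "\<dots> = 0" unfolding c by simp
  finally have "s = 0 \<or> sig s * W s = 0" by simp
  moreover have "sig s = 0" if "s = 0" using c(1) that by simp
  ultimately show ?thesis by auto
qed

text \<open>The multiplier \<open>\<mu>\<close> is eliminated between two values of \<open>s\<close>. As a function of \<open>q\<close> it has a
  double pole at the zero of \<open>N s\<close>, so this zero cannot depend on \<open>s\<close>.\<close>

lemma pole_coincide:
  assumes Q: "infinite Q" and N: "\<And>q. q \<in> Q \<Longrightarrow> N s q \<noteq> 0" "\<And>q. q \<in> Q \<Longrightarrow> N s' q \<noteq> 0"
    and E: "\<And>q. q \<in> Q \<Longrightarrow> \<exists>\<mu>. E s q \<mu> = 0 \<and> E s' q \<mu> = 0"
    and s: "r s \<noteq> 0" "sig s * W s \<noteq> 0" and s': "sig s' * W s' \<noteq> 0"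
  shows "N s' (s\<^sup>2 - 1 / r s) = 0"
proof (rule ccontr)
  assume N': "N s' (s\<^sup>2 - 1 / r s) \<noteq> 0"
  define q0 where "q0 = s\<^sup>2 - 1 / r s"
  have eq: "poly (RP s * (NP s' ^ 2 * AP s')) q = poly (RP s' * (NP s ^ 2 * AP s)) q" if "q \<in> Q" for q
  proof -
    obtain \<mu> where "E s q \<mu> = 0" "E s' q \<mu> = 0" using E[OF \<open>q \<in> Q\<close>] by blast
    then have e: "E s q 0 = \<mu> * (2 * f s q - s * fs s q)" "E s' q 0 = \<mu> * (2 * f s' q - s' * fs s' q)"
      using E_mu by (metis eq_iff_diff_eq_0)+
    note n = N(1)[OF that] N(2)[OF that]
    have "poly (RP s) q = 2 * \<mu> * (N s q)^2 * poly (AP s) q" "poly (RP s') q = 2 * \<mu> * (N s' q)^2 * poly (AP s') q"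
      unfolding poly_RP_eq[OF n(1)] poly_RP_eq[OF n(2)] poly_AP_eq[OF n(1), symmetric] poly_AP_eq[OF n(2), symmetric] e
      by (simp_all add: power2_eq_square power4_eq_xxxx)
    then show ?thesis by (simp add: poly_NP mult_ac)
  qed
  have id: "RP s * (NP s' ^ 2 * AP s') = RP s' * (NP s ^ 2 * AP s)"
    by (rule poly_eqI_infinite[OF Q eq])
  have N0: "N s q0 = 0" using s(1) by (simp add: N_def q0_def field_simps)
  have Ns0: "Ns s q0 = - W s / r s" using s(1) by (simp add: Ns_def q0_def W_def field_simps power2_eq_square)
  have R0: "poly (RP s) q0 \<noteq> 0"
    unfolding poly_RP_root[OF N0] Ns0 using s by (simp add: q0_def)
  have "poly (RP s) q0 * ((N s' q0)^2 * poly (AP s') q0) = 0"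
    using arg_cong[OF id, of "\<lambda>p. poly p q0"] by (simp add: poly_NP N0)
  then have A0: "poly (AP s') q0 = 0" using R0 N' by (simp add: q0_def)
  \<comment> \<open>The right-hand side of \<open>id\<close> has a double zero at \<open>q0\<close>, and \<open>AP\<close> has degree at most 1.\<close>
  have "poly (RP s) q0 * ((N s' q0)^2 * poly (pderiv (AP s')) q0) = 0"
    using arg_cong[OF id, of "\<lambda>p. poly (pderiv p) q0"]
    by (simp add: pderiv_mult power2_eq_square poly_NP N0 A0)
  then have A1: "poly (pderiv (AP s')) q0 = 0" using R0 N' by (simp add: q0_def)
  obtain c0 c1 where AP: "AP s' = [:c0, c1:]" by (simp add: AP_def NP_def NsP_def)
  have "AP s' = 0" using A0 A1 unfolding AP by (simp add: pderiv_pCons)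
  then show False using AP_eq_0_iff s' by blast
qed

text \<open>If \<open>\<sigma> W \<noteq> 0\<close> then \<open>\<rho> \<noteq> 0\<close> at some nearby point, and near it the zero \<open>s\<^sup>2 - 1/\<rho>\<close> of \<open>N\<close> is
  constant. Its derivative is \<open>W/\<rho>\<^sup>2\<close>.\<close>

lemma sig_W_eq_0:
  assumes Q: "infinite Q" and s0: "s0\<^sup>2 < c" and Qc: "\<And>q. q \<in> Q \<Longrightarrow> c < q"
    and d: "\<And>s. s\<^sup>2 < c \<Longrightarrow> (r has_real_derivative r1 s) (at s)" "\<And>s. s\<^sup>2 < c \<Longrightarrow> (r1 has_real_derivative r2 s) (at s)"
    and N: "\<And>q s. q \<in> Q \<Longrightarrow> s\<^sup>2 < c \<Longrightarrow> N s q \<noteq> 0"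
    and E: "\<And>q. q \<in> Q \<Longrightarrow> \<exists>\<mu>. \<forall>s. s\<^sup>2 < c \<longrightarrow> E s q \<mu> = 0"
  shows "sig s0 * W s0 = 0"
proof (rule ccontr)
  assume nz: "sig s0 * W s0 \<noteq> 0"
  define V where "V = {s. s\<^sup>2 < c} \<inter> {s. sig s * W s \<noteq> 0}"
  have o1: "open {s::real. s\<^sup>2 < c}" by (intro open_Collect_less continuous_intros)
  have cont: "continuous_on {s. s\<^sup>2 < c} (\<lambda>s. sig s * W s)"
  proof (rule continuous_at_imp_continuous_on, rule ballI)
    fix s assume "s \<in> {s. s\<^sup>2 < c}"
    then have "isCont r s" "isCont r1 s" using d DERIV_isCont by blast+
    moreover have "isCont sig s" using sig_derivs(1)[OF d] \<open>s \<in> _\<close> DERIV_isCont by blast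
    ultimately show "isCont (\<lambda>s. sig s * W s) s" unfolding W_def by (intro continuous_intros)
  qed
  have "V = {s. s\<^sup>2 < c} \<inter> (\<lambda>s. sig s * W s) -` (- {0})" by (auto simp: V_def)
  then have V: "open V" using continuous_open_preimage[OF cont o1, of "- {0}"] by auto
  have s0V: "s0 \<in> V" using nz s0 by (simp add: V_def)
  have "\<exists>s1\<in>V. r s1 \<noteq> 0"
  proof (rule ccontr)
    assume "\<not> (\<exists>s1\<in>V. r s1 \<noteq> 0)"
    then have r0: "r s = 0" if "s \<in> V" for s using that by blast
    have "((\<lambda>_. 0) has_real_derivative r1 s0) (at s0)"
      by (rule has_field_derivative_transform_within_open[OF d(1)[OF s0] V s0V]) (simp add: r0)
    then have "r1 s0 = 0" using DERIV_unique DERIV_const by blast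
    then show False using nz r0[OF s0V] by (simp add: W_def)
  qed
  then obtain s1 where s1: "s1 \<in> V" "r s1 \<noteq> 0" by blast
  define q0 where "q0 = s1\<^sup>2 - 1 / r s1"
  have rq: "r s * (q0 - s\<^sup>2) = - 1" if "s \<in> V" for s
  proof -
    have "N s q0 = 0" unfolding q0_def
    proof (rule pole_coincide[OF Q])
      show "\<exists>\<mu>. E s1 q \<mu> = 0 \<and> E s q \<mu> = 0" if "q \<in> Q" for q
        using E[OF that] s1(1) \<open>s \<in> V\<close> by (auto simp: V_def)
    qed (use N s1 that in \<open>auto simp: V_def\<close>)
    then show ?thesis by (simp add: N_def algebra_simps)
  qed
  have q0: "q0 - s1\<^sup>2 \<noteq> 0" using rq[OF s1(1)] by auto
  have s1c: "s1\<^sup>2 < c" using s1 by (simp add: V_def)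
  have "((\<lambda>s. r s * (q0 - s\<^sup>2)) has_real_derivative r1 s1 * (q0 - s1\<^sup>2) + (- 2 * s1) * r s1) (at s1)"
    by (auto intro!: derivative_eq_intros d(1)[OF s1c])
  moreover have "((\<lambda>s. r s * (q0 - s\<^sup>2)) has_real_derivative 0) (at s1)"
    by (rule has_field_derivative_transform_within_open[OF DERIV_const V s1(1)]) (simp add: rq)
  ultimately have "r1 s1 * (q0 - s1\<^sup>2) - 2 * s1 * r s1 = 0" using DERIV_unique by fastforce
  then have "r s1 * (r1 s1 * (q0 - s1\<^sup>2) - 2 * s1 * r s1) = 0" by simp
  moreover have "r s1 * (r1 s1 * (q0 - s1\<^sup>2) - 2 * s1 * r s1) = - W s1"
  proof -
    have "r s1 * (r1 s1 * (q0 - s1\<^sup>2) - 2 * s1 * r s1) = r1 s1 * (r s1 * (q0 - s1\<^sup>2)) - 2 * s1 * (r s1)\<^sup>2"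
      by (simp add: algebra_simps power2_eq_square)
    then show ?thesis unfolding rq[OF s1(1)] W_def by simp
  qed
  ultimately show False using s1(1) by (simp add: V_def)
qed

end

section \<open>The two alternatives cannot be mixed\<close>

lemma gronwall_zero:
  fixes L L' :: "real \<Rightarrow> real"
  assumes ab: "a < b" and c: "continuous_on {a..b} L"
    and d: "\<And>s. a < s \<Longrightarrow> s < b \<Longrightarrow> (L has_real_derivative L' s) (at s)"
    and K: "\<And>s. a < s \<Longrightarrow> s < b \<Longrightarrow> L' s \<ge> - K * L s"
    and b: "L b \<le> 0"
  shows "L a \<le> 0"
proof -
  have "L a * exp (K * a) \<le> L b * exp (K * b)"
  proof (rule DERIV_nonneg_imp_increasing_open[of a b "\<lambda>s. L s * exp (K * s)"])
    show "continuous_on {a..b} (\<lambda>s. L s * exp (K * s))" by (intro continuous_intros c)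
    fix s assume s: "a < s" "s < b"
    have "((\<lambda>s. L s * exp (K * s)) has_real_derivative (L' s + K * L s) * exp (K * s)) (at s)"
      by (auto intro!: derivative_eq_intros d[OF s] simp: algebra_simps)
    moreover have "(L' s + K * L s) * exp (K * s) \<ge> 0" using K[OF s] by simp
    ultimately show "\<exists>y. ((\<lambda>s. L s * exp (K * s)) has_real_derivative y) (at s) \<and> 0 \<le> y" by blast
  qed (use ab in simp)
  also have "\<dots> \<le> 0" using b by (simp add: mult_le_0_iff)
  finally show ?thesis by (simp add: mult_le_0_iff)
qed

context riccati
begin

text \<open>At a zero of \<open>\<sigma>\<close> the right-hand side is \<open>2 s (k1 k3 - k2)\<close>; so where \<open>W = 0\<close>, the zeros of \<open>\<sigma>\<close> other
  than \<open>0\<close> are simple.\<close>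

lemma D_sig1_eq:
  assumes "W s = 0"
  shows "D (s\<^sup>2) * sig1 s = 2 * s * (k1 * k3 - k2) + sig s * (2 * s * D' (s\<^sup>2) - 4 * s * kap s - 2 * s * sig s)"
proof -
  have r1: "r1 s = - 2 * s * r s * r s" using assms by (simp add: W_def power2_eq_square)
  have Dr: "D (s\<^sup>2) * r s = sig s + kap s" by (simp add: sig_def)
  have "D (s\<^sup>2) * sig1 s = 2 * s * D' (s\<^sup>2) * (D (s\<^sup>2) * r s) - 2 * s * (D (s\<^sup>2) * r s) * (D (s\<^sup>2) * r s) - 2 * k2 * s * D (s\<^sup>2)"
    unfolding sig1_def r1 by (simp add: algebra_simps)
  also have "\<dots> = 2 * s * D' (s\<^sup>2) * (sig s + kap s) - 2 * s * (sig s + kap s) * (sig s + kap s) - 2 * k2 * s * D (s\<^sup>2)"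
    unfolding Dr ..
  also have "\<dots> = 2 * s * (k1 * k3 - k2) + sig s * (2 * s * D' (s\<^sup>2) - 4 * s * kap s - 2 * s * sig s)"
    by (simp add: D'_def D_def kap_def algebra_simps power2_eq_square)
  finally show ?thesis .
qed

text \<open>On an interval avoiding \<open>0\<close> the two alternatives \<open>sig = 0\<close> and \<open>W = 0\<close> cannot be mixed:
  \<open>sig\<close> has only simple zeros where \<open>W\<close> vanishes.\<close>

lemma sig_or_W:
  assumes k: "k2 \<noteq> k1 * k3" and S: "open S" "connected S" "0 \<notin> S"
    and d: "\<And>s. s \<in> S \<Longrightarrow> (r has_real_derivative r1 s) (at s)" "\<And>s. s \<in> S \<Longrightarrow> (r1 has_real_derivative r2 s) (at s)"
    and sW: "\<And>s. s \<in> S \<Longrightarrow> sig s * W s = 0"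
  shows "(\<forall>s\<in>S. sig s = 0) \<or> (\<forall>s\<in>S. W s = 0)"
proof -
  have cW: "isCont W s" if "s \<in> S" for s
  proof -
    have "isCont r s" "isCont r1 s" using d that DERIV_isCont by blast+
    then show ?thesis unfolding W_def[abs_def] by (intro continuous_intros)
  qed
  have oW: "open {s \<in> S. W s \<noteq> 0}"
  proof -
    have "{s \<in> S. W s \<noteq> 0} = S \<inter> W -` (- {0})" by auto
    then show ?thesis
      using continuous_open_preimage[OF continuous_at_imp_continuous_on S(1), of W "- {0}"] cW by auto
  qed
  have "open {s \<in> S. W s = 0}"
    unfolding open_contains_ball
  proof
    fix s assume "s \<in> {s \<in> S. W s = 0}"
    then have s: "s \<in> S" "W s = 0" by auto
    obtain e where e: "e > 0" "ball s e \<subseteq> S" using S(1) s(1) open_contains_ball by blast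
    have "eventually (\<lambda>p. sig p \<noteq> 0) (at s)"
    proof (cases "sig s = 0")
      case False
      have "isCont sig s" using sig_derivs(1)[OF d[OF s(1)]] DERIV_isCont by blast
      then have "(sig \<longlongrightarrow> sig s) (at s)" by (simp add: isCont_def)
      then show ?thesis using tendsto_imp_eventually_ne[OF _ False] by blast
    next
      case True
      have "s \<noteq> 0" using s(1) S(3) by auto
      then have "sig1 s \<noteq> 0" using D_sig1_eq[OF s(2)] k True by auto
      have lim: "((\<lambda>p. (sig p - sig s) / (p - s)) \<longlongrightarrow> sig1 s) (at s)"
        using sig_derivs(1)[OF d[OF s(1)]] by (simp add: has_field_derivative_iff)
      have "eventually (\<lambda>p. (sig p - sig s) / (p - s) \<noteq> 0) (at s)"
        using tendsto_imp_eventually_ne[OF lim \<open>sig1 s \<noteq> 0\<close>] .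
      then show ?thesis by eventually_elim (use True in auto)
    qed
    then obtain e' where e': "e' > 0" "\<And>p. p \<noteq> s \<Longrightarrow> dist p s < e' \<Longrightarrow> sig p \<noteq> 0"
      by (auto simp: eventually_at)
    have "ball s (min e e') \<subseteq> {s \<in> S. W s = 0}"
    proof
      fix p assume p: "p \<in> ball s (min e e')"
      then have pS: "p \<in> S" using e by auto
      show "p \<in> {s \<in> S. W s = 0}"
        using sW[OF pS] e'(2)[of p] p s pS by (cases "p = s") (auto simp: dist_commute)
    qed
    then show "\<exists>e>0. ball s e \<subseteq> {s \<in> S. W s = 0}" using e(1) e'(1) by (metis min_less_iff_conj)
  qed
  from connectedD[OF S(2) this oW] have "{s \<in> S. W s = 0} \<inter> S = {} \<or> {s \<in> S. W s \<noteq> 0} \<inter> S = {}"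
    by blast
  then show ?thesis using sW by auto
qed

text \<open>Nor can they be mixed across \<open>0\<close>: the second derivative of \<open>sig\<close> at \<open>0\<close> would vanish, as seen from
  the side on which \<open>sig = 0\<close>, and would equal \<open>2 (k1 k3 - k2)\<close>, as seen from the side on which
  \<open>W = 0\<close>.\<close>

lemma no_mixing_at_0:
  assumes k: "k2 \<noteq> k1 * k3" and S: "open S" "0 \<in> S" and \<sigma>: "\<sigma> = 1 \<or> \<sigma> = (- 1 :: real)"
    and d: "\<And>s. s \<in> S \<Longrightarrow> (r has_real_derivative r1 s) (at s)" "\<And>s. s \<in> S \<Longrightarrow> (r1 has_real_derivative r2 s) (at s)"
    and sig0: "\<And>s. s \<in> S \<Longrightarrow> \<sigma> * s > 0 \<Longrightarrow> sig s = 0"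
    and W0: "\<And>s. s \<in> S \<Longrightarrow> \<sigma> * s < 0 \<Longrightarrow> W s = 0"
  shows False
proof -
  obtain e where e: "e > 0" "ball 0 e \<subseteq> S" by (rule openE[OF S])
  have inS: "s \<in> S" if "\<bar>s\<bar> < e" for s using subsetD[OF e(2), of s] that by simp
  note sd = sig_derivs[OF d]
  have 0: "0 \<in> S" by fact
  \<comment> \<open>\<open>X n\<close> tends to \<open>0\<close> on the side where \<open>sig\<close> vanishes, and \<open>- X n\<close> on the other side.\<close>
  define X where "X n = (\<sigma> * (e / 2)) * inverse (real (Suc n))" for n
  have X0: "X \<longlonglongrightarrow> 0"
  proof -
    have "(\<lambda>n. (\<sigma> * (e / 2)) * inverse (real (Suc n))) \<longlonglongrightarrow> (\<sigma> * (e / 2)) * 0"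
      by (rule tendsto_mult[OF tendsto_const LIMSEQ_inverse_real_of_nat])
    then show ?thesis unfolding X_def[abs_def] by simp
  qed
  have Xp: "\<sigma> * X n > 0" "\<bar>X n\<bar> < e" for n
  proof -
    have "\<sigma> * X n = (e / 2) / real (Suc n)" using \<sigma> by (elim disjE) (simp_all add: X_def field_simps)
    then show "\<sigma> * X n > 0" using e(1) by simp
    have "\<bar>X n\<bar> = (e / 2) / real (Suc n)" using \<sigma> e(1) by (elim disjE) (simp_all add: X_def abs_mult field_simps)
    also have "\<dots> \<le> (e / 2) / 1" using e(1) by (intro divide_left_mono) auto
    finally show "\<bar>X n\<bar> < e" using e(1) by simp
  qed
  have Xnz: "X n \<noteq> 0" for n using Xp(1)[of n] by auto
  have XS: "X n \<in> S" "- X n \<in> S" for n using inS Xp(2) by auto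
  have fX: "filterlim X (at 0) sequentially" using X0 Xnz by (simp add: filterlim_at)
  have fX': "filterlim (\<lambda>n. - X n) (at 0) sequentially" using tendsto_minus[OF X0] Xnz by (simp add: filterlim_at)
  have cs: "isCont sig 0" "isCont sig1 0" using sd[OF 0 0] DERIV_isCont by blast+
  have sX: "sig (X n) = 0" for n using sig0[OF XS(1) Xp(1)] .
  have s0: "sig 0 = 0"
  proof -
    have "(\<lambda>n. sig (X n)) \<longlonglongrightarrow> sig 0" using isCont_tendsto_compose[OF cs(1) X0] .
    then show ?thesis by (simp add: sX LIMSEQ_const_iff)
  qed
  have s1X: "sig1 (X n) = 0" for n
  proof -
    have "open (S \<inter> {s. \<sigma> * s > 0})" by (intro open_Int S open_Collect_less continuous_intros)
    then have "((\<lambda>_. 0) has_real_derivative sig1 (X n)) (at (X n))"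
      by (rule has_field_derivative_transform_within_open[OF sd(1)[OF XS(1) XS(1)]])
         (use XS Xp sig0 in auto)
    then show ?thesis using DERIV_unique DERIV_const by blast
  qed
  have s10: "sig1 0 = 0"
  proof -
    have "(\<lambda>n. sig1 (X n)) \<longlonglongrightarrow> sig1 0" using isCont_tendsto_compose[OF cs(2) X0] .
    then show ?thesis by (simp add: s1X LIMSEQ_const_iff)
  qed
  have l2: "((\<lambda>p. sig1 p / p) \<longlongrightarrow> sig2 0) (at 0)"
    using sd(2)[OF 0 0] by (simp add: has_field_derivative_iff s10)
  have l1: "((\<lambda>p. sig p / p) \<longlongrightarrow> 0) (at 0)"
    using sd(1)[OF 0 0] by (simp add: has_field_derivative_iff s10 s0)
  have "(\<lambda>n. sig1 (X n) / X n) \<longlonglongrightarrow> sig2 0" using filterlim_compose[OF l2 fX] .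
  then have s20: "sig2 0 = 0" by (simp add: s1X LIMSEQ_const_iff)
  have "((\<lambda>p. D (p\<^sup>2) * (sig1 p / p) - (sig p / p) * (2 * p * D' (p\<^sup>2) - 4 * p * kap p - 2 * p * sig p)) \<longlongrightarrow>
     D (0\<^sup>2) * sig2 0 - 0 * (2 * 0 * D' (0\<^sup>2) - 4 * 0 * kap 0 - 2 * 0 * sig 0)) (at 0)"
  proof (intro tendsto_diff tendsto_mult l1 l2)
    have "isCont (\<lambda>p. D (p\<^sup>2)) 0" "isCont (\<lambda>p. D' (p\<^sup>2)) 0" "isCont kap 0"
      unfolding D_def D'_def kap_def[abs_def] by (intro continuous_intros)+
    with cs(1) show "((\<lambda>p. D (p\<^sup>2)) \<longlongrightarrow> D (0\<^sup>2)) (at 0)" "((\<lambda>p. D' (p\<^sup>2)) \<longlongrightarrow> D' (0\<^sup>2)) (at 0)"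
       "(kap \<longlongrightarrow> kap 0) (at 0)" "(sig \<longlongrightarrow> sig 0) (at 0)" unfolding isCont_def by auto
  qed (rule tendsto_const tendsto_ident_at)+
  from filterlim_compose[OF this fX']
  have "(\<lambda>n. D ((- X n)\<^sup>2) * (sig1 (- X n) / (- X n)) - (sig (- X n) / (- X n)) * (2 * (- X n) * D' ((- X n)\<^sup>2) - 4 * (- X n) * kap (- X n) - 2 * (- X n) * sig (- X n))) \<longlonglongrightarrow> 0"
    by (simp add: s20)
  moreover have "D ((- X n)\<^sup>2) * (sig1 (- X n) / (- X n)) - (sig (- X n) / (- X n)) * (2 * (- X n) * D' ((- X n)\<^sup>2) - 4 * (- X n) * kap (- X n) - 2 * (- X n) * sig (- X n)) = 2 * (k1 * k3 - k2)" for n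
  proof -
    have "W (- X n) = 0" using W0[OF XS(2), of n] Xp(1)[of n] by simp
    have aux: "x * (p / y) - (q / y) * c = 2 * k" if "y \<noteq> 0" "x * p = 2 * y * k + q * c" for x y p q c k :: real
      using that by (simp add: field_simps)
    show ?thesis using Xnz[of n] by (intro aux D_sig1_eq[OF \<open>W (- X n) = 0\<close>]) simp
  qed
  ultimately have "(\<lambda>n. 2 * (k1 * k3 - k2)) \<longlonglongrightarrow> 0" by simp
  then show False using k by (simp add: LIMSEQ_const_iff)
qed

text \<open>With \<open>k = \<rho>(0)\<close>, the function \<open>\<rho> (1 + k s\<^sup>2) - k\<close> satisfies a linear homogeneous equation and
  vanishes at \<open>0\<close>.\<close>

lemma W_eq_0_imp:
  assumes d: "\<And>s. \<bar>s\<bar> < b \<Longrightarrow> (r has_real_derivative r1 s) (at s)" and W: "\<And>s. \<bar>s\<bar> < b \<Longrightarrow> W s = 0"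
    and s: "\<bar>s\<bar> < b"
  shows "r s * (1 + r 0 * s\<^sup>2) = r 0"
proof -
  define G where "G s = r s * (1 + r 0 * s\<^sup>2) - r 0" for s
  have Gd: "(G has_real_derivative - 2 * p * r p * G p) (at p)" if "\<bar>p\<bar> < b" for p
  proof -
    have r1: "r1 p = - 2 * p * r p * r p" using W[OF that] by (simp add: W_def power2_eq_square)
    show ?thesis unfolding G_def[abs_def]
      by (auto intro!: derivative_eq_intros d[OF that] simp: r1 algebra_simps power2_eq_square)
  qed
  have G2: "((\<lambda>p. (G p)\<^sup>2) has_real_derivative - 4 * p * r p * (G p)\<^sup>2) (at p)" if "\<bar>p\<bar> < b" for p
    by (auto intro!: derivative_eq_intros Gd[OF that] simp: power2_eq_square)
  have "compact {- \<bar>s\<bar>..\<bar>s\<bar>}" by simp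
  moreover have "continuous_on {- \<bar>s\<bar>..\<bar>s\<bar>} (\<lambda>p. 4 * p * r p)"
  proof (rule continuous_at_imp_continuous_on, rule ballI)
    fix p assume "p \<in> {- \<bar>s\<bar>..\<bar>s\<bar>}"
    then have "isCont r p" using d[of p] s DERIV_isCont by fastforce
    then show "isCont (\<lambda>p. 4 * p * r p) p" by (intro continuous_intros)
  qed
  ultimately have "bounded ((\<lambda>p. 4 * p * r p) ` {- \<bar>s\<bar>..\<bar>s\<bar>})"
    using compact_continuous_image compact_imp_bounded by blast
  then obtain K where K: "\<And>p. p \<in> {- \<bar>s\<bar>..\<bar>s\<bar>} \<Longrightarrow> \<bar>4 * p * r p\<bar> \<le> K"
    unfolding bounded_iff real_norm_def by blast
  have "(G s)\<^sup>2 \<le> 0"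
  proof (cases "s = 0")
    case False
    have cont: "continuous_on T (\<lambda>p. (G p)\<^sup>2)" if "T \<subseteq> {- \<bar>s\<bar>..\<bar>s\<bar>}" for T
      using that s by (intro continuous_at_imp_continuous_on ballI DERIV_isCont[OF G2]) (auto dest!: subsetD)
    consider "s > 0" | "s < 0" using False by linarith
    then show ?thesis
    proof cases
      case 1
      have "(G (- (- s)))\<^sup>2 \<le> 0"
      proof (rule gronwall_zero[where a = "- s" and b = 0 and L = "\<lambda>p. (G (- p))\<^sup>2" and K = K])
        show "continuous_on {- s..0} (\<lambda>p. (G (- p))\<^sup>2)"
          using 1 by (intro continuous_on_compose2[OF cont[OF order_refl], of _ uminus] continuous_intros) auto
        show "((\<lambda>p. (G (- p))\<^sup>2) has_real_derivative 4 * (- p) * r (- p) * (G (- p))\<^sup>2) (at p)" if "- s < p" "p < 0" for p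
        proof -
          have "((\<lambda>p. (G (- p))\<^sup>2) has_real_derivative (- 4 * (- p) * r (- p) * (G (- p))\<^sup>2) * - 1) (at p)"
            by (rule DERIV_chain2[where f = "\<lambda>p. (G p)\<^sup>2" and g = "\<lambda>x. - x", OF G2 DERIV_minus[OF DERIV_ident]])
               (use that s 1 in auto)
          then show ?thesis by simp
        qed
        show "- K * (G (- p))\<^sup>2 \<le> 4 * (- p) * r (- p) * (G (- p))\<^sup>2" if "- s < p" "p < 0" for p
          using K[of "- p"] that 1 by (intro mult_right_mono) auto
      qed (use 1 in \<open>auto simp: G_def\<close>)
      then show ?thesis by simp
    next
      case 2
      show ?thesis
      proof (rule gronwall_zero[where a = s and b = 0 and L = "\<lambda>p. (G p)\<^sup>2" and K = K])
        show "continuous_on {s..0} (\<lambda>p. (G p)\<^sup>2)" using 2 by (intro cont) auto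
        show "((\<lambda>p. (G p)\<^sup>2) has_real_derivative - 4 * p * r p * (G p)\<^sup>2) (at p)" if "s < p" "p < 0" for p
          using that s by (intro G2) auto
        show "- K * (G p)\<^sup>2 \<le> - 4 * p * r p * (G p)\<^sup>2" if "s < p" "p < 0" for p
          using K[of p] that by (intro mult_right_mono) auto
      qed (use 2 in \<open>auto simp: G_def\<close>)
    qed
  qed (simp add: G_def)
  then show ?thesis by (simp add: G_def)
qed

end

section \<open>A singular ordinary differential equation\<close>

lemma no_interior_max:
  fixes g g' :: "real \<Rightarrow> real"
  assumes ab: "a < s" "s < b"
    and d: "\<And>p. a < p \<Longrightarrow> p < b \<Longrightarrow> (g has_real_derivative g' p) (at p)"
    and d2: "(g' has_real_derivative g'') (at s)" and pos: "g'' > 0"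
    and max: "\<And>p. a < p \<Longrightarrow> p < b \<Longrightarrow> g p \<le> g s" and crit: "g' s = 0"
  shows False
proof -
  obtain e where e: "e > 0" "\<And>h. 0 < h \<Longrightarrow> h < e \<Longrightarrow> g' s < g' (s + h)"
    using DERIV_pos_inc_right[OF d2 pos] by auto
  define h where "h = min (e / 2) ((b - s) / 2)"
  have h: "0 < h" "h < e" "s + h < b" using e(1) ab by (auto simp: h_def min_def field_simps)
  obtain z where z: "s < z" "z < s + h" "g (s + h) - g s = (s + h - s) * g' z"
    using MVT2[of s "s + h" g g'] d ab h by auto
  have "g' z > 0" using e(2)[of "z - s"] z h crit by simp
  then have "g (s + h) > g s" using z h by (simp add: algebra_simps)
  then show False using max[of "s + h"] h ab by simp
qed

text \<open>With \<open>z = b\<^sup>2 - s\<^sup>2\<close> this is the form that \<open>E = 0\<close> takes for \<open>P = \<rho>/N\<close> at a value \<open>b\<^sup>2\<close> with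
  \<open>D(b\<^sup>2) = 0\<close>. The end points are regular singular points at which \<open>P - P0\<close> has the exponents \<open>-1\<close>
  and \<open>M/2\<close>. For \<open>M < 0\<close> a bounded solution therefore is locally constant; for \<open>M > 0\<close> this is not a
  local statement, but the maximum principle applies on the whole interval.\<close>

locale singular_ode =
  fixes P P1 P2 :: "real \<Rightarrow> real" and b M P0 :: real
  assumes b: "b > 0"
    and d1: "\<And>s. \<bar>s\<bar> \<le> b \<Longrightarrow> (P has_real_derivative P1 s) (at s)"
    and d2: "\<And>s. \<bar>s\<bar> \<le> b \<Longrightarrow> (P1 has_real_derivative P2 s) (at s)"
    and pos: "\<And>s. \<bar>s\<bar> \<le> b \<Longrightarrow> 1 - (b\<^sup>2 - s\<^sup>2) * P s > 0"
    and ends: "P b = P0" "P (- b) = P0"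
    and ode: "\<And>s. \<bar>s\<bar> < b \<Longrightarrow> (1 - (b\<^sup>2 - s\<^sup>2) * P s) * (b\<^sup>2 - s\<^sup>2)\<^sup>2 * P2 s =
       2 * M * b\<^sup>2 * (P s - P0) + s * (b\<^sup>2 - s\<^sup>2) * P1 s * (4 - M - 3 * (b\<^sup>2 - s\<^sup>2) * P s)
        - (b\<^sup>2 - s\<^sup>2)^3 * (P1 s)\<^sup>2 / 2"
begin

lemma zpos: "\<bar>s\<bar> < b \<Longrightarrow> b\<^sup>2 - s\<^sup>2 > 0"
  using power_strict_mono[of "\<bar>s\<bar>" b 2] by simp

lemma contP: "T \<subseteq> {- b..b} \<Longrightarrow> continuous_on T P" and contP1: "T \<subseteq> {- b..b} \<Longrightarrow> continuous_on T P1"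
  by (intro continuous_at_imp_continuous_on ballI DERIV_isCont; force intro: d1 d2)+

lemma critical:
  assumes s: "\<bar>s\<bar> < b" and c: "P1 s = 0" and M: "M > 0"
  shows "P s > P0 \<Longrightarrow> P2 s > 0" "P s < P0 \<Longrightarrow> P2 s < 0"
proof -
  define a where "a = (1 - (b\<^sup>2 - s\<^sup>2) * P s) * (b\<^sup>2 - s\<^sup>2)\<^sup>2"
  have a: "a > 0" using pos[of s] zpos[OF s] s by (simp add: a_def)
  have c': "2 * M * b\<^sup>2 > 0" using M b by simp
  have eq: "a * P2 s = (2 * M * b\<^sup>2) * (P s - P0)" using ode[OF s] c by (simp add: a_def)
  show "P2 s > 0" if "P s > P0"
  proof -
    have "a * P2 s > 0" using that c' unfolding eq by simp
    then show ?thesis using a by (rule zero_less_mult_pos)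
  qed
  show "P2 s < 0" if "P s < P0"
  proof -
    have "a * - P2 s > 0" using that c' eq by (simp add: mult_pos_neg)
    then have "- P2 s > 0" using a by (rule zero_less_mult_pos)
    then show ?thesis by simp
  qed
qed

text \<open>The difference \<open>P - P0\<close> vanishes at the end points, and at an interior critical point its second
  derivative has its own sign. So it has neither a positive maximum nor a negative minimum.\<close>

lemma constant_pos:
  assumes M: "M > 0" and s: "\<bar>s\<bar> \<le> b"
  shows "P s = P0"
proof -
  have ne: "{- b..b} \<noteq> {}" "compact {- b..b}" using b by auto
  have crit: "P1 p = 0" if "\<bar>p\<bar> < b" "(\<forall>x\<in>{- b..b}. P x \<le> P p) \<or> (\<forall>x\<in>{- b..b}. P p \<le> P x)" for p
  proof -
    have *: "\<And>y. \<bar>p - y\<bar> < b - \<bar>p\<bar> \<Longrightarrow> y \<in> {- b..b}" by auto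
    show ?thesis using that(2)
    proof
      assume "\<forall>x\<in>{- b..b}. P x \<le> P p"
      then show ?thesis
        using DERIV_local_max[OF d1, of p "b - \<bar>p\<bar>"] that(1) * by auto
    next
      assume "\<forall>x\<in>{- b..b}. P p \<le> P x"
      then show ?thesis
        using DERIV_local_min[OF d1, of p "b - \<bar>p\<bar>"] that(1) * by auto
    qed
  qed
  have "P s \<le> P0"
  proof (rule ccontr)
    assume "\<not> P s \<le> P0"
    obtain p where p: "p \<in> {- b..b}" "\<And>x. x \<in> {- b..b} \<Longrightarrow> P x \<le> P p"
      using continuous_attains_sup[OF ne(2,1) contP] by auto
    have "P p > P0" using p(2)[of s] s \<open>\<not> P s \<le> P0\<close> by force
    then have "\<bar>p\<bar> < b" using p(1) ends by (cases "p = b \<or> p = - b") auto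
    then have c: "P1 p = 0" using crit p(2) by blast
    have "P2 p > 0" using critical(1)[OF \<open>\<bar>p\<bar> < b\<close> c M] \<open>P p > P0\<close> by simp
    show False
      by (rule no_interior_max[where a = "- b" and s = p and b = b and g = P and g' = P1 and g'' = "P2 p"])
         (use \<open>\<bar>p\<bar> < b\<close> \<open>P2 p > 0\<close> p(2) c in \<open>auto intro: d1 d2\<close>)
  qed
  moreover have "P s \<ge> P0"
  proof (rule ccontr)
    assume "\<not> P s \<ge> P0"
    obtain p where p: "p \<in> {- b..b}" "\<And>x. x \<in> {- b..b} \<Longrightarrow> P p \<le> P x"
      using continuous_attains_inf[OF ne(2,1) contP] by auto
    have "P p < P0" using p(2)[of s] s \<open>\<not> P s \<ge> P0\<close> by force
    then have "\<bar>p\<bar> < b" using p(1) ends by (cases "p = b \<or> p = - b") auto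
    then have c: "P1 p = 0" using crit p(2) by blast
    have "P2 p < 0" using critical(2)[OF \<open>\<bar>p\<bar> < b\<close> c M] \<open>P p < P0\<close> by simp
    show False
      by (rule no_interior_max[where a = "- b" and s = p and b = b and g = "\<lambda>x. - P x" and g' = "\<lambda>x. - P1 x" and g'' = "- P2 p"])
         (use \<open>\<bar>p\<bar> < b\<close> \<open>P2 p < 0\<close> p(2) c in \<open>auto intro: DERIV_minus[OF d1] DERIV_minus[OF d2]\<close>)
  qed
  ultimately show ?thesis by simp
qed

text \<open>For \<open>M < 0\<close> the quadratic form \<open>(P - P0)\<^sup>2 - z\<^sup>2 P1\<^sup>2 / (2 M b\<^sup>2)\<close> is nonnegative, vanishes at
  the end point, and satisfies a Gronwall inequality up to the end point.\<close>

lemma constant_neg: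
  assumes M: "M < 0" and s: "0 \<le> s" "s \<le> b"
  shows "P s = P0"
proof (cases "s = b")
  case False
  then have sb: "s < b" using s by simp
  \<comment> \<open>With this factor the products of \<open>\<omega>\<close> and \<open>\<theta>\<close> cancel in \<open>L'\<close> up to a multiple of \<open>z\<close>.\<close>
  define A where "A = - 1 / (2 * M * b\<^sup>2)"
  have A: "A > 0" using M b by (simp add: A_def divide_neg_neg mult_neg_pos)
  have AM: "2 * A * (2 * M * b\<^sup>2) = - 2" using M b by (simp add: A_def)
  define z where "z p = b\<^sup>2 - p\<^sup>2" for p
  define n where "n p = 1 - z p * P p" for p
  define L where "L p = (P p - P0)\<^sup>2 + A * (z p * P1 p)\<^sup>2" for p
  define L' where "L' p = 2 * (P p - P0) * P1 p + A * (2 * (z p * P1 p) * (z p * P2 p - 2 * p * P1 p))" for p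
  have Ld: "(L has_real_derivative L' p) (at p)" if "\<bar>p\<bar> \<le> b" for p
  proof -
    have "(z has_real_derivative - 2 * p) (at p)"
      unfolding z_def[abs_def] by (auto intro!: derivative_eq_intros)
    note zP = DERIV_mult[OF this d2[OF that]]
    note LP = DERIV_add[OF DERIV_power[OF DERIV_diff[OF d1[OF that] DERIV_const[of P0]], of 2] DERIV_cmult[OF DERIV_power[OF zP, of 2], of A]]
    show ?thesis
      unfolding L_def[abs_def] L'_def by (rule DERIV_cong[OF LP]) (simp add: algebra_simps)
  qed
  define H where "H p = \<bar>P p / n p\<bar> * (1 + 1 / A) + (2 * p * \<bar>P p\<bar> + z p * \<bar>P1 p\<bar>) / n p" for p
  have npos: "n p > 0" if "\<bar>p\<bar> \<le> b" for p using pos[OF that] by (simp add: n_def z_def)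
  have "continuous_on {s..b} P" "continuous_on {s..b} P1"
    using s by (intro contP contP1; simp)+
  moreover have "\<forall>p\<in>{s..b}. 1 - (b\<^sup>2 - p\<^sup>2) * P p \<noteq> 0"
  proof
    fix p assume "p \<in> {s..b}"
    then show "1 - (b\<^sup>2 - p\<^sup>2) * P p \<noteq> 0" using pos[of p] s by auto
  qed
  ultimately have "continuous_on {s..b} H"
    unfolding H_def n_def z_def by (intro continuous_intros) auto
  then have "bounded (H ` {s..b})" using compact_continuous_image compact_imp_bounded compact_Icc by blast
  then obtain K where "\<forall>p\<in>{s..b}. \<bar>H p\<bar> \<le> K"
    unfolding bounded_iff real_norm_def by blast
  then have K: "H p \<le> K" if "p \<in> {s..b}" for p using that abs_le_D1 by blast
  have "L s \<le> 0"
  proof (rule gronwall_zero[where L = L and L' = L' and K = K and b = b])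
    show "continuous_on {s..b} L"
      using s by (intro continuous_at_imp_continuous_on ballI DERIV_isCont[OF Ld]) auto
    show "L b \<le> 0" by (simp add: L_def z_def ends)
    fix p assume p: "s < p" "p < b"
    then have pb: "\<bar>p\<bar> < b" "\<bar>p\<bar> \<le> b" "p > 0" using s by auto
    show "(L has_real_derivative L' p) (at p)" using Ld[OF pb(2)] .
    define \<omega> \<theta> where "\<omega> = P p - P0" and "\<theta> = z p * P1 p"
    have zp: "z p > 0" using zpos[OF pb(1)] by (simp add: z_def)
    have np: "n p > 0" using npos[OF pb(2)] .
    have o: "n p * (z p)\<^sup>2 * P2 p = 2 * M * b\<^sup>2 * \<omega> + p * z p * P1 p * (4 - M - 3 * z p * P p) - (z p)^3 * (P1 p)\<^sup>2 / 2"
      using ode[OF pb(1)] by (simp add: n_def z_def \<omega>_def)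
    have "z p * (n p * L' p) = z p * (n p * (2 * \<omega> * P1 p)) + 2 * A * \<theta> * (n p * (z p)\<^sup>2 * P2 p) - 4 * A * p * n p * \<theta> * \<theta>"
      by (simp add: L'_def \<omega>_def[symmetric] \<theta>_def algebra_simps power2_eq_square)
    also have "\<dots> = 2 * n p * \<omega> * \<theta> + (2 * A * (2 * M * b\<^sup>2)) * \<omega> * \<theta>
        + A * \<theta> * \<theta> * (2 * p * (4 - M - 3 * z p * P p) - z p * \<theta> - 4 * p * n p)"
      unfolding o by (simp add: \<theta>_def algebra_simps power2_eq_square power3_eq_cube)
    also have "\<dots> = - 2 * z p * P p * \<omega> * \<theta> + A * \<theta> * \<theta> * (4 * p - 2 * p * M) - A * \<theta> * \<theta> * z p * (2 * p * P p + \<theta>)"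
      unfolding AM by (simp add: n_def algebra_simps)
    finally have e: "z p * (n p * L' p) = - 2 * z p * P p * \<omega> * \<theta> + A * \<theta> * \<theta> * (4 * p - 2 * p * M) - A * \<theta> * \<theta> * z p * (2 * p * P p + \<theta>)" .
    have L: "L p = \<omega>\<^sup>2 + A * \<theta>\<^sup>2" by (simp add: L_def \<omega>_def \<theta>_def)
    have 1: "2 * P p * \<omega> * \<theta> \<le> \<bar>P p\<bar> * (1 + 1 / A) * L p"
    proof -
      have "2 * P p * \<omega> * \<theta> \<le> \<bar>P p\<bar> * (2 * \<bar>\<omega>\<bar> * \<bar>\<theta>\<bar>)"
        by (rule order_trans[OF abs_ge_self]) (simp add: abs_mult)
      also have "2 * \<bar>\<omega>\<bar> * \<bar>\<theta>\<bar> \<le> \<omega>\<^sup>2 + \<theta>\<^sup>2"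
        using sum_squares_bound[of "\<bar>\<omega>\<bar>" "\<bar>\<theta>\<bar>"] by simp
      also have "\<omega>\<^sup>2 + \<theta>\<^sup>2 \<le> (1 + 1 / A) * L p"
      proof -
        have "(1 + 1 / A) * L p = (\<omega>\<^sup>2 + \<theta>\<^sup>2) + (A * \<theta>\<^sup>2 + \<omega>\<^sup>2 / A)" using A by (simp add: L field_simps)
        moreover have "A * \<theta>\<^sup>2 + \<omega>\<^sup>2 / A \<ge> 0" using A by simp
        ultimately show ?thesis by linarith
      qed
      finally show ?thesis by (simp add: mult_left_mono mult.assoc)
    qed
    have 2: "A * \<theta> * \<theta> * (2 * p * P p + \<theta>) \<le> (2 * p * \<bar>P p\<bar> + z p * \<bar>P1 p\<bar>) * L p"
    proof -
      have "2 * p * P p + \<theta> \<le> 2 * p * \<bar>P p\<bar> + z p * \<bar>P1 p\<bar>"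
        using pb(3) zp by (intro add_mono) (auto simp: \<theta>_def intro!: mult_left_mono)
      moreover have "A * \<theta> * \<theta> \<ge> 0" using A by (simp add: mult.assoc)
      ultimately have "A * \<theta> * \<theta> * (2 * p * P p + \<theta>) \<le> A * \<theta> * \<theta> * (2 * p * \<bar>P p\<bar> + z p * \<bar>P1 p\<bar>)"
        by (rule mult_left_mono)
      also have "\<dots> \<le> L p * (2 * p * \<bar>P p\<bar> + z p * \<bar>P1 p\<bar>)"
        using pb(3) zp by (intro mult_right_mono) (auto simp: L power2_eq_square)
      finally show ?thesis by (simp add: mult.commute)
    qed
    have "A * \<theta> * \<theta> * (4 * p - 2 * p * M) \<ge> 0"
    proof -
      have "p * M \<le> 0" using M pb(3) by (simp add: mult_nonneg_nonpos)
      then have "4 * p - 2 * p * M \<ge> 0" using pb(3) by linarith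
      moreover have "A * \<theta> * \<theta> \<ge> 0" using A by (simp add: mult.assoc)
      ultimately show ?thesis by simp
    qed
    then have "z p * (n p * L' p) \<ge> z p * (- (2 * P p * \<omega> * \<theta>) - A * \<theta> * \<theta> * (2 * p * P p + \<theta>))"
      unfolding e by (simp add: algebra_simps)
    then have "n p * L' p \<ge> - (2 * P p * \<omega> * \<theta>) - A * \<theta> * \<theta> * (2 * p * P p + \<theta>)"
      using zp by simp
    also have "- (2 * P p * \<omega> * \<theta>) - A * \<theta> * \<theta> * (2 * p * P p + \<theta>) \<ge> - (n p * H p * L p)"
    proof -
      have "n p * H p * L p = \<bar>P p\<bar> * (1 + 1 / A) * L p + (2 * p * \<bar>P p\<bar> + z p * \<bar>P1 p\<bar>) * L p"
        using np by (simp add: H_def field_simps)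
      then show ?thesis using 1 2 by linarith
    qed
    finally have "n p * (- (H p * L p)) \<le> n p * L' p" by (simp add: mult.assoc)
    then have "L' p \<ge> - (H p * L p)" using np by (rule mult_left_le_imp_le)
    moreover have "H p * L p \<le> K * L p"
      using K[of p] p A by (intro mult_right_mono) (auto simp: L)
    ultimately show "- K * L p \<le> L' p" by simp
  qed (use sb in simp)
  moreover have "L s \<ge> (P s - P0)\<^sup>2" using A by (simp add: L_def)
  ultimately have "(P s - P0)\<^sup>2 \<le> 0" by linarith
  then show ?thesis by simp
qed (use ends in simp)

end

lemma (in singular_ode) reflect: "singular_ode (\<lambda>s. P (- s)) (\<lambda>s. - P1 (- s)) (\<lambda>s. P2 (- s)) b M P0"
proof
  fix s :: real
  show "((\<lambda>s. P (- s)) has_real_derivative - P1 (- s)) (at s)" if "\<bar>s\<bar> \<le> b"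
  proof -
    have "((\<lambda>s. P (- s)) has_real_derivative P1 (- s) * - 1) (at s)"
      by (rule DERIV_chain2[where f = P and g = "\<lambda>x. - x", OF d1 DERIV_minus[OF DERIV_ident]]) (use that in auto)
    then show ?thesis by simp
  qed
  show "((\<lambda>s. - P1 (- s)) has_real_derivative P2 (- s)) (at s)" if "\<bar>s\<bar> \<le> b"
  proof -
    have "((\<lambda>s. P1 (- s)) has_real_derivative P2 (- s) * - 1) (at s)"
      by (rule DERIV_chain2[where f = P1 and g = "\<lambda>x. - x", OF d2 DERIV_minus[OF DERIV_ident]]) (use that in auto)
    from DERIV_minus[OF this] show ?thesis by simp
  qed
  show "1 - (b\<^sup>2 - s\<^sup>2) * P (- s) > 0" if "\<bar>s\<bar> \<le> b" using pos[of "- s"] that by simp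
  show "(1 - (b\<^sup>2 - s\<^sup>2) * P (- s)) * (b\<^sup>2 - s\<^sup>2)\<^sup>2 * P2 (- s) =
       2 * M * b\<^sup>2 * (P (- s) - P0) + s * (b\<^sup>2 - s\<^sup>2) * - P1 (- s) * (4 - M - 3 * (b\<^sup>2 - s\<^sup>2) * P (- s))
        - (b\<^sup>2 - s\<^sup>2)^3 * (- P1 (- s))\<^sup>2 / 2" if "\<bar>s\<bar> < b"
    using ode[of "- s"] that by simp
qed (simp_all add: b ends)

lemma (in singular_ode) is_constant:
  assumes "M \<noteq> 0" "\<bar>s\<bar> \<le> b"
  shows "P s = P0"
proof (cases "M > 0")
  case True then show ?thesis using constant_pos assms by blast
next
  case False
  then have M: "M < 0" using assms by simp
  interpret r: singular_ode "\<lambda>s. P (- s)" "\<lambda>s. - P1 (- s)" "\<lambda>s. P2 (- s)" b M P0 by (rule reflect)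
  show ?thesis
    using constant_neg[OF M, of s] r.constant_neg[OF M, of "- s"] assms(2) by (cases "s \<ge> 0") auto
qed

section \<open>Solution of the equation\<close>

lemma isCont_eq_0:
  fixes g :: "real \<Rightarrow> real"
  assumes "isCont g x" "open S" "x \<in> S" "\<And>s. s \<in> S \<Longrightarrow> s \<noteq> x \<Longrightarrow> g s = 0"
  shows "g x = 0"
proof -
  have "(g \<longlongrightarrow> g x) (at x)" using assms(1) by (simp add: isCont_def)
  moreover have "eventually (\<lambda>s. g s = 0) (at x)"
    using assms(2-4) by (auto simp: eventually_at_topological)
  then have "(g \<longlongrightarrow> 0) (at x)" by (rule tendsto_eventually)
  ultimately show ?thesis using tendsto_unique[OF at_neq_bot] by blast
qed

context riccati
begin

text \<open>The first expression is the factor of \<open>\<tau> a\<^sub>i\<^sub>j\<close> in \<open>b\<^bsub>i|j\<^esub>\<close>; the other two are \<^const>\<open>q_coeff\<close> and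
  \<^const>\<open>eta_coeff\<close> divided by \<open>\<tau>\<^sup>2\<close>. If the first vanished, or the other two together, then
  \<open>k2 = k1 k3\<close>.\<close>

lemma degenerate_coefficients:
  assumes k: "k2 \<noteq> k1 * k3" and D: "D q = 0"
  shows "1 + k1 * q \<noteq> 0"
    "k3 - 2 * k1 - k1\<^sup>2 * q - \<mu> = 0 \<Longrightarrow>
     k1\<^sup>2 + k2 - 2 * k1 * k3 - k1 * (k2 - k1\<^sup>2) * q + k1 * \<mu> \<noteq> 0"
proof -
  have D: "1 + k1 * q + (k2 * q + k3) * q = 0" using D by (simp add: D_def algebra_simps power2_eq_square)
  show "1 + k1 * q \<noteq> 0"
  proof
    assume u: "1 + k1 * q = 0"
    then have "q \<noteq> 0" by auto
    then have "k3 = - k2 * q" using D u by auto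
    then have "k1 * k3 = k2 * - (k1 * q)" by simp
    also have "k1 * q = - 1" using u by simp
    finally show False using k by simp
  qed
  assume a: "k3 - 2 * k1 - k1\<^sup>2 * q - \<mu> = 0"
  show "k1\<^sup>2 + k2 - 2 * k1 * k3 - k1 * (k2 - k1\<^sup>2) * q + k1 * \<mu> \<noteq> 0"
  proof
    assume e: "k1\<^sup>2 + k2 - 2 * k1 * k3 - k1 * (k2 - k1\<^sup>2) * q + k1 * \<mu> = 0"
    have mu: "\<mu> = k3 - 2 * k1 - k1\<^sup>2 * q" using a by simp
    have 1: "k2 - k1 * k2 * q - k1 * (k1 + k3) = 0"
      using e unfolding mu by (simp add: algebra_simps power2_eq_square)
    have "k1 + k2 * q = k1 * (1 + k1 * q + (k2 * q + k3) * q) + q * (k2 - k1 * k2 * q - k1 * (k1 + k3))"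
      by (simp add: algebra_simps)
    then have k1: "k1 = - (k2 * q)" unfolding D 1 by simp
    have "1 + k3 * q = 0" using D unfolding k1 by (simp add: algebra_simps)
    then have "k3 * q = - 1" by simp
    moreover have "k1 * k3 = - k2 * (k3 * q)" unfolding k1 by simp
    ultimately show False using k by simp
  qed
qed

text \<open>For \<open>D q = 0\<close> the partial derivatives with respect to \<open>q\<close> drop out of \<open>E\<close>, and \<open>h\<close> is a constant
  times \<open>(q - s\<^sup>2) \<rho>/N\<close>. This turns \<open>E = 0\<close> into the singular equation for \<open>P = \<rho>/N\<close>, and its limit at
  the end points determines \<open>P\<close> there. Hence \<open>P\<close> is constant, which means \<open>\<rho> (1 + k s\<^sup>2) = k\<close>.\<close>

lemma degenerate_case:
  assumes k: "k2 \<noteq> k1 * k3" and Dq: "D q = 0" and q: "q > 0"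
    and d: "\<And>s. s\<^sup>2 \<le> q \<Longrightarrow> (r has_real_derivative r1 s) (at s)" "\<And>s. s\<^sup>2 \<le> q \<Longrightarrow> (r1 has_real_derivative r2 s) (at s)"
    and c2: "\<And>s. s\<^sup>2 \<le> q \<Longrightarrow> isCont r2 s"
    and N: "\<And>s. s\<^sup>2 \<le> q \<Longrightarrow> N s q > 0"
    and E: "\<And>s. s\<^sup>2 < q \<Longrightarrow> E s q \<mu> = 0"
  shows "\<exists>k. \<forall>s. s\<^sup>2 \<le> q \<longrightarrow> r s * (1 + k * s\<^sup>2) = k"
proof -
  define b where "b = sqrt q"
  have b: "b > 0" "b\<^sup>2 = q" using q by (simp_all add: b_def)
  have sq_le: "s\<^sup>2 \<le> q \<longleftrightarrow> \<bar>s\<bar> \<le> b" for s using b abs_le_square_iff[of s b] by simp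
  have sq_less: "s\<^sup>2 < q \<longleftrightarrow> \<bar>s\<bar> < b" for s using b abs_le_square_iff[of b s] by (simp add: not_le[symmetric])
  define g where "g = (1 + k1 * q) / q"
  have g: "g \<noteq> 0" using degenerate_coefficients(1)[OF k Dq] q by (simp add: g_def)
  have gv: "k2 * q + k3 = - g" "1 + k1 * q = g * q"
    using Dq q by (simp_all add: g_def D_def field_simps power2_eq_square)
  define qq ee where "qq = k3 - 2 * k1 - k1\<^sup>2 * q - \<mu>" and "ee = k1\<^sup>2 + k2 - 2 * k1 * k3 - k1 * (k2 - k1\<^sup>2) * q + k1 * \<mu>"
  have qe: "qq = 0 \<Longrightarrow> ee \<noteq> 0" using degenerate_coefficients(2)[OF k Dq] by (simp add: qq_def ee_def)
  define P where "P s = r s / N s q" for s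
  define P1 where "P1 s = W s / (N s q)\<^sup>2" for s
  define P2 where "P2 s = (r2 s + 2 * (r s)\<^sup>2 + 4 * s * r s * r1 s) / (N s q)\<^sup>2 - 2 * W s * Ns s q / (N s q)^3" for s
  have Nd: "((\<lambda>s. N s q) has_real_derivative Ns s q) (at s)" if "s\<^sup>2 \<le> q" for s
    unfolding N_def Ns_def by (auto intro!: derivative_eq_intros d(1)[OF that] simp: algebra_simps)
  have Wd: "(W has_real_derivative r2 s + 2 * (r s)\<^sup>2 + 4 * s * r s * r1 s) (at s)" if "s\<^sup>2 \<le> q" for s
    unfolding W_def[abs_def]
    by (auto intro!: derivative_eq_intros d[OF that] simp: algebra_simps power2_eq_square)
  have Pd: "(P has_real_derivative P1 s) (at s)" if "s\<^sup>2 \<le> q" for s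
  proof -
    have n: "N s q \<noteq> 0" using N[OF that] by simp
    have e: "r1 s * N s q - r s * Ns s q = W s"
      by (simp add: N_def Ns_def W_def algebra_simps power2_eq_square)
    show ?thesis unfolding P_def[abs_def] P1_def e[symmetric]
      by (rule DERIV_cong[OF DERIV_divide[OF d(1)[OF that] Nd[OF that] n]]) (simp add: power2_eq_square)
  qed
  have P1d: "(P1 has_real_derivative P2 s) (at s)" if "s\<^sup>2 \<le> q" for s
  proof -
    have n: "(N s q)\<^sup>2 \<noteq> 0" "N s q \<noteq> 0" using N[OF that] by simp_all
    show ?thesis unfolding P1_def[abs_def] P2_def
      by (rule DERIV_cong[OF DERIV_divide[OF Wd[OF that] DERIV_power[OF Nd[OF that], of 2] n(1)]])
         (use n in \<open>simp add: field_simps power2_eq_square power3_eq_cube\<close>)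
  qed
  have zP: "1 - (q - s\<^sup>2) * P s = 1 / N s q" if "s\<^sup>2 \<le> q" for s
    using N[OF that] by (simp add: P_def field_simps) (simp add: N_def algebra_simps)
  have h0: "h s q = g * (q - s\<^sup>2) * P s / 2" if "s\<^sup>2 \<le> q" for s
  proof -
    have "1 + k1 * q + (k2 * q + k3) * s\<^sup>2 = g * (q - s\<^sup>2)" unfolding gv by (simp add: algebra_simps)
    then show ?thesis using h_eq[of s q] N[OF that] by (simp add: P_def)
  qed
  have op: "open {s. s\<^sup>2 < q}" by (intro open_Collect_less continuous_intros)
  have h1: "hs s q = g * (- s * P s + (q - s\<^sup>2) * P1 s / 2)" if s: "s\<^sup>2 < q" for s
  proof -
    have s': "s\<^sup>2 \<le> q" using s by simp
    have "((\<lambda>s. h s q) has_derivative (\<lambda>x. hs s q * x + fB s q * 0)) (at s)"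
      by (rule has_derivative_pair_comp[OF h_derivs(1)[OF d(1)[OF s'] d(2)[OF s']] has_derivative_ident has_derivative_const])
         (use N[OF s'] in simp)
    then have "((\<lambda>s. h s q) has_real_derivative hs s q) (at s)"
      by (simp add: has_field_derivative_def)
    moreover have "((\<lambda>s. g * (q - s\<^sup>2) * P s / 2) has_real_derivative g * (- s * P s + (q - s\<^sup>2) * P1 s / 2)) (at s)"
      by (auto intro!: derivative_eq_intros Pd[OF s'] simp: field_simps)
    then have "((\<lambda>s. h s q) has_real_derivative g * (- s * P s + (q - s\<^sup>2) * P1 s / 2)) (at s)"
      by (rule has_field_derivative_transform_within_open[OF _ op]) (use s h0 in auto)
    ultimately show ?thesis by (rule DERIV_unique)
  qed
  have h2: "k2 + fss s q = g * (- P s - 2 * s * P1 s + (q - s\<^sup>2) * P2 s / 2)" if s: "s\<^sup>2 < q" for s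
  proof -
    have s': "s\<^sup>2 \<le> q" using s by simp
    have "((\<lambda>s. hs s q) has_derivative (\<lambda>x. (k2 + fss s q) * x + fsB s q * 0)) (at s)"
      by (rule has_derivative_pair_comp[OF h_derivs(2)[OF d(1)[OF s'] d(2)[OF s']] has_derivative_ident has_derivative_const])
         (use N[OF s'] in simp)
    then have "((\<lambda>s. hs s q) has_real_derivative k2 + fss s q) (at s)"
      by (simp add: has_field_derivative_def)
    moreover have "((\<lambda>s. g * (- s * P s + (q - s\<^sup>2) * P1 s / 2)) has_real_derivative g * (- P s - 2 * s * P1 s + (q - s\<^sup>2) * P2 s / 2)) (at s)"
      by (auto intro!: derivative_eq_intros Pd[OF s'] P1d[OF s'] simp: field_simps)
    then have "((\<lambda>s. hs s q) has_real_derivative g * (- P s - 2 * s * P1 s + (q - s\<^sup>2) * P2 s / 2)) (at s)"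
      by (rule has_field_derivative_transform_within_open[OF _ op]) (use s h1 in auto)
    ultimately show ?thesis by (rule DERIV_unique)
  qed
  \<comment> \<open>\<open>E s q \<mu>\<close> in terms of \<open>P\<close>; unlike \<open>E\<close> it is used at the end points as well.\<close>
  define \<Phi> where "\<Phi> s = qq * g * (q * P s - s * (q - s\<^sup>2) * P1 s / 2) + ee
     + g\<^sup>2 * ((1 - (q - s\<^sup>2) * P s) * (2 * s * (q - s\<^sup>2) * P1 s - (q - s\<^sup>2)\<^sup>2 * P2 s / 2)
          + (q - s\<^sup>2)\<^sup>2 * P1 s * (s * P s - (q - s\<^sup>2) * P1 s / 2) / 2)" for s
  have Phi0: "\<Phi> s = 0" if s: "s\<^sup>2 < q" for s
  proof -
    define z where "z = q - s\<^sup>2"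
    have qz: "q = z + s * s" by (simp add: z_def power2_eq_square)
    define p p1 p2 where "p = P s" and "p1 = P1 s" and "p2 = P2 s"
    have s': "s\<^sup>2 \<le> q" using s by simp
    have "0 = qq * (2 * h s q - s * hs s q) + ee
     + 4 * (1 + k1 * q + (k2 * q + k3) * q) * fB s q - 2 * s * (1 + k1 * q + (k2 * q + k3) * q) * fsB s q
     - (1 + k1 * q + (k2 * q + k3) * s\<^sup>2) * (k2 + fss s q)
     + 2 * (k2 * q + k3) * h s q + 4 * (h s q)\<^sup>2 - 2 * s * h s q * hs s q
     + (q - s\<^sup>2) * (2 * h s q * (k2 + fss s q) - (hs s q)\<^sup>2)"
      using E[OF s] unfolding E_eq qq_def ee_def by simp
    also have "\<dots> = qq * (2 * (g * z * p / 2) - s * (g * (- s * p + z * p1 / 2))) + ee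
      - g * z * (g * (- p - 2 * s * p1 + z * p2 / 2)) - 2 * g * (g * z * p / 2) + 4 * (g * z * p / 2)\<^sup>2
      - 2 * s * (g * z * p / 2) * (g * (- s * p + z * p1 / 2))
      + z * (2 * (g * z * p / 2) * (g * (- p - 2 * s * p1 + z * p2 / 2)) - (g * (- s * p + z * p1 / 2))\<^sup>2)"
    proof -
      have e1: "g * q + - g * s\<^sup>2 = g * z" "g * q + - g * q = 0" by (simp_all add: z_def algebra_simps)
      show ?thesis
        unfolding h0[OF s'] h1[OF s] h2[OF s] gv e1 z_def[symmetric] p_def[symmetric] p1_def[symmetric] p2_def[symmetric]
        by (simp add: algebra_simps)
    qed
    also have "\<dots> = qq * g * ((z + s * s) * p - s * z * p1 / 2) + ee
     + g\<^sup>2 * ((1 - z * p) * (2 * s * z * p1 - z\<^sup>2 * p2 / 2) + z\<^sup>2 * p1 * (s * p - z * p1 / 2) / 2)"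
      by (simp add: field_simps power2_eq_square)
    also have "\<dots> = \<Phi> s"
      unfolding \<Phi>_def z_def[symmetric] p_def[symmetric] p1_def[symmetric] p2_def[symmetric] qz[symmetric] ..
    finally show ?thesis by simp
  qed
  have Phi_end: "\<Phi> s = 0" if "\<bar>s\<bar> = b" for s
  proof (rule continuous_constant_on_closure[of "{- b<..<b}" \<Phi> 0 s])
    have cl: "closure {- b<..<b} = {- b..b}" using b(1) by (intro closure_greaterThanLessThan) simp
    show "s \<in> closure {- b<..<b}" using that unfolding cl by auto
    show "continuous_on (closure {- b<..<b}) \<Phi>"
      unfolding cl
    proof (rule continuous_at_imp_continuous_on, rule ballI)
      fix x assume "x \<in> {- b..b}"
      then have x: "x\<^sup>2 \<le> q" unfolding sq_le by auto
      have 0: "N x q \<noteq> 0" using N[OF x] by simp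
      have c: "isCont r x" "isCont r1 x" "isCont P x" "isCont P1 x" "isCont W x" "isCont (\<lambda>s. N s q) x"
        using DERIV_isCont d[OF x] Pd[OF x] P1d[OF x] Wd[OF x] Nd[OF x] by blast+
      have "isCont P2 x" unfolding P2_def[abs_def] Ns_def
        using c c2[OF x] 0 by (intro continuous_intros) auto
      then show "isCont \<Phi> x" unfolding \<Phi>_def[abs_def] using c by (intro continuous_intros) auto
    qed
  qed (use Phi0 sq_less in auto)
  have ends: "qq * g * q * P s + ee = 0" if "\<bar>s\<bar> = b" for s
  proof -
    have "s\<^sup>2 = q" using that b by (metis power2_abs)
    then show ?thesis using Phi_end[OF that] by (simp add: \<Phi>_def)
  qed
  have qq: "qq \<noteq> 0" using qe ends[of b] b by auto
  define M P0 where "M = qq / g" and "P0 = - ee / (qq * g * q)"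
  have M: "M \<noteq> 0" using qq g by (simp add: M_def)
  have endP: "P s = P0" if "\<bar>s\<bar> = b" for s
    using ends[OF that] qq g q by (simp add: P0_def field_simps)
  interpret S: singular_ode P P1 P2 b M P0
  proof
    fix s :: real
    show "(P has_real_derivative P1 s) (at s)" if "\<bar>s\<bar> \<le> b" using Pd that sq_le by blast
    show "(P1 has_real_derivative P2 s) (at s)" if "\<bar>s\<bar> \<le> b" using P1d that sq_le by blast
    show "0 < 1 - (b\<^sup>2 - s\<^sup>2) * P s" if "\<bar>s\<bar> \<le> b"
      using zP[of s] N[of s] that sq_le by (simp add: b)
    show "(1 - (b\<^sup>2 - s\<^sup>2) * P s) * (b\<^sup>2 - s\<^sup>2)\<^sup>2 * P2 s =
       2 * M * b\<^sup>2 * (P s - P0) + s * (b\<^sup>2 - s\<^sup>2) * P1 s * (4 - M - 3 * (b\<^sup>2 - s\<^sup>2) * P s)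
        - (b\<^sup>2 - s\<^sup>2)^3 * (P1 s)\<^sup>2 / 2" if "\<bar>s\<bar> < b"
    proof -
      define z p p1 p2 where "z = q - s\<^sup>2" and "p = P s" and "p1 = P1 s" and "p2 = P2 s"
      have e: "ee = - (M * g) * g * q * P0" "qq = M * g" using g qq q by (simp_all add: P0_def M_def)
      have "0 = qq * g * (q * p - s * z * p1 / 2) + ee
         + g\<^sup>2 * ((1 - z * p) * (2 * s * z * p1 - z\<^sup>2 * p2 / 2) + z\<^sup>2 * p1 * (s * p - z * p1 / 2) / 2)"
        using Phi0[of s] that sq_less unfolding \<Phi>_def z_def p_def p1_def p2_def by simp
      also have "\<dots> = g\<^sup>2 / 2 * (2 * M * q * (p - P0) + s * z * p1 * (4 - M - 3 * z * p) - z^3 * p1\<^sup>2 / 2 - (1 - z * p) * z\<^sup>2 * p2)"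
        unfolding e by (simp add: field_simps power2_eq_square power3_eq_cube)
      finally show ?thesis using g unfolding b z_def p_def p1_def p2_def by simp
    qed
  qed (use b endP in auto)
  have r: "r s = P0 * (1 + (q - s\<^sup>2) * r s)" if "s\<^sup>2 \<le> q" for s
    using S.is_constant[OF M, of s] that N[OF that] unfolding sq_le P_def by (simp add: field_simps N_def)
  have P0: "1 - P0 * q \<noteq> 0"
  proof
    assume a: "1 - P0 * q = 0"
    have "r 0 = P0 + (P0 * q) * r 0" using r[of 0] q by (simp add: algebra_simps)
    also have "P0 * q = 1" using a by simp
    finally show False using a by simp
  qed
  have "r s * (1 + P0 / (1 - P0 * q) * s\<^sup>2) = P0 / (1 - P0 * q)" if "s\<^sup>2 \<le> q" for s
    using r[OF that] P0 by (simp add: field_simps)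
  then show ?thesis by blast
qed

end

text \<open>\<open>BB\<close> stands for the set of values of \<open>b\<^sup>2\<close> at points with \<open>\<tau> \<noteq> 0\<close>; then \<open>J\<close> below consists of the values
  of \<open>s\<close> in the interior of \<open>[-b, b]\<close> at such points. The multiplier \<open>\<mu>\<close> depends on \<open>q\<close> but not on \<open>s\<close>.\<close>

locale riccati_family = riccati k1 k2 k3 r r1 r2 for k1 k2 k3 :: real and r r1 r2 :: "real \<Rightarrow> real" +
  fixes BB :: "real set"
  assumes k: "k2 \<noteq> k1 * k3" and BB_pos: "\<exists>q\<in>BB. q > 0"
    and d: "\<And>q s. q \<in> BB \<Longrightarrow> s\<^sup>2 \<le> q \<Longrightarrow> (r has_real_derivative r1 s) (at s)"
      "\<And>q s. q \<in> BB \<Longrightarrow> s\<^sup>2 \<le> q \<Longrightarrow> (r1 has_real_derivative r2 s) (at s)"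
      "\<And>q s. q \<in> BB \<Longrightarrow> s\<^sup>2 \<le> q \<Longrightarrow> isCont r2 s"
    and N_pos: "\<And>q s. q \<in> BB \<Longrightarrow> s\<^sup>2 \<le> q \<Longrightarrow> N s q > 0"
    and E0: "\<And>q. q \<in> BB \<Longrightarrow> \<exists>\<mu>. \<forall>s. s\<^sup>2 < q \<longrightarrow> E s q \<mu> = 0"
    and dense: "\<And>q e. q \<in> BB \<Longrightarrow> q > 0 \<Longrightarrow> D q \<noteq> 0 \<Longrightarrow> e > 0 \<Longrightarrow> infinite (BB \<inter> {q - e<..<q + e})"
begin

definition J :: "real set" where "J = {s. \<exists>q\<in>BB. s\<^sup>2 < q}"

lemma open_J: "open J"
proof -
  have "J = (\<Union>q\<in>BB. {s. s\<^sup>2 < q})" by (auto simp: J_def)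
  then show ?thesis by (auto intro!: open_UN open_Collect_less continuous_intros)
qed

lemma J_mono: "s \<in> J \<Longrightarrow> \<bar>p\<bar> \<le> \<bar>s\<bar> \<Longrightarrow> p \<in> J"
  unfolding J_def using abs_le_square_iff by (fastforce intro: order_le_less_trans)

lemma zero_J: "0 \<in> J"
  using BB_pos by (simp add: J_def)

lemma J_derivs:
  assumes "s \<in> J"
  shows "(r has_real_derivative r1 s) (at s)" "(r1 has_real_derivative r2 s) (at s)"
  using assms d unfolding J_def by (auto intro: less_imp_le)

lemma generic_case:
  assumes gen: "\<And>s. s \<in> J \<Longrightarrow> \<exists>q\<in>BB. s\<^sup>2 < q \<and> D q \<noteq> 0"
  shows "(\<forall>s\<in>J. sig s = 0) \<or> (\<exists>k. \<forall>s\<in>J. r s * (1 + k * s\<^sup>2) = k)"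
proof -
  have sW: "sig s * W s = 0" if s: "s \<in> J" for s
  proof -
    obtain q where q: "q \<in> BB" "s\<^sup>2 < q" "D q \<noteq> 0" using gen[OF s] by blast
    \<comment> \<open>The values in \<open>Q\<close> exceed \<open>c\<close>, so the equation holds for all of them on a common interval around \<open>s\<close>.\<close>
    define c where "c = (s\<^sup>2 + q) / 2"
    define Q where "Q = BB \<inter> {q - (q - s\<^sup>2) / 2<..<q + (q - s\<^sup>2) / 2}"
    have "q > 0" using q(2) by (meson le_less_trans zero_le_power2)
    have Q: "infinite Q" unfolding Q_def using q \<open>q > 0\<close> by (intro dense) auto
    have Qc: "c < p" "p \<in> BB" if "p \<in> Q" for p using that by (auto simp: Q_def c_def field_simps)
    have c: "s\<^sup>2 < c" "c < q" using q(2) by (auto simp: c_def)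
    show ?thesis
    proof (rule sig_W_eq_0[OF Q c(1) Qc(1)])
      show "(r has_real_derivative r1 p) (at p)" "(r1 has_real_derivative r2 p) (at p)" if "p\<^sup>2 < c" for p
        using d[OF q(1), of p] that c by auto
      show "N p q' \<noteq> 0" if "q' \<in> Q" "p\<^sup>2 < c" for q' p
        using N_pos[OF Qc(2)[OF that(1)], of p] Qc(1)[OF that(1)] that(2) by auto
      show "\<exists>\<mu>. \<forall>p. p\<^sup>2 < c \<longrightarrow> E p q' \<mu> = 0" if "q' \<in> Q" for q'
        using E0[OF Qc(2)[OF that]] Qc(1)[OF that] by (meson less_trans)
    qed
  qed
  define Jp Jm where "Jp = J \<inter> {0<..}" and "Jm = J \<inter> {..<0}"
  have conn: "connected Jp" "connected Jm"
    unfolding is_interval_connected_1[symmetric] is_interval_1 Jp_def Jm_def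
    by (auto intro: J_mono)
  have op: "open Jp" "open Jm" using open_J by (auto simp: Jp_def Jm_def)
  have alt: "(\<forall>s\<in>S. sig s = 0) \<or> (\<forall>s\<in>S. W s = 0)" if "S = Jp \<or> S = Jm" for S
    by (rule sig_or_W[OF k]) (use that conn op J_derivs sW in \<open>auto simp: Jp_def Jm_def\<close>)
  have cont: "isCont sig 0" "isCont W 0"
  proof -
    note D0 = J_derivs[OF zero_J]
    show "isCont sig 0" using sig_derivs(1)[OF D0] DERIV_isCont by blast
    have "isCont r 0" "isCont r1 0" using D0 DERIV_isCont by blast+
    then show "isCont W 0" unfolding W_def[abs_def] by (intro continuous_intros)
  qed
  have cover: "s \<in> Jp \<or> s \<in> Jm" if "s \<in> J" "s \<noteq> 0" for s using that by (auto simp: Jp_def Jm_def)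
  consider "\<forall>s\<in>Jp. sig s = 0" "\<forall>s\<in>Jm. sig s = 0" | "\<forall>s\<in>Jp. W s = 0" "\<forall>s\<in>Jm. W s = 0"
    | "\<forall>s\<in>Jp. sig s = 0" "\<forall>s\<in>Jm. W s = 0" | "\<forall>s\<in>Jp. W s = 0" "\<forall>s\<in>Jm. sig s = 0"
    using alt by blast
  then show ?thesis
  proof cases
    case 1
    have "sig 0 = 0" by (rule isCont_eq_0[OF cont(1) open_J zero_J]) (use 1 cover in blast)
    then have "\<forall>s\<in>J. sig s = 0" using 1 cover by metis
    then show ?thesis ..
  next
    case 2
    have "W 0 = 0" by (rule isCont_eq_0[OF cont(2) open_J zero_J]) (use 2 cover in blast)
    then have W: "W s = 0" if "s \<in> J" for s using 2 cover that by metis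
    have "r s * (1 + r 0 * s\<^sup>2) = r 0" if "s \<in> J" for s
    proof -
      obtain q where q: "q \<in> BB" "s\<^sup>2 < q" using \<open>s \<in> J\<close> by (auto simp: J_def)
      have "p \<in> J" if "\<bar>p\<bar> < sqrt q" for p
      proof -
        have "p\<^sup>2 < q" using that real_less_rsqrt by (metis abs_ge_zero power2_abs real_sqrt_abs real_sqrt_less_iff)
        then show ?thesis using q by (auto simp: J_def)
      qed
      then show ?thesis
        by (intro W_eq_0_imp[of "sqrt q"] J_derivs W) (use q in \<open>auto simp flip: real_sqrt_abs\<close>)
    qed
    then show ?thesis by blast
  next
    case 3
    then show ?thesis
      using no_mixing_at_0[OF k open_J zero_J, of 1] J_derivs by (auto simp: Jp_def Jm_def)
  next
    case 4
    then show ?thesis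
      using no_mixing_at_0[OF k open_J zero_J, of "- 1"] J_derivs by (auto simp: Jp_def Jm_def)
  qed
qed

lemma finite_D_roots: "finite {q. D q = 0}"
proof -
  have "{q. D q = 0} = {q. poly [:1, k1 + k3, k2:] q = 0}"
    by (simp add: D_def algebra_simps power2_eq_square)
  then show ?thesis using poly_roots_finite[of "[:1, k1 + k3, k2:]"] by simp
qed

text \<open>If \<open>D\<close> vanishes at all \<open>q \<in> BB\<close> above some \<open>s\<^sup>2\<close> then there are finitely many of them. The largest one
  is the maximum of \<open>BB\<close>, and the degenerate case at this value covers all of \<open>J\<close>.\<close>

theorem sig_zero_or_randers:
  "(\<forall>s\<in>J. sig s = 0) \<or> (\<exists>k. \<forall>s\<in>J. r s * (1 + k * s\<^sup>2) = k)"
proof (cases "\<forall>s\<in>J. \<exists>q\<in>BB. s\<^sup>2 < q \<and> D q \<noteq> 0")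
  case True
  then show ?thesis using generic_case by blast
next
  case False
  then obtain s where s: "s \<in> J" "\<And>q. q \<in> BB \<Longrightarrow> s\<^sup>2 < q \<Longrightarrow> D q = 0" by blast
  define R where "R = {q\<in>BB. s\<^sup>2 < q}"
  have fin: "finite R" using s(2) by (intro finite_subset[OF _ finite_D_roots]) (auto simp: R_def)
  have ne: "R \<noteq> {}" using s(1) by (auto simp: R_def J_def)
  define q where "q = Max R"
  have qR: "q \<in> R" using Max_in[OF fin ne] by (simp add: q_def)
  have q: "q \<in> BB" "s\<^sup>2 < q" "D q = 0" using qR s(2) by (auto simp: R_def)
  have "q > 0" using q(2) by (meson le_less_trans zero_le_power2)
  have max: "p \<le> q" if "p \<in> BB" for p
  proof (cases "s\<^sup>2 < p")
    case True
    then show ?thesis using Max_ge[OF fin, of p] that by (auto simp: R_def q_def)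
  qed (use q in linarith)
  obtain \<mu> where mu: "\<And>s. s\<^sup>2 < q \<Longrightarrow> E s q \<mu> = 0" using E0[OF q(1)] by blast
  have "\<exists>k. \<forall>s. s\<^sup>2 \<le> q \<longrightarrow> r s * (1 + k * s\<^sup>2) = k"
    by (rule degenerate_case[OF k q(3) \<open>q > 0\<close> d[OF q(1)] N_pos[OF q(1)] mu])
  then obtain k where "\<And>s. s\<^sup>2 \<le> q \<Longrightarrow> r s * (1 + k * s\<^sup>2) = k" by blast
  moreover have "p\<^sup>2 \<le> q" if "p \<in> J" for p using that max unfolding J_def by force
  ultimately show ?thesis by blast
qed

end

section \<open>Consequences at a point and in a chart\<close>

context ab_chart
begin

lemma exists_unit_vector:
  assumes n: "CARD('n) \<ge> 3" and x: "x \<in> U" and B: "B x > 0" and s: "s\<^sup>2 \<le> B x"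
  shows "\<exists>y. y \<noteq> 0 \<and> ip x y y = 1 \<and> b c x \<bullet> y = s"
proof -
  obtain e where e: "e \<noteq> 0" "b c x \<bullet> e = 0" using exists_orthogonal2[OF n, of "b c x" "b c x"] by blast
  define r where "r = sqrt ((1 - s\<^sup>2 / B x) / ip x e e)"
  have ipe: "ip x e e > 0" by (rule ip_pos[OF x e(1)])
  have "s\<^sup>2 / B x \<le> 1" using B s by (simp add: divide_le_eq_1)
  then have "(1 - s\<^sup>2 / B x) / ip x e e \<ge> 0" using ipe by (intro divide_nonneg_pos) auto
  then have "r * r = (1 - s\<^sup>2 / B x) / ip x e e" unfolding r_def by (rule real_sqrt_mult_self[THEN trans, OF abs_of_nonneg])
  then have r: "r * r * ip x e e = 1 - s\<^sup>2 / B x" using ipe by (simp only:) (rule nonzero_eq_divide_eq[THEN iffD1], auto)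
  define y where "y = (s / B x) *\<^sub>R bs x + r *\<^sub>R e"
  have bb: "b c x \<bullet> bs x = B x" by (simp add: normsq_eq)
  have "ip x y y = (s / B x) * (s / B x) * B x + r * r * ip x e e"
    by (simp add: y_def ip_bs[OF x] bb e(2))
  also have "\<dots> = 1" unfolding r using B by (simp add: power2_eq_square)
  finally have y1: "ip x y y = 1" .
  then have "y \<noteq> 0" by auto
  moreover have "b c x \<bullet> y = s" using B by (simp add: y_def inner_add_right bb e(2))
  ultimately show ?thesis using y1 by blast
qed

lemma s_in_Pdom:
  assumes n: "CARD('n) \<ge> 3" and x: "x \<in> U" and s: "s\<^sup>2 \<le> B x"
  shows "(s, B x) \<in> Pdom"
proof (cases "B x > 0")
  case True
  then obtain y where "y \<noteq> 0" "ip x y y = 1" "b c x \<bullet> y = s"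
    using exists_unit_vector[OF n x _ s] by blast
  then show ?thesis using in_Pdom[OF n x, of y] by (simp add: sv_def)
next
  case False
  then have B0: "B x = 0" using B_nonneg[OF x] by simp
  then have "s = 0" using s by simp
  moreover have "sv x (axis undefined 1) = 0" using B_eq_0[OF x B0] by (simp add: sv_def)
  ultimately show ?thesis using in_Pdom[OF n x, of "axis undefined 1"] by (simp add: axis_eq_0_iff)
qed

lemma local_equation:
  assumes n: "CARD('n) \<ge> 3" and x: "x \<in> U" and t0: "t x \<noteq> 0" and s: "s\<^sup>2 < B x"
    and sc: "\<And>y i k. y \<noteq> 0 \<Longrightarrow> riemann_curv F i k x y = K y * (F x y)\<^sup>2 * (kron i k - y $ i / F x y * dy k F x y)"
    and cu: "\<And>y i k. y \<noteq> 0 \<Longrightarrow> riemann_curv (alpha a c) i k x y =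
        l x * ((alpha a c x y)\<^sup>2 * kron i k - y $ i * y_low a c x y k)
        + eta_coeff k1 k2 k3 (B x) (t x) (l x) * ((beta b c x y)\<^sup>2 * kron i k + (alpha a c x y)\<^sup>2 * b_up a b c x i * b c x $ k
           - beta b c x y * b_up a b c x i * y_low a c x y k
           - beta b c x y * b c x $ k * y $ i)"
  shows "E s (B x) (l x / (t x)\<^sup>2) = 0"
proof -
  have "B x > 0" using s by (meson le_less_trans zero_le_power2)
  then obtain y where y: "y \<noteq> 0" "ip x y y = 1" "b c x \<bullet> y = s"
    using exists_unit_vector[OF n x, of s] s by auto
  obtain e' where e': "e' \<noteq> 0" "(a c x *v y) \<bullet> e' = 0" "b c x \<bullet> e' = 0"
    using exists_orthogonal2[OF n] by blast
  define e where "e = sqrt ((B x - s\<^sup>2) / ip x e' e') *\<^sub>R e'"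
  have ipe: "ip x e' e' > 0" by (rule ip_pos[OF x e'(1)])
  have "ip x e' y = 0" using e'(2) by (simp add: ip_def inner_commute)
  then have "ip x y e = 0" using ip_sym[OF x, of y e'] by (simp add: e_def)
  moreover have "b c x \<bullet> e = 0" using e' by (simp add: e_def)
  moreover have "ip x e e = B x - (b c x \<bullet> y)\<^sup>2"
    using ipe s by (simp add: e_def y(3) mult.assoc[symmetric])
  ultimately have "E (b c x \<bullet> y) (B x) (l x / (t x)\<^sup>2) = 0"
    by (rule equation_at_unit[OF n x y(1,2) _ _ _ sc[OF y(1)] cu[OF y(1)] t0]) (use s y in auto)
  then show ?thesis by (simp add: y)
qed

text \<open>If \<open>\<beta> = 0\<close> near \<open>x\<close> then \<open>0 = b\<^bsub>i|j\<^esub> = \<tau> a\<^sub>i\<^sub>j\<close> at \<open>x\<close>.\<close>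

lemma t_eq_0:
  assumes x: "x \<in> V" and V: "open V" "V \<subseteq> U" and b0: "\<And>z. z \<in> V \<Longrightarrow> b c z = 0"
  shows "t x = 0"
proof -
  have xU: "x \<in> U" using x V by blast
  have "(b c has_derivative (\<lambda>_. 0)) (at x)"
    by (rule has_derivative_transform_within_open[OF has_derivative_const V(1) x]) (simp add: b0)
  then have db: "db x w = 0" for w
    using has_derivative_unique[OF has_derivative_b[OF xU]] by metis
  define e where "e = (axis undefined 1 :: real^'n)"
  have "e \<noteq> 0" by (simp add: e_def axis_eq_0_iff)
  then have "ip x e e > 0" by (rule ip_pos[OF xU])
  moreover have "B x = 0" by (simp add: normsq_eq b0[OF x])
  then have "t x * ip x e e = 0" using cov_b[OF xU, of e e] by (simp add: db b0[OF x])
  ultimately show ?thesis by simp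
qed

lemma continuous_on_t: "continuous_on U t"
proof (rule continuous_at_imp_continuous_on, rule ballI)
  fix x assume "x \<in> U"
  then show "isCont t x" using has_derivative_continuous[OF has_derivative_t] by blast
qed

lemma continuous_on_B: "continuous_on U B"
proof (rule continuous_at_imp_continuous_on, rule ballI)
  fix x assume "x \<in> U"
  then show "isCont B x" using has_derivative_continuous[OF has_derivative_B] by blast
qed

lemma B_locally_constant:
  assumes V: "open V" "V \<subseteq> U" "x \<in> V" and t0: "\<And>z. z \<in> V \<Longrightarrow> t z = 0"
  shows "\<exists>e>0. ball x e \<subseteq> V \<and> (\<forall>z\<in>ball x e. B z = B x)"
proof -
  obtain e where e: "e > 0" "ball x e \<subseteq> V" by (rule openE[OF V(1,3)])
  have "(B has_derivative (\<lambda>_. 0)) (at z within ball x e)" if "z \<in> ball x e" for z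
  proof -
    have z: "z \<in> U" "t z = 0" using that e V t0 by auto
    show ?thesis using has_derivative_at_withinI[OF has_derivative_B[OF z(1)], of "ball x e"] by (simp add: z(2))
  qed
  from has_derivative_zero_constant[OF convex_ball this]
  obtain k where k: "\<And>z. z \<in> ball x e \<Longrightarrow> B z = k" by blast
  have "B z = B x" if "z \<in> ball x e" for z using k[OF that] k[of x] e(1) by simp
  then show ?thesis using e by blast
qed

text \<open>A continuous function with finitely many values on a ball is constant there, but the derivative of
  \<open>b\<^sup>2\<close> in the direction of \<open>b\<close> is \<open>2 \<tau> D(b\<^sup>2) b\<^sup>2\<close>.\<close>

lemma B_infinite_values:
  assumes V: "open V" "V \<subseteq> U" "x \<in> V" and t0: "t x \<noteq> 0" and B: "B x > 0" and D: "D (B x) \<noteq> 0"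
  shows "infinite (B ` V)"
proof
  assume fin: "finite (B ` V)"
  obtain e where e: "e > 0" "ball x e \<subseteq> V" by (rule openE[OF V(1,3)])
  have xU: "x \<in> U" using V by blast
  have "continuous_on (ball x e) B"
    by (rule continuous_on_subset[OF continuous_on_B subset_trans[OF e(2) V(2)]])
  then have "connected (B ` ball x e)" by (rule connected_continuous_image) (rule connected_ball)
  moreover have "finite (B ` ball x e)" by (rule finite_subset[OF image_mono[OF e(2)] fin])
  ultimately have "B ` ball x e = {} \<or> (\<exists>k. B ` ball x e = {k})" by (simp only: connected_finite_iff_sing)
  then obtain k where k: "B ` ball x e \<subseteq> {k}" by (elim disjE exE) simp_all
  have Bz: "B z = B x" if "z \<in> ball x e" for z
  proof -
    have "x \<in> ball x e" using e(1) by simp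
    from subsetD[OF k imageI[OF this]] subsetD[OF k imageI[OF that]] show ?thesis by simp
  qed
  have "(B has_derivative (\<lambda>_. 0)) (at x)"
  proof (rule has_derivative_transform_within_open[OF has_derivative_const open_ball])
    show "x \<in> ball x e" using e(1) by simp
    show "B x = B z" if "z \<in> ball x e" for z by (rule Bz[OF that, symmetric])
  qed
  from has_derivative_unique[OF has_derivative_B[OF xU] this]
  have "2 * t x * (u x + v x * B x) * (b c x \<bullet> bs x) = 0" by (rule fun_cong)
  moreover have "u x + v x * B x = D (B x)" by (simp add: D_def algebra_simps power2_eq_square)
  ultimately have "2 * t x * D (B x) * B x = 0" by (simp only: normsq_eq[symmetric])
  then show False using t0 B D by simp
qed

end

section \<open>The manifold\<close>

text \<open>Functions of Randers type appear as one of two alternatives and are excluded only in the end; so the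
  locale admits them.\<close>

locale ab_manifold =
  fixes M :: "'m topology" and A :: "('m, 'n::finite) chart set"
    and a :: "('m, 'n) form2" and b :: "('m, 'n) form1"
    and \<phi> :: "real \<Rightarrow> real" and bo :: ereal
    and k1 k2 k3 :: real and lam tau :: "'m \<Rightarrow> real"
  assumes dim: "CARD('n) \<ge> 3"
    and manifold: "smooth_manifold M A" "connected_space M"
    and ab: "alpha_beta_metric A a b \<phi> bo"
    and phi0: "\<phi> 0 = 1"
    and not_parallel: "\<not> parallel A a b"
    and scalar: "scalar_flag_curvature A (ab_metric a b \<phi>)"
    and k: "k2 \<noteq> k1 * k3"
    and smooth_tau: "smooth_function A tau"
    and cov: "\<And>c x i j. c \<in> A \<Longrightarrow> x \<in> chart_image c \<Longrightarrow>
        cov_deriv a b c i j x =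
        tau (chart_inv c x) *
          ((1 + k1 * normsq a b c x) * a c x $ i $ j
           + (k2 * normsq a b c x + k3) * b c x $ i * b c x $ j)"
    and curv: "\<And>c x y i k. c \<in> A \<Longrightarrow> x \<in> chart_image c \<Longrightarrow> y \<noteq> 0 \<Longrightarrow>
        riemann_curv (alpha a c) i k x y =
        lam (chart_inv c x) * ((alpha a c x y)\<^sup>2 * kron i k - y $ i * y_low a c x y k)
        + eta_coeff k1 k2 k3 (normsq a b c x) (tau (chart_inv c x)) (lam (chart_inv c x)) *
          ((beta b c x y)\<^sup>2 * kron i k + (alpha a c x y)\<^sup>2 * b_up a b c x i * b c x $ k
           - beta b c x y * b_up a b c x i * y_low a c x y k
           - beta b c x y * b c x $ k * y $ i)"
    and dtau: "\<And>c x i. c \<in> A \<Longrightarrow> x \<in> chart_image c \<Longrightarrow>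
        pd i (tau \<circ> chart_inv c) x =
        q_coeff k1 k3 (normsq a b c x) (tau (chart_inv c x)) (lam (chart_inv c x)) * b c x $ i"
begin

definition I :: "real set" where "I = {s. ereal \<bar>s\<bar> < bo}"

lemma open_I: "open I"
proof -
  have "continuous_on UNIV (\<lambda>s::real. ereal \<bar>s\<bar>)" by (intro continuous_intros)
  then have "open ((\<lambda>s::real. ereal \<bar>s\<bar>) -` {..<bo})" by (rule open_vimage[OF open_lessThan])
  then show ?thesis by (simp add: I_def vimage_def)
qed

lemma chart:
  assumes c: "c \<in> A"
  shows "ab_chart a c (chart_image c) b \<phi> I k1 k2 k3 (tau \<circ> chart_inv c) (lam \<circ> chart_inv c)"
proof
  have rm: "riemannian_metric A a" and of: "one_form A b" and sp: "smooth_on {s. ereal \<bar>s\<bar> < bo} \<phi>"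
    and pp: "\<forall>s. ereal \<bar>s\<bar> < bo \<longrightarrow> \<phi> s > 0"
    and reg: "\<forall>c\<in>A. \<forall>x\<in>chart_image c. ereal (sqrt (normsq a b c x)) < bo \<and>
        (\<forall>s. \<bar>s\<bar> \<le> sqrt (normsq a b c x) \<longrightarrow>
           \<phi> s - s * deriv \<phi> s + (normsq a b c x - s\<^sup>2) * deriv (deriv \<phi>) s > 0)"
    and fm: "finsler_metric A (ab_metric a b \<phi>)"
    using ab unfolding alpha_beta_metric_def by blast+
  show "open (chart_image c)" using manifold(1) c unfolding smooth_manifold_def by blast
  show "smooth_on (chart_image c) (a c)" using rm c unfolding riemannian_metric_def by blast
  show "smooth_on (chart_image c) (b c)" using of c unfolding one_form_def by blast
  show "open I" by (rule open_I)
  show "smooth_on I \<phi>" using sp by (simp add: I_def)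
  fix x assume x: "x \<in> chart_image c"
  show "transpose (a c x) = a c x" using rm c x unfolding riemannian_metric_def by blast
  show "0 < y \<bullet> (a c x *v y)" if "y \<noteq> 0" for y using rm c x that unfolding riemannian_metric_def by blast
  have r: "ereal (sqrt (normsq a b c x)) < bo" using reg c x by blast
  show "s \<in> I" if "\<bar>s\<bar> \<le> sqrt (normsq a b c x)" for s
    using le_less_trans[OF ereal_less_eq(3)[THEN iffD2, OF that] r] by (simp add: I_def)
  show "0 < \<phi> s - s * deriv \<phi> s + (normsq a b c x - s\<^sup>2) * deriv (deriv \<phi>) s"
    if "\<bar>s\<bar> \<le> sqrt (normsq a b c x)" for s using reg c x that by blast
  show "0 < v \<bullet> (fund_tensor (ab_metric a b \<phi> c) x y *v v)" if "y \<noteq> 0" "v \<noteq> 0" for y v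
    using fm c x that unfolding finsler_metric_def by blast
  show "cov_deriv a b c i j x = (tau \<circ> chart_inv c) x * ((1 + k1 * normsq a b c x) * a c x $ i $ j
           + (k2 * normsq a b c x + k3) * b c x $ i * b c x $ j)" for i j
    using cov[OF c x] by simp
  show "(tau \<circ> chart_inv c) differentiable (at x)"
    using smooth_tau c x smooth_on_differentiable unfolding smooth_function_def by blast
  show "pd i (tau \<circ> chart_inv c) x = q_coeff k1 k3 (normsq a b c x) ((tau \<circ> chart_inv c) x) ((lam \<circ> chart_inv c) x) * b c x $ i" for i
    using dtau[OF c x] by simp
next
  show "0 < \<phi> s" if "s \<in> I" for s using ab that unfolding alpha_beta_metric_def I_def by blast
qed

lemma chart_inj: assumes c: "c \<in> A" shows "inj_on (snd c) (fst c)"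
proof -
  have "openin M (fst c)" and h: "homeomorphic_map (subtopology M (fst c)) (top_of_set (chart_image c)) (snd c)"
    using manifold(1) c unfolding smooth_manifold_def by blast+
  then have "topspace (subtopology M (fst c)) = fst c" by (simp add: openin_subset Int_absorb1)
  then show ?thesis using homeomorphic_imp_injective_map[OF h] by simp
qed

lemma chart_inv_eq: "c \<in> A \<Longrightarrow> p \<in> fst c \<Longrightarrow> chart_inv c (snd c p) = p"
  unfolding chart_inv_def by (rule inv_into_f_f[OF chart_inj])

lemma in_chart_image: "p \<in> fst c \<Longrightarrow> snd c p \<in> chart_image c"
  by (simp add: chart_image_def)

lemma chart_imageE: 
  assumes "c \<in> A" "x \<in> chart_image c" obtains p where "p \<in> fst c" "x = snd c p" "chart_inv c x = p"
  using assms chart_inv_eq unfolding chart_image_def by blast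

lemma openin_chart_preimage:
  assumes c: "c \<in> A" and V: "open V"
  shows "openin M {p \<in> fst c. snd c p \<in> V}"
proof -
  have o: "openin M (fst c)" and h: "homeomorphic_map (subtopology M (fst c)) (top_of_set (chart_image c)) (snd c)"
    using manifold(1) c unfolding smooth_manifold_def by blast+
  have t: "topspace (subtopology M (fst c)) = fst c" using o by (simp add: openin_subset Int_absorb1)
  have "continuous_map (subtopology M (fst c)) (top_of_set (chart_image c)) (snd c)"
    by (rule homeomorphic_imp_continuous_map[OF h])
  moreover have "openin (top_of_set (chart_image c)) (chart_image c \<inter> V)" using V by (simp add: openin_open_Int)
  ultimately have "openin (subtopology M (fst c)) {p \<in> topspace (subtopology M (fst c)). snd c p \<in> chart_image c \<inter> V}"
    by (rule openin_continuous_map_preimage)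
  moreover have "{p \<in> topspace (subtopology M (fst c)). snd c p \<in> chart_image c \<inter> V} = {p \<in> fst c. snd c p \<in> V}"
    unfolding t by (auto simp: in_chart_image)
  ultimately show ?thesis using openin_open_subtopology[OF o] by simp
qed

text \<open>The square of \<open>\<beta>/\<alpha>\<close> takes the value \<open>b\<^sup>2\<close> at the vector dual to \<open>\<beta>\<close>, and nowhere a larger one. Since
  \<open>\<beta>\<close> and \<open>\<alpha>\<close> transform with the derivative of the transition map, this bounds \<open>b\<^sup>2\<close> in one chart by
  \<open>b\<^sup>2\<close> in the other.\<close>

lemma normsq_le:
  assumes c: "c \<in> A" "d \<in> A" and p: "p \<in> fst c" "p \<in> fst d"
  shows "normsq a b c (snd c p) \<le> normsq a b d (snd d p)"
proof -
  interpret c: ab_chart a c "chart_image c" b \<phi> I k1 k2 k3 "tau \<circ> chart_inv c" "lam \<circ> chart_inv c" by (rule chart[OF c(1)])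
  interpret d: ab_chart a d "chart_image d" b \<phi> I k1 k2 k3 "tau \<circ> chart_inv d" "lam \<circ> chart_inv d" by (rule chart[OF c(2)])
  define x x' where "x = snd c p" and "x' = snd d p"
  have xx: "x \<in> chart_image c" "x' \<in> chart_image d" using p by (auto simp: x_def x'_def in_chart_image)
  have ov: "x \<in> overlap c d" using p by (auto simp: overlap_def x_def)
  have tr: "transition c d x = x'" by (simp add: transition_def x_def x'_def chart_inv_eq[OF c(1) p(1)])
  define L where "L = transition_deriv c d x"
  have of: "\<forall>u. b c x \<bullet> u = b d x' \<bullet> L u"
    using ab c ov tr unfolding alpha_beta_metric_def one_form_def L_def by metis
  have rm: "\<forall>u v. u \<bullet> (a c x *v v) = L u \<bullet> (a d x' *v L v)"
    using ab c ov tr unfolding alpha_beta_metric_def riemannian_metric_def L_def by metis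
  have bb: "b c x \<bullet> c.bs x = normsq a b c x" by (simp add: c.normsq_eq)
  have "c.ip x (c.bs x) (c.bs x) = normsq a b c x" by (simp add: c.ip_bs[OF xx(1)] bb)
  then have ip: "d.ip x' (L (c.bs x)) (L (c.bs x)) = normsq a b c x"
    using rm by (simp add: c.ip_def d.ip_def)
  have "(b d x' \<bullet> L (c.bs x))\<^sup>2 \<le> normsq a b d x' * normsq a b c x"
    using d.beta_sq_le[OF xx(2), of "L (c.bs x)"] by (simp add: ip)
  then have le: "normsq a b c x * normsq a b c x \<le> normsq a b d x' * normsq a b c x"
    using of bb by (simp add: power2_eq_square)
  show ?thesis
  proof (cases "normsq a b c x = 0")
    case True
    then show ?thesis using d.B_nonneg[OF xx(2)] by (simp add: x_def x'_def)
  next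
    case False
    then have "normsq a b c x > 0" using c.B_nonneg[OF xx(1)] by simp
    then show ?thesis using le by (simp add: x_def x'_def)
  qed
qed

lemma normsq_invariant:
  "c \<in> A \<Longrightarrow> d \<in> A \<Longrightarrow> p \<in> fst c \<Longrightarrow> p \<in> fst d \<Longrightarrow> normsq a b c (snd c p) = normsq a b d (snd d p)"
  using normsq_le by (intro antisym) auto

definition BB :: "real set" where
  "BB = {normsq a b c x | c x. c \<in> A \<and> x \<in> chart_image c \<and> tau (chart_inv c x) \<noteq> 0}"

lemma BB_I: "c \<in> A \<Longrightarrow> x \<in> chart_image c \<Longrightarrow> tau (chart_inv c x) \<noteq> 0 \<Longrightarrow> normsq a b c x \<in> BB"
  unfolding BB_def by blast

lemma chart_at: "p \<in> topspace M \<Longrightarrow> \<exists>c\<in>A. p \<in> fst c"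
  using manifold(1) unfolding smooth_manifold_def by auto

lemma fst_topspace: "c \<in> A \<Longrightarrow> fst c \<subseteq> topspace M"
  using manifold(1) unfolding smooth_manifold_def by auto

text \<open>Otherwise the set \<open>S\<close> where \<open>b\<^sup>2\<close> has the value in question is closed and also open, since near its
  points \<open>b\<^sup>2\<close> is still too large for \<open>\<tau> \<noteq> 0\<close> and hence locally constant. Then \<open>S\<close> is the whole
  manifold, and \<open>\<tau> = 0\<close> makes \<open>\<beta>\<close> parallel.\<close>

lemma BB_cofinal:
  assumes c: "c \<in> A" and x: "x \<in> chart_image c" and e: "e > 0"
  shows "\<exists>q\<in>BB. q > normsq a b c x - e"
proof (rule ccontr)
  define v where "v = normsq a b c x"
  assume "\<not> (\<exists>q\<in>BB. q > normsq a b c x - e)"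
  then have small: "q \<le> v - e" if "q \<in> BB" for q using that by (auto simp: v_def not_less)
  define S where "S = {p \<in> topspace M. \<exists>d\<in>A. p \<in> fst d \<and> normsq a b d (snd d p) = v}"
  have "openin M S"
    unfolding openin_subopen[of M S]
  proof
    fix p assume "p \<in> S"
    then obtain d where d: "d \<in> A" "p \<in> fst d" "normsq a b d (snd d p) = v" by (auto simp: S_def)
    interpret d: ab_chart a d "chart_image d" b \<phi> I k1 k2 k3 "tau \<circ> chart_inv d" "lam \<circ> chart_inv d" by (rule chart[OF d(1)])
    define V where "V = chart_image d \<inter> normsq a b d -` {v - e<..}"
    have V: "open V" unfolding V_def by (rule continuous_open_preimage[OF d.continuous_on_B d.open_U open_greaterThan])
    have pV: "snd d p \<in> V" using d e by (simp add: V_def in_chart_image)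
    have t0: "(tau \<circ> chart_inv d) z = 0" if "z \<in> V" for z
    proof (rule ccontr)
      assume "(tau \<circ> chart_inv d) z \<noteq> 0"
      then have "normsq a b d z \<in> BB" using that d(1) by (intro BB_I) (auto simp: V_def)
      then show False using small that by (fastforce simp: V_def)
    qed
    obtain r where r: "r > 0" "ball (snd d p) r \<subseteq> V" "\<forall>z\<in>ball (snd d p) r. normsq a b d z = normsq a b d (snd d p)"
      using d.B_locally_constant[OF V _ pV t0] by (auto simp: V_def)
    define T where "T = {p' \<in> fst d. snd d p' \<in> ball (snd d p) r}"
    have "openin M T" unfolding T_def by (rule openin_chart_preimage[OF d(1) open_ball])
    moreover have "p \<in> T" using d r(1) by (simp add: T_def)
    moreover have "T \<subseteq> S"
    proof
      fix p' assume p': "p' \<in> T"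
      have "normsq a b d (snd d p') = v" using p' r(3) d(3) by (simp add: T_def)
      then show "p' \<in> S" using p' d(1) fst_topspace[OF d(1)] unfolding S_def T_def by blast
    qed
    ultimately show "\<exists>T. openin M T \<and> p \<in> T \<and> T \<subseteq> S" by blast
  qed
  moreover have "openin M (topspace M - S)"
    unfolding openin_subopen[of M "topspace M - S"]
  proof
    fix p assume p: "p \<in> topspace M - S"
    then obtain d where d: "d \<in> A" "p \<in> fst d" using chart_at by blast
    interpret d: ab_chart a d "chart_image d" b \<phi> I k1 k2 k3 "tau \<circ> chart_inv d" "lam \<circ> chart_inv d" by (rule chart[OF d(1)])
    have nv: "normsq a b d (snd d p) \<noteq> v" using p d by (auto simp: S_def)
    define V where "V = chart_image d \<inter> normsq a b d -` (- {v})"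
    have V: "open V" unfolding V_def by (rule continuous_open_preimage[OF d.continuous_on_B d.open_U]) (rule open_Compl, simp)
    define T where "T = {p' \<in> fst d. snd d p' \<in> V}"
    have "openin M T" unfolding T_def by (rule openin_chart_preimage[OF d(1) V])
    moreover have "p \<in> T" using d nv by (simp add: T_def V_def in_chart_image)
    moreover have "T \<subseteq> topspace M - S"
    proof
      fix p' assume p': "p' \<in> T"
      then have p'd: "p' \<in> fst d" "normsq a b d (snd d p') \<noteq> v" by (auto simp: T_def V_def)
      have "p' \<notin> S"
      proof
        assume "p' \<in> S"
        then obtain d' where "d' \<in> A" "p' \<in> fst d'" "normsq a b d' (snd d' p') = v" by (auto simp: S_def)
        then show False using normsq_invariant[OF d(1) \<open>d' \<in> A\<close> p'd(1)] p'd(2) by simp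
      qed
      then show "p' \<in> topspace M - S" using p'd fst_topspace[OF d(1)] by blast
    qed
    ultimately show "\<exists>T. openin M T \<and> p \<in> T \<and> T \<subseteq> topspace M - S" by blast
  qed
  then have "closedin M S" by (simp add: closedin_def S_def)
  ultimately have "S = {} \<or> S = topspace M" using manifold(2) unfolding connected_space_clopen_in by blast
  moreover have "S \<noteq> {}"
  proof -
    obtain p where "p \<in> fst c" "x = snd c p" by (rule chart_imageE[OF c x])
    then show ?thesis using c fst_topspace[OF c] unfolding S_def v_def by blast
  qed
  ultimately have S: "S = topspace M" by blast
  have "parallel A a b"
    unfolding parallel_def
  proof (intro ballI allI)
    fix d z i j assume d: "d \<in> A" "z \<in> chart_image d"
    obtain p where p: "p \<in> fst d" "z = snd d p" by (rule chart_imageE[OF d])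
    then have "p \<in> S" using S fst_topspace[OF d(1)] by blast
    then obtain d' where d': "d' \<in> A" "p \<in> fst d'" "normsq a b d' (snd d' p) = v" by (auto simp: S_def)
    have "normsq a b d z = v" using normsq_invariant[OF d(1) d'(1) p(1) d'(2)] p(2) d'(3) by simp
    then have "tau (chart_inv d z) = 0" using BB_I[OF d] small[of v] e by fastforce
    then show "cov_deriv a b d i j z = 0" using cov[OF d] by simp
  qed
  then show False using not_parallel by blast
qed

lemma BB_positive: "\<exists>q\<in>BB. q > 0"
proof (rule ccontr)
  assume "\<not> (\<exists>q\<in>BB. q > 0)"
  then have neg: "q \<le> 0" if "q \<in> BB" for q using that by (auto simp: not_less)
  obtain c x i j where c: "c \<in> A" and x: "x \<in> chart_image c" and "cov_deriv a b c i j x \<noteq> 0"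
    using not_parallel unfolding parallel_def by blast
  then have t: "(tau \<circ> chart_inv c) x \<noteq> 0" using cov by auto
  interpret c: ab_chart a c "chart_image c" b \<phi> I k1 k2 k3 "tau \<circ> chart_inv c" "lam \<circ> chart_inv c" by (rule chart[OF c])
  define V where "V = chart_image c \<inter> (tau \<circ> chart_inv c) -` (- {0})"
  have V: "open V" unfolding V_def by (rule continuous_open_preimage[OF c.continuous_on_t c.open_U]) (rule open_Compl, simp)
  have "b c z = 0" if "z \<in> V" for z
  proof -
    have z: "z \<in> chart_image c" "tau (chart_inv c z) \<noteq> 0" using that by (auto simp: V_def)
    have "normsq a b c z = 0" using neg[OF BB_I[OF c z]] c.B_nonneg[OF z(1)] by simp
    then show ?thesis by (rule c.B_eq_0[OF z(1)])
  qed
  then have "(tau \<circ> chart_inv c) x = 0"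
    by (intro c.t_eq_0[of x V] V) (use x t in \<open>auto simp: V_def\<close>)
  then show False using t by simp
qed

abbreviation rho where "rho \<equiv> ab_chart.rho \<phi>"

sublocale R: riccati k1 k2 k3 rho "deriv rho" "deriv (deriv rho)" .

lemma BB_infinite:
  assumes q: "q \<in> BB" "q > 0" "R.D q \<noteq> 0" and e: "e > 0"
  shows "infinite (BB \<inter> {q - e<..<q + e})"
proof -
  obtain c x where c: "c \<in> A" and x: "x \<in> chart_image c" and t: "tau (chart_inv c x) \<noteq> 0" and qx: "q = normsq a b c x"
    using q(1) by (auto simp: BB_def)
  interpret c: ab_chart a c "chart_image c" b \<phi> I k1 k2 k3 "tau \<circ> chart_inv c" "lam \<circ> chart_inv c" by (rule chart[OF c])
  define V where "V = (chart_image c \<inter> (tau \<circ> chart_inv c) -` (- {0})) \<inter> (chart_image c \<inter> normsq a b c -` {q - e<..<q + e})"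
  have V: "open V" unfolding V_def
    by (intro open_Int continuous_open_preimage[OF c.continuous_on_t c.open_U] continuous_open_preimage[OF c.continuous_on_B c.open_U]) auto
  have "infinite (normsq a b c ` V)"
    by (rule c.B_infinite_values[OF V]) (use x t qx q e in \<open>auto simp: V_def\<close>)
  moreover have "normsq a b c ` V \<subseteq> BB \<inter> {q - e<..<q + e}"
    using c by (auto simp: V_def intro: BB_I)
  ultimately show ?thesis using infinite_super by blast
qed

lemma point_props:
  assumes c: "c \<in> A" and x: "x \<in> chart_image c" and s: "s\<^sup>2 \<le> normsq a b c x"
  shows "s \<in> I" "\<phi> s - s * deriv \<phi> s > 0" "R.N s (normsq a b c x) > 0"
    "(rho has_real_derivative deriv rho s) (at s)" "(deriv rho has_real_derivative deriv (deriv rho) s) (at s)"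
    "isCont (deriv (deriv rho)) s"
proof -
  interpret c: ab_chart a c "chart_image c" b \<phi> I k1 k2 k3 "tau \<circ> chart_inv c" "lam \<circ> chart_inv c" by (rule chart[OF c])
  have P: "(s, normsq a b c x) \<in> c.Pdom" by (rule c.s_in_Pdom[OF dim x s])
  show I: "s \<in> I" and g: "\<phi> s - s * deriv \<phi> s > 0" using P by (auto simp: c.Pdom_def)
  show "R.N s (normsq a b c x) > 0" by (rule c.N_pos[OF P])
  show "(rho has_real_derivative deriv rho s) (at s)" "(deriv rho has_real_derivative deriv (deriv rho) s) (at s)"
    "isCont (deriv (deriv rho)) s" by (rule c.rho_derivs[OF I g])+
qed

lemma BB_E:
  assumes "q \<in> BB" obtains c x where "c \<in> A" "x \<in> chart_image c" "tau (chart_inv c x) \<noteq> 0" "q = normsq a b c x"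
  using assms by (auto simp: BB_def)

lemma riccati_equation:
  assumes "q \<in> BB" shows "\<exists>\<mu>. \<forall>s. s\<^sup>2 < q \<longrightarrow> R.E s q \<mu> = 0"
proof -
  obtain c x where c: "c \<in> A" and x: "x \<in> chart_image c" and t: "tau (chart_inv c x) \<noteq> 0" and qx: "q = normsq a b c x"
    by (rule BB_E[OF assms])
  interpret c: ab_chart a c "chart_image c" b \<phi> I k1 k2 k3 "tau \<circ> chart_inv c" "lam \<circ> chart_inv c" by (rule chart[OF c])
  obtain K where K: "\<And>y i k. y \<noteq> 0 \<Longrightarrow> riemann_curv (ab_metric a b \<phi> c) i k x y =
           K y * (ab_metric a b \<phi> c x y)\<^sup>2 * (kron i k - y $ i / ab_metric a b \<phi> c x y * dy k (ab_metric a b \<phi> c) x y)"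
    using scalar c x unfolding scalar_flag_curvature_def by metis
  have "R.E s q ((lam \<circ> chart_inv c) x / ((tau \<circ> chart_inv c) x)\<^sup>2) = 0" if "s\<^sup>2 < q" for s
    unfolding qx
  proof (rule c.local_equation[OF dim x _ _ K])
    show "(tau \<circ> chart_inv c) x \<noteq> 0" using t by simp
    show "s\<^sup>2 < normsq a b c x" using that qx by simp
  qed (use curv[OF c x] in simp_all)
  then show ?thesis by blast
qed

sublocale riccati_family k1 k2 k3 rho "deriv rho" "deriv (deriv rho)" BB
proof
  show "k2 \<noteq> k1 * k3" by (rule k)
  show "\<exists>q\<in>BB. 0 < q" by (rule BB_positive)
  show "infinite (BB \<inter> {q - e<..<q + e})" if "q \<in> BB" "0 < q" "R.D q \<noteq> 0" "0 < e" for q e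
    by (rule BB_infinite[OF that])
  show "\<exists>\<mu>. \<forall>s. s\<^sup>2 < q \<longrightarrow> R.E s q \<mu> = 0" if "q \<in> BB" for q by (rule riccati_equation[OF that])
  fix q s assume q: "q \<in> BB" and s: "s\<^sup>2 \<le> q"
  obtain c x where cx: "c \<in> A" "x \<in> chart_image c" and qx: "q = normsq a b c x" by (rule BB_E[OF q])
  note p = point_props[OF cx s[unfolded qx]]
  show "(rho has_real_derivative deriv rho s) (at s)" "(deriv rho has_real_derivative deriv (deriv rho) s) (at s)"
    "isCont (deriv (deriv rho)) s" by (rule p)+
  show "R.N s q > 0" unfolding qx by (rule p)
qed

end

section \<open>Functions of Randers type and the conclusion\<close>

text \<open>With \<open>w = sqrt (1 + k s\<^sup>2)\<close>, the functions \<open>(\<phi> - s \<phi>') w\<close> and \<open>\<phi>' - k s/w\<close> have derivative \<open>0\<close>. They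
  determine \<open>\<phi>\<close>.\<close>

lemma randers_solution:
  fixes \<phi> \<phi>1 \<phi>2 :: "real \<Rightarrow> real"
  assumes s: "\<And>p. \<bar>p\<bar> \<le> \<bar>s\<bar> \<Longrightarrow> (\<phi> has_real_derivative \<phi>1 p) (at p)"
      "\<And>p. \<bar>p\<bar> \<le> \<bar>s\<bar> \<Longrightarrow> (\<phi>1 has_real_derivative \<phi>2 p) (at p)"
    and pos: "\<And>p. \<bar>p\<bar> \<le> \<bar>s\<bar> \<Longrightarrow> 1 + k * p\<^sup>2 > 0"
    and eq: "\<And>p. \<bar>p\<bar> \<le> \<bar>s\<bar> \<Longrightarrow> \<phi>2 p * (1 + k * p\<^sup>2) = k * (\<phi> p - p * \<phi>1 p)"
    and phi0: "\<phi> 0 = 1"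
  shows "\<phi> s = \<phi>1 0 * s + sqrt (1 + k * s\<^sup>2)"
proof -
  define S where "S = {- \<bar>s\<bar>..\<bar>s\<bar>}"
  have S: "convex S" "s \<in> S" "0 \<in> S" by (auto simp: S_def)
  define w where "w p = sqrt (1 + k * p\<^sup>2)" for p
  have w: "w p > 0" "w p * w p = 1 + k * p\<^sup>2" if "p \<in> S" for p
  proof -
    have "1 + k * p\<^sup>2 > 0" using that by (intro pos) (auto simp: S_def)
    then show "w p > 0" "w p * w p = 1 + k * p\<^sup>2" by (auto simp: w_def)
  qed
  have wd: "(w has_real_derivative k * p / w p) (at p)" if "p \<in> S" for p
  proof -
    have "1 + k * p\<^sup>2 > 0" using pos[of p] that by (auto simp: S_def)
    then show ?thesis unfolding w_def[abs_def]
      by (auto intro!: derivative_eq_intros simp: field_simps)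
  qed
  have pd: "(\<phi> has_real_derivative \<phi>1 p) (at p)" "(\<phi>1 has_real_derivative \<phi>2 p) (at p)"
    "\<phi>2 p * (w p * w p) = k * (\<phi> p - p * \<phi>1 p)" if "p \<in> S" for p
    using s eq[of p] w(2)[OF that] that by (auto simp: S_def)
  have "((\<lambda>p. (\<phi> p - p * \<phi>1 p) * w p) has_real_derivative 0) (at p within S)" if p: "p \<in> S" for p
  proof -
    have "((\<lambda>p. (\<phi> p - p * \<phi>1 p) * w p) has_real_derivative
        (\<phi>1 p - (1 * \<phi>1 p + \<phi>2 p * p)) * w p + (k * p / w p) * (\<phi> p - p * \<phi>1 p)) (at p)"
      by (intro DERIV_mult DERIV_diff DERIV_ident pd[OF p] wd[OF p])
    moreover have "(\<phi>1 p - (1 * \<phi>1 p + \<phi>2 p * p)) * w p + (k * p / w p) * (\<phi> p - p * \<phi>1 p) = 0"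
    proof -
      have "(k * p / w p) * (\<phi> p - p * \<phi>1 p) = (p / w p) * (k * (\<phi> p - p * \<phi>1 p))" by simp
      also have "\<dots> = p * \<phi>2 p * w p" unfolding pd(3)[OF p, symmetric] using w(1)[OF p] by simp
      finally show ?thesis by (simp add: algebra_simps)
    qed
    ultimately show ?thesis using has_field_derivative_at_within by force
  qed
  from has_field_derivative_zero_constant[OF S(1) this]
  obtain C where C: "\<And>p. p \<in> S \<Longrightarrow> (\<phi> p - p * \<phi>1 p) * w p = C" by blast
  have "C = 1" using C[OF S(3)] by (simp add: phi0 w_def)
  then have g: "\<phi> p - p * \<phi>1 p = 1 / w p" if "p \<in> S" for p
    using C[OF that] w(1)[OF that] by (simp add: field_simps)
  have "((\<lambda>p. \<phi>1 p - k * p / w p) has_real_derivative 0) (at p within S)" if p: "p \<in> S" for p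
  proof -
    have nz: "w p \<noteq> 0" using w(1)[OF p] by simp
    have "((\<lambda>p. \<phi>1 p - k * p / w p) has_real_derivative
        \<phi>2 p - ((k * 1) * w p - k * p * (k * p / w p)) / (w p * w p)) (at p)"
      by (intro DERIV_divide DERIV_diff DERIV_cmult DERIV_ident pd[OF p] wd[OF p] nz)
    moreover have "\<phi>2 p - ((k * 1) * w p - k * p * (k * p / w p)) / (w p * w p) = 0"
    proof -
      have "w p * (\<phi>2 p * (w p * w p)) = k" using pd(3)[OF p] g[OF p] nz by simp
      moreover have "w p * ((k * 1) * w p - k * p * (k * p / w p)) = k * (w p * w p - k * p\<^sup>2)"
        using nz by (simp add: field_simps power2_eq_square)
      ultimately have "w p * (\<phi>2 p * (w p * w p)) = w p * ((k * 1) * w p - k * p * (k * p / w p))"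
        unfolding w(2)[OF p] by simp
      then have "\<phi>2 p * (w p * w p) = (k * 1) * w p - k * p * (k * p / w p)" using nz by simp
      then show ?thesis using nz by (simp add: nonzero_eq_divide_eq)
    qed
    ultimately show ?thesis using has_field_derivative_at_within by force
  qed
  from has_field_derivative_zero_constant[OF S(1) this]
  obtain C' where C': "\<And>p. p \<in> S \<Longrightarrow> \<phi>1 p - k * p / w p = C'" by blast
  have "C' = \<phi>1 0" using C'[OF S(3)] by simp
  then have "\<phi>1 s = \<phi>1 0 + k * s / w s" using C'[OF S(2)] by simp
  then have "\<phi> s = 1 / w s + s * (\<phi>1 0 + k * s / w s)" using g[OF S(2)] by simp
  also have "\<dots> = \<phi>1 0 * s + (1 + k * s\<^sup>2) / w s" by (simp add: algebra_simps add_divide_distrib power2_eq_square)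
  also have "(1 + k * s\<^sup>2) / w s = w s" using w[OF S(2)] by (simp add: field_simps)
  finally show ?thesis by (simp add: w_def)
qed

context ab_manifold
begin

lemma s_values_E:
  assumes "s \<in> s_values A a b"
  obtains c x where "c \<in> A" "x \<in> chart_image c" "s\<^sup>2 \<le> normsq a b c x"
proof -
  obtain c x y where c: "c \<in> A" "x \<in> chart_image c" "y \<noteq> 0" "s = beta b c x y / alpha a c x y"
    using assms unfolding s_values_def by blast
  interpret c: ab_chart a c "chart_image c" b \<phi> I k1 k2 k3 "tau \<circ> chart_inv c" "lam \<circ> chart_inv c" by (rule chart[OF c(1)])
  have "s = c.sv x y" by (simp add: c(4) c.beta_eq c.alpha_eq c.sv_def)
  then show thesis using that[OF c(1,2)] c.sv_sq_le[OF c(2,3)] by simp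
qed

text \<open>The values of \<open>\<beta>/\<alpha>\<close> of largest modulus may occur only at points with \<open>\<tau> = 0\<close>. They are limits of
  elements of \<open>J\<close>, to which identities extend by continuity.\<close>

lemma scaled_in_J:
  assumes s: "s \<in> s_values A a b" and r: "0 \<le> r" "r < 1"
  shows "r * s \<in> J"
proof (cases "s = 0")
  case True
  then show ?thesis using zero_J by simp
next
  case False
  obtain c x where c: "c \<in> A" "x \<in> chart_image c" "s\<^sup>2 \<le> normsq a b c x" by (rule s_values_E[OF s])
  have "r\<^sup>2 < 1" using r by (simp add: power_less_one_iff)
  then have e: "(1 - r\<^sup>2) * s\<^sup>2 > 0" using False by simp
  obtain q where q: "q \<in> BB" "q > normsq a b c x - (1 - r\<^sup>2) * s\<^sup>2" using BB_cofinal[OF c(1,2) e] by blast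
  have "(r * s)\<^sup>2 = s\<^sup>2 - (1 - r\<^sup>2) * s\<^sup>2" by (simp add: power_mult_distrib algebra_simps)
  then have "(r * s)\<^sup>2 < q" using q(2) c(3) by linarith
  then show ?thesis using q(1) by (auto simp: J_def)
qed

lemma J_props:
  assumes "s \<in> J" shows "s \<in> I" "\<phi> s - s * deriv \<phi> s > 0"
proof -
  obtain q where q: "q \<in> BB" "s\<^sup>2 < q" using assms by (auto simp: J_def)
  obtain c x where cx: "c \<in> A" "x \<in> chart_image c" and qx: "q = normsq a b c x" by (rule BB_E[OF q(1)])
  have "s\<^sup>2 \<le> normsq a b c x" using q qx by simp
  from point_props(1,2)[OF cx this] show "s \<in> I" "\<phi> s - s * deriv \<phi> s > 0" .
qed

lemma s_values_props:
  assumes "s \<in> s_values A a b" shows "s \<in> I" "\<phi> s - s * deriv \<phi> s > 0"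
proof -
  obtain c x where cx: "c \<in> A" "x \<in> chart_image c" "s\<^sup>2 \<le> normsq a b c x" by (rule s_values_E[OF assms])
  from point_props(1,2)[OF cx] show "s \<in> I" "\<phi> s - s * deriv \<phi> s > 0" .
qed

lemma extend_to_s_values:
  fixes \<Psi> :: "real \<Rightarrow> real"
  assumes s: "s \<in> s_values A a b" and c: "isCont \<Psi> s" and z: "\<And>p. p \<in> J \<Longrightarrow> \<Psi> p = 0"
  shows "\<Psi> s = 0"
proof -
  define X where "X n = (1 + - inverse (real (Suc n))) * s" for n
  have "(\<lambda>n. (1 + - inverse (real (Suc n))) * s) \<longlonglongrightarrow> 1 * s"
    by (rule tendsto_mult[OF LIMSEQ_inverse_real_of_nat_add_minus tendsto_const])
  then have X: "X \<longlonglongrightarrow> s" unfolding X_def[abs_def] by simp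
  have "X n \<in> J" for n
    unfolding X_def by (rule scaled_in_J[OF s]) (simp_all add: inverse_le_1_iff)
  then have "\<Psi> (X n) = 0" for n by (rule z)
  moreover have "(\<lambda>n. \<Psi> (X n)) \<longlonglongrightarrow> \<Psi> s" using isCont_tendsto_compose[OF c X] .
  ultimately show ?thesis by (simp add: LIMSEQ_const_iff)
qed

lemma phi_derivs:
  assumes "s \<in> I"
  shows "(\<phi> has_real_derivative deriv \<phi> s) (at s)" "(deriv \<phi> has_real_derivative deriv (deriv \<phi>) s) (at s)"
    "isCont (deriv (deriv \<phi>)) s"
proof -
  have sm: "smooth_on I \<phi>" using ab unfolding alpha_beta_metric_def I_def by blast
  note sm1 = smooth_on_deriv[OF open_I sm]
  note sm2 = smooth_on_deriv[OF open_I sm1]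
  show "(\<phi> has_real_derivative deriv \<phi> s) (at s)" by (rule smooth_on_has_real_derivative[OF sm assms])
  show "(deriv \<phi> has_real_derivative deriv (deriv \<phi>) s) (at s)" by (rule smooth_on_has_real_derivative[OF sm1 assms])
  show "isCont (deriv (deriv \<phi>)) s" by (rule DERIV_isCont[OF smooth_on_has_real_derivative[OF sm2 assms]])
qed

lemma rho_eq: "rho s = deriv (deriv \<phi>) s / (\<phi> s - s * deriv \<phi> s)"
proof -
  obtain c x where c: "c \<in> A" using BB_positive by (auto simp: BB_def)
  interpret c: ab_chart a c "chart_image c" b \<phi> I k1 k2 k3 "tau \<circ> chart_inv c" "lam \<circ> chart_inv c" by (rule chart[OF c])
  show ?thesis by (rule c.rho_def)
qed

text \<open>Positivity of \<open>1 + k s\<^sup>2\<close> is part of the Randers type. It holds because \<open>1 + k s\<^sup>2 = 0\<close> together with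
  \<open>\<rho> (1 + k s\<^sup>2) = k\<close> would give \<open>k = 0\<close>.\<close>

lemma randers_case:
  assumes "\<And>s. s \<in> J \<Longrightarrow> rho s * (1 + k * s\<^sup>2) = k"
  shows "randers_type A a b \<phi>"
proof -
  have eqJ: "deriv (deriv \<phi>) s * (1 + k * s\<^sup>2) - k * (\<phi> s - s * deriv \<phi> s) = 0" if "s \<in> J" for s
    using assms[OF that] J_props(2)[OF that] unfolding rho_eq by (simp add: field_simps)
  have eq: "deriv (deriv \<phi>) s * (1 + k * s\<^sup>2) - k * (\<phi> s - s * deriv \<phi> s) = 0" if s: "s \<in> s_values A a b" for s
  proof (rule extend_to_s_values[OF s _ eqJ])
    have "isCont \<phi> s" "isCont (deriv \<phi>) s" "isCont (deriv (deriv \<phi>)) s"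
      using phi_derivs[OF s_values_props(1)[OF s]] DERIV_isCont by blast+
    then show "isCont (\<lambda>s. deriv (deriv \<phi>) s * (1 + k * s\<^sup>2) - k * (\<phi> s - s * deriv \<phi> s)) s"
      by (intro continuous_intros)
  qed
  have nzJ: "1 + k * s\<^sup>2 \<noteq> 0" if "s \<in> J" for s
    using J_props(2)[OF that] assms[OF that] by (cases "k = 0") auto
  have between: "\<exists>r. 0 \<le> r \<and> r < 1 \<and> 1 + k * (r * s)\<^sup>2 = 0" if neg: "1 + k * s\<^sup>2 < 0" for s
  proof -
    define m where "m = - (k * s\<^sup>2)"
    have m: "m > 1" using neg by (simp add: m_def)
    have "(sqrt (1 / m))\<^sup>2 = 1 / m" using m by simp
    then have "1 + k * (sqrt (1 / m) * s)\<^sup>2 = 1 - (1 / m) * m" by (simp add: power_mult_distrib m_def)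
    also have "\<dots> = 0" using m by simp
    finally show ?thesis using m by (intro exI[of _ "sqrt (1 / m)"]) simp
  qed
  have posJ: "1 + k * s\<^sup>2 > 0" if s: "s \<in> J" for s
  proof (rule ccontr)
    assume "\<not> 1 + k * s\<^sup>2 > 0"
    then have "1 + k * s\<^sup>2 < 0" using nzJ[OF s] by linarith
    then obtain r where r: "0 \<le> r" "r < 1" "1 + k * (r * s)\<^sup>2 = 0" using between by blast
    have "\<bar>r * s\<bar> \<le> \<bar>s\<bar>" using r by (simp add: abs_mult mult_left_le_one_le)
    then show False using nzJ[OF J_mono[OF s]] r(3) by blast
  qed
  have pos: "1 + k * s\<^sup>2 > 0" if s: "s \<in> s_values A a b" for s
  proof (rule ccontr)
    assume np: "\<not> 1 + k * s\<^sup>2 > 0"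
    have "1 + k * s\<^sup>2 \<noteq> 0"
    proof
      assume 0: "1 + k * s\<^sup>2 = 0"
      have "k * (\<phi> s - s * deriv \<phi> s) = 0" using eq[OF s] unfolding 0 by simp
      then have "k = 0" using s_values_props(2)[OF s] by simp
      then show False using 0 by simp
    qed
    then have "1 + k * s\<^sup>2 < 0" using np by linarith
    then obtain r where r: "0 \<le> r" "r < 1" "1 + k * (r * s)\<^sup>2 = 0" using between by blast
    then show False using nzJ[OF scaled_in_J[OF s r(1,2)]] by blast
  qed
  have form: "\<phi> s - (deriv \<phi> 0 * s + sqrt (1 + k * s\<^sup>2)) = 0" if s: "s \<in> J" for s
  proof -
    have "\<phi> s = deriv \<phi> 0 * s + sqrt (1 + k * s\<^sup>2)"
    proof (rule randers_solution[of s \<phi> "deriv \<phi>" "deriv (deriv \<phi>)" k])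
      fix p assume "\<bar>p\<bar> \<le> \<bar>s\<bar>"
      then have p: "p \<in> J" by (rule J_mono[OF s])
      show "(\<phi> has_real_derivative deriv \<phi> p) (at p)" "(deriv \<phi> has_real_derivative deriv (deriv \<phi>) p) (at p)"
        by (rule phi_derivs[OF J_props(1)[OF p]])+
      show "1 + k * p\<^sup>2 > 0" by (rule posJ[OF p])
      show "deriv (deriv \<phi>) p * (1 + k * p\<^sup>2) = k * (\<phi> p - p * deriv \<phi> p)" using eqJ[OF p] by simp
    qed (rule phi0)
    then show ?thesis by simp
  qed
  have "\<phi> s = deriv \<phi> 0 * s + sqrt (1 + k * s\<^sup>2)" if s: "s \<in> s_values A a b" for s
  proof -
    have "\<phi> s - (deriv \<phi> 0 * s + sqrt (1 + k * s\<^sup>2)) = 0"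
    proof (rule extend_to_s_values[OF s _ form])
      have "isCont \<phi> s" using phi_derivs(1)[OF s_values_props(1)[OF s]] DERIV_isCont by blast
      then show "isCont (\<lambda>s. \<phi> s - (deriv \<phi> 0 * s + sqrt (1 + k * s\<^sup>2))) s" by (intro continuous_intros)
    qed
    then show ?thesis by simp
  qed
  then show ?thesis unfolding randers_type_def using pos by blast
qed

lemma sig_case:
  assumes sig: "\<And>s. s \<in> J \<Longrightarrow> R.sig s = 0" and s: "s \<in> s_values A a b"
  shows "(1 + (k1 + k3) * s\<^sup>2 + k2 * s^4) * deriv (deriv \<phi>) s - (k1 + k2 * s\<^sup>2) * (\<phi> s - s * deriv \<phi> s) = 0"
proof (rule extend_to_s_values[OF s])
  have "isCont \<phi> s" "isCont (deriv \<phi>) s" "isCont (deriv (deriv \<phi>)) s"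
    using phi_derivs[OF s_values_props(1)[OF s]] DERIV_isCont by blast+
  then show "isCont (\<lambda>s. (1 + (k1 + k3) * s\<^sup>2 + k2 * s^4) * deriv (deriv \<phi>) s - (k1 + k2 * s\<^sup>2) * (\<phi> s - s * deriv \<phi> s)) s"
    by (intro continuous_intros)
  fix p assume p: "p \<in> J"
  have "R.D (p\<^sup>2) * rho p = R.kap p" using sig[OF p] by (simp add: R.sig_def)
  then have "R.D (p\<^sup>2) * deriv (deriv \<phi>) p = R.kap p * (\<phi> p - p * deriv \<phi> p)"
    using J_props(2)[OF p] unfolding rho_eq by (simp add: field_simps)
  then show "(1 + (k1 + k3) * p\<^sup>2 + k2 * p^4) * deriv (deriv \<phi>) p - (k1 + k2 * p\<^sup>2) * (\<phi> p - p * deriv \<phi> p) = 0"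
    by (simp add: R.D_def R.kap_def)
qed

end

theorem theorem3p2:
  fixes M :: "'m topology" and A :: "('m, 'n::finite) chart set"
    and a :: "('m, 'n) form2" and b :: "('m, 'n) form1"
    and \<phi> :: "real \<Rightarrow> real" and bo :: ereal
    and k1 k2 k3 :: real and lam tau :: "'m \<Rightarrow> real"
  assumes dim: "CARD('n) \<ge> 3"
    and manifold: "smooth_manifold M A" "connected_space M"
    and ab: "alpha_beta_metric A a b \<phi> bo"
    and phi0: "\<phi> 0 = 1"
    and not_randers: "\<not> randers_type A a b \<phi>"
    and not_parallel: "\<not> parallel A a b"
    and scalar: "scalar_flag_curvature A (ab_metric a b \<phi>)"
    and k: "k2 \<noteq> k1 * k3"
    and smooth: "smooth_function A lam" "smooth_function A tau"
    and cov: "\<And>c x i j. c \<in> A \<Longrightarrow> x \<in> chart_image c \<Longrightarrow>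
        cov_deriv a b c i j x =
        tau (chart_inv c x) *
          ((1 + k1 * normsq a b c x) * a c x $ i $ j
           + (k2 * normsq a b c x + k3) * b c x $ i * b c x $ j)"
    and curv: "\<And>c x y i k. c \<in> A \<Longrightarrow> x \<in> chart_image c \<Longrightarrow> y \<noteq> 0 \<Longrightarrow>
        riemann_curv (alpha a c) i k x y =
        lam (chart_inv c x) * ((alpha a c x y)\<^sup>2 * kron i k - y $ i * y_low a c x y k)
        + eta_coeff k1 k2 k3 (normsq a b c x) (tau (chart_inv c x)) (lam (chart_inv c x)) *
          ((beta b c x y)\<^sup>2 * kron i k + (alpha a c x y)\<^sup>2 * b_up a b c x i * b c x $ k
           - beta b c x y * b_up a b c x i * y_low a c x y k
           - beta b c x y * b c x $ k * y $ i)"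
    and dtau: "\<And>c x i. c \<in> A \<Longrightarrow> x \<in> chart_image c \<Longrightarrow>
        pd i (tau \<circ> chart_inv c) x =
        q_coeff k1 k3 (normsq a b c x) (tau (chart_inv c x)) (lam (chart_inv c x)) * b c x $ i"
  shows "\<forall>s\<in>s_values A a b.
           (1 + (k1 + k3) * s\<^sup>2 + k2 * s^4) * deriv (deriv \<phi>) s =
           (k1 + k2 * s\<^sup>2) * (\<phi> s - s * deriv \<phi> s)"
proof -
  interpret ab_manifold M A a b \<phi> bo k1 k2 k3 lam tau
    by (rule ab_manifold.intro[OF dim manifold ab phi0 not_parallel scalar k smooth(2) cov curv dtau])
  have sig0: "R.sig s = 0" if "s \<in> J" for s
    using sig_zero_or_randers
  proof
    assume "\<forall>s\<in>J. R.sig s = 0"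
    then show ?thesis using that by blast
  next
    assume "\<exists>k. \<forall>s\<in>J. rho s * (1 + k * s\<^sup>2) = k"
    then obtain k where "\<And>s. s \<in> J \<Longrightarrow> rho s * (1 + k * s\<^sup>2) = k" by blast
    from randers_case[OF this] not_randers show ?thesis by contradiction
  qed
  show ?thesis
  proof
    fix s assume "s \<in> s_values A a b"
    from sig_case[OF sig0 this]
    show "(1 + (k1 + k3) * s\<^sup>2 + k2 * s^4) * deriv (deriv \<phi>) s = (k1 + k2 * s\<^sup>2) * (\<phi> s - s * deriv \<phi> s)"
      by (simp only: right_minus_eq)
  qed
qed

end
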